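(* There exist absolute constants $c_2,c_3>0$ such that for every $n\ge 1$, every symmetric convex body $K$ in $\mathbf{R}^n$, every orthonormal basis $\{e_1,\ldots,e_n\}$ of $\mathbf{R}^n$ and every $\theta\in(0,1)$ there exists $\sigma\subseteq\{1,\ldots,n\}$ with $|\sigma|\ge(1-\theta)n$ such that $$\mathcal{P}_{\sigma}(K)\supseteq\frac{1}{[c_2\,vr(K)]^{\frac{c_3\log(2/\theta)}{\theta}}\,M_K}\,D_{\sigma}.$$
   Context: $\mathbf{R}^n$ carries an inner product $\langle\cdot,\cdot\rangle$ with Euclidean norm $|\cdot|$, unit ball $D_n$ and unit sphere $S^{n-1}$. A symmetric convex body $K$ induces the norm $\|\cdot\|_K$ with unit ball $K$; $M_K=\left(\int_{S^{n-1}}\|x\|_K^2\,d\mu(x)\right)^{1/2}$, where $\mu$ is the rotationally invariant probability measure on $S^{n-1}$. The volume ratio of $K$ is $vr(K)=(|K|/|E|)^{1/n}$, where $E$ is the ellipsoid of maximal volume contained in $K$ and $|\cdot|$ applied to a body denotes volume. For $\sigma\subseteq\{1,\ldots,n\}$, $|\sigma|$ is its cardinality, $\mathbf{R}^{\sigma}=\{x\in\mathbf{R}^n:\langle x,e_j\rangle=0\text{ if }j\notin\sigma\}$, $\mathcal{P}_{\sigma}$ is the orthogonal projection onto $\mathbf{R}^{\sigma}$, and $D_{\sigma}=D_n\cap\mathbf{R}^{\sigma}$. *)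

theory Defs
  imports "HOL-Analysis.Analysis" "HOL-Probability.Probability_Measure"
begin

text \<open>
  The dimension is quantified inside the statement (the constants do not depend on it), so
  \<open>R^n\<close> is the carrier of the library's \<^const>\<open>Euclidean_space\<close>: the functions
  \<open>nat \<Rightarrow> real\<close> that vanish from index \<open>n\<close> on. Coordinates and basis vectors are
  indexed by \<open>0, ..., n - 1\<close>.
\<close>

abbreviation Rn :: "nat \<Rightarrow> (nat \<Rightarrow> real) set" where
  "Rn n \<equiv> topspace (Euclidean_space n)"

definition inner_n :: "nat \<Rightarrow> (nat \<Rightarrow> real) \<Rightarrow> (nat \<Rightarrow> real) \<Rightarrow> real" where
  "inner_n n x y = (\<Sum>i<n. x i * y i)"

definition norm_n :: "nat \<Rightarrow> (nat \<Rightarrow> real) \<Rightarrow> real" where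
  "norm_n n x = sqrt (inner_n n x x)"

definition unit_ball :: "nat \<Rightarrow> (nat \<Rightarrow> real) set" where
  "unit_ball n = {x \<in> Rn n. norm_n n x \<le> 1}"

definition unit_sphere :: "nat \<Rightarrow> (nat \<Rightarrow> real) set" where
  "unit_sphere n = {x \<in> Rn n. norm_n n x = 1}"

definition linear_n :: "nat \<Rightarrow> ((nat \<Rightarrow> real) \<Rightarrow> (nat \<Rightarrow> real)) \<Rightarrow> bool" where
  "linear_n n T \<longleftrightarrow> T \<in> Rn n \<rightarrow> Rn n \<and>
     (\<forall>x\<in>Rn n. \<forall>y\<in>Rn n. T (\<lambda>i. x i + y i) = (\<lambda>i. T x i + T y i)) \<and>
     (\<forall>a. \<forall>x\<in>Rn n. T (\<lambda>i. a * x i) = (\<lambda>i. a * T x i))"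

definition orthogonal_n :: "nat \<Rightarrow> ((nat \<Rightarrow> real) \<Rightarrow> (nat \<Rightarrow> real)) \<Rightarrow> bool" where
  "orthogonal_n n U \<longleftrightarrow> linear_n n U \<and>
     (\<forall>x\<in>Rn n. \<forall>y\<in>Rn n. inner_n n (U x) (U y) = inner_n n x y)"

text \<open>
  The points of the product measure are \<^const>\<open>undefined\<close> instead of \<open>0\<close> outside
  \<open>{..<n}\<close>; \<^const>\<open>restrict\<close> translates between the two conventions.
\<close>

definition vol :: "nat \<Rightarrow> (nat \<Rightarrow> real) set \<Rightarrow> real" where
  "vol n A = measure (\<Pi>\<^sub>M i\<in>{..<n}. lborel) ((\<lambda>x. restrict x {..<n}) ` A)"

definition convex_n :: "(nat \<Rightarrow> real) set \<Rightarrow> bool" where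
  "convex_n K \<longleftrightarrow> (\<forall>x\<in>K. \<forall>y\<in>K. \<forall>t\<in>{0..1}. (\<lambda>i. (1 - t) * x i + t * y i) \<in> K)"

definition symmetric_convex_body :: "nat \<Rightarrow> (nat \<Rightarrow> real) set \<Rightarrow> bool" where
  "symmetric_convex_body n K \<longleftrightarrow>
     compactin (Euclidean_space n) K \<and> Euclidean_space n interior_of K \<noteq> {} \<and>
     convex_n K \<and> (\<forall>x\<in>K. (\<lambda>i. - x i) \<in> K)"

definition body_norm :: "(nat \<Rightarrow> real) set \<Rightarrow> (nat \<Rightarrow> real) \<Rightarrow> real" where
  "body_norm K x = Inf {t. t > 0 \<and> (\<lambda>i. x i / t) \<in> K}"

text \<open>
  Invariance is required under the full orthogonal group: for \<open>n = 1\<close> the special orthogonal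
  group is trivial and would not determine the measure.
\<close>

definition rotation_invariant_prob :: "nat \<Rightarrow> (nat \<Rightarrow> real) measure \<Rightarrow> bool" where
  "rotation_invariant_prob n \<mu> \<longleftrightarrow>
     prob_space \<mu> \<and> sets \<mu> = sets (restrict_space borel (unit_sphere n)) \<and>
     (\<forall>U. orthogonal_n n U \<longrightarrow> distr \<mu> \<mu> U = \<mu>)"

definition sphere_measure :: "nat \<Rightarrow> (nat \<Rightarrow> real) measure" where
  "sphere_measure n = (THE \<mu>. rotation_invariant_prob n \<mu>)"

definition M_body :: "nat \<Rightarrow> (nat \<Rightarrow> real) set \<Rightarrow> real" where
  "M_body n K = sqrt (LINT x|sphere_measure n. (body_norm K x)\<^sup>2)"

definition ellipsoid :: "nat \<Rightarrow> (nat \<Rightarrow> real) set \<Rightarrow> bool" where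
  "ellipsoid n E \<longleftrightarrow>
     (\<exists>T. \<exists>v\<in>Rn n. linear_n n T \<and> bij_betw T (Rn n) (Rn n) \<and>
        E = (\<lambda>x i. v i + T x i) ` unit_ball n)"

definition max_volume_ellipsoid :: "nat \<Rightarrow> (nat \<Rightarrow> real) set \<Rightarrow> (nat \<Rightarrow> real) set \<Rightarrow> bool" where
  "max_volume_ellipsoid n K E \<longleftrightarrow> ellipsoid n E \<and> E \<subseteq> K \<and>
     (\<forall>E'. ellipsoid n E' \<and> E' \<subseteq> K \<longrightarrow> vol n E' \<le> vol n E)"

text \<open>The choice of \<open>E\<close> does not affect the value: all maximizers have the same volume.\<close>

definition vr :: "nat \<Rightarrow> (nat \<Rightarrow> real) set \<Rightarrow> real" where
  "vr n K = (vol n K / vol n (SOME E. max_volume_ellipsoid n K E)) powr (1 / real n)"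

definition orthonormal_basis :: "nat \<Rightarrow> (nat \<Rightarrow> nat \<Rightarrow> real) \<Rightarrow> bool" where
  "orthonormal_basis n e \<longleftrightarrow>
     (\<forall>j<n. e j \<in> Rn n) \<and>
     (\<forall>j<n. \<forall>k<n. inner_n n (e j) (e k) = (if j = k then 1 else 0)) \<and>
     (\<forall>x\<in>Rn n. \<exists>c. x = (\<lambda>i. \<Sum>j<n. c j * e j i))"

definition coord_subspace :: "nat \<Rightarrow> (nat \<Rightarrow> nat \<Rightarrow> real) \<Rightarrow> nat set \<Rightarrow> (nat \<Rightarrow> real) set" where
  "coord_subspace n e \<sigma> = {x \<in> Rn n. \<forall>j<n. j \<notin> \<sigma> \<longrightarrow> inner_n n x (e j) = 0}"

definition orth_proj :: "nat \<Rightarrow> (nat \<Rightarrow> real) set \<Rightarrow> (nat \<Rightarrow> real) \<Rightarrow> (nat \<Rightarrow> real)" where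
  "orth_proj n S x = (THE y. y \<in> S \<and> (\<forall>z\<in>S. inner_n n (\<lambda>i. x i - y i) z = 0))"

end

theory Submission
  imports Defs
begin

text \<open>
  Let \<open>A = vr K\<close>, \<open>M = M\<^sub>K\<close>, let \<open>E \<subseteq> K\<close> be the maximal volume ellipsoid translated to the
  origin (allowed by symmetry), with half-axes \<open>a\<^sub>i\<close>, and let \<open>T\<close> be the positive map with
  \<open>T D = E\<close>. By Markov's inequality a proportion \<open>8/9\<close> of the ball \<open>D\<close> lies in \<open>3 M K\<close>, and
  \<open>1 + M T\<close> maps this part into \<open>4 M K\<close>. Comparing volumes gives
  \<open>\<Prod>i. (1 + 1 / (M a\<^sub>i)) \<le> (5 A)\<^sup>n\<close>, so all but \<open>\<theta> n / 4\<close> of the half-axes are at least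
  \<open>\<rho> = 1 / ((5 A) powr (4 / \<theta>) M)\<close>.

  Let \<open>G\<close> be the span of the short axes. Starting from all coordinates and deleting them one at a
  time, with a barrier argument in the style of Batson, Spielman and Srivastava, one finds at most
  \<open>\<theta> n\<close> coordinates \<open>\<tau>\<close> such that restricting vectors of \<open>G\<close> to \<open>\<tau>\<close> shrinks squared norms at most
  by the factor \<open>\<theta> / 4\<close>. For \<open>\<sigma>\<close> the complement of \<open>\<tau>\<close>, every vector of \<open>D\<^sub>\<sigma>\<close> then becomes
  orthogonal to \<open>G\<close> after adding a vector supported on \<open>\<tau>\<close> whose size is controlled by \<open>\<theta>\<close>; a
  multiple \<open>\<rho> / sqrt (1 + 4 / \<theta>)\<close> of the sum lies in \<open>E\<close>. This bound is stronger than the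
  one claimed.
\<close>

subsection \<open>Diagonalisation of symmetric matrices\<close>

text \<open>The subspaces are prescribed by the basis, so no random or generic choice of a subspace
  is available. What has to be found is a small set of rows of an isometry on which a lower bound
  survives, a restricted invertibility problem. Selecting \<open>\<tau>\<close> instead of
  \<open>\<sigma>\<close> turns projecting into correcting: a vector supported on
  \<open>\<tau>\<close> is invisible to the projection onto the coordinates in
  \<open>\<sigma>\<close>, so it may be added freely to push a vector off the short axes. The volume
  comparison uses a linear map because its determinant is an explicit product over the half-axes;
  one factor per axis is what allows short axes to be counted. The short axes cost the exponent
  \<open>4 / \<theta>\<close>. The logarithm in the claimed exponent pays only for
  \<open>sqrt (1 + 4 / \<theta>)\<close>, which works because the base is at least 5, hence above e.
  Much of the work comes from definitions by description: \<open>sphere_measure\<close> is a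
  \<open>THE\<close>, so the invariant probability must be shown to exist and to be unique, and
  \<open>vr\<close> is built on a \<open>SOME\<close>, so a maximal ellipsoid must be shown to
  exist.\<close>

lemma indicator_mult_simps:
  "(if b then 1 else 0) * x = (if b then x else (0::real))"
  "x * (if b then 1 else 0) = (if b then x else (0::real))"
  by auto

text \<open>Tychonoff's theorem for the product topology on function types. It supplies the
  compactness of the orthogonal matrices, of the sphere and of the parameters of ellipsoids.\<close>

lemma compact_Pi_UNIV:
  fixes S :: "'a \<Rightarrow> 'b::topological_space set"
  assumes "\<And>i. compact (S i)"
  shows "compact {f. \<forall>i. f i \<in> S i}"
proof -
  have "compactin (product_topology (\<lambda>i. euclidean) UNIV) (Pi\<^sub>E UNIV S)"
    using assms by (subst compactin_PiE) (auto simp: compactin_euclidean_iff)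
  moreover have "Pi\<^sub>E UNIV S = {f. \<forall>i. f i \<in> S i}" by auto
  ultimately show ?thesis by (simp add: euclidean_product_topology compactin_euclidean_iff)
qed

lemma continuous_on_entry [continuous_intros]:
  "continuous_on S (\<lambda>Q::'a \<Rightarrow> 'b \<Rightarrow> 'c::topological_space. Q i j)"
  by (rule continuous_on_product_then_coordinatewise, rule continuous_on_product_then_coordinatewise,
      rule continuous_on_id)

text \<open>The index set is arbitrary because matrices occur both on all coordinates
  \<open>{..<n}\<close> and on a set \<open>J\<close> of selected axes. Rows and columns are both
  required to be orthonormal, so that transposition is immediate.\<close>

definition orthogonal_mat :: "nat set \<Rightarrow> (nat \<Rightarrow> nat \<Rightarrow> real) \<Rightarrow> bool" where
  "orthogonal_mat I Q \<longleftrightarrow>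
     (\<forall>i\<in>I. \<forall>j\<in>I. (\<Sum>k\<in>I. Q i k * Q j k) = (if i = j then 1 else 0)) \<and>
     (\<forall>i\<in>I. \<forall>j\<in>I. (\<Sum>k\<in>I. Q k i * Q k j) = (if i = j then 1 else 0))"

lemma orthogonal_matD:
  assumes "orthogonal_mat I Q" "i \<in> I" "j \<in> I"
  shows "(\<Sum>k\<in>I. Q i k * Q j k) = (if i = j then 1 else 0)"
    "(\<Sum>k\<in>I. Q k i * Q k j) = (if i = j then 1 else 0)"
  using assms unfolding orthogonal_mat_def by blast+

lemma orthogonal_mat_id: "finite I \<Longrightarrow> orthogonal_mat I (\<lambda>i j. if i = j then 1 else 0)"
  unfolding orthogonal_mat_def by (auto simp: indicator_mult_simps)

lemma orthogonal_mat_transpose: "orthogonal_mat I Q \<Longrightarrow> orthogonal_mat I (\<lambda>i j. Q j i)"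
  unfolding orthogonal_mat_def by blast

lemma orthogonal_mat_le_1:
  assumes "finite I" "orthogonal_mat I Q" "i \<in> I" "j \<in> I"
  shows "\<bar>Q i j\<bar> \<le> 1"
proof -
  have "(Q i j)\<^sup>2 \<le> (\<Sum>k\<in>I. (Q i k)\<^sup>2)"
    by (rule member_le_sum) (use assms in auto)
  also have "\<dots> = 1"
    using orthogonal_matD(1)[OF assms(2), of i i] assms by (simp add: power2_eq_square)
  finally show ?thesis by (simp add: abs_square_le_1)
qed

lemma orthogonal_mat_mult_rows:
  assumes "finite I" "orthogonal_mat I P" "orthogonal_mat I Q" "i \<in> I" "j \<in> I"
  shows "(\<Sum>k\<in>I. (\<Sum>a\<in>I. P i a * Q a k) * (\<Sum>a\<in>I. P j a * Q a k)) = (if i = j then 1 else 0)"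
proof -
  have "(\<Sum>k\<in>I. (\<Sum>a\<in>I. P i a * Q a k) * (\<Sum>a\<in>I. P j a * Q a k))
      = (\<Sum>k\<in>I. \<Sum>a\<in>I. \<Sum>b\<in>I. P i a * P j b * (Q a k * Q b k))"
    by (simp add: sum_product mult_ac)
  also have "\<dots> = (\<Sum>a\<in>I. \<Sum>k\<in>I. \<Sum>b\<in>I. P i a * P j b * (Q a k * Q b k))"
    by (rule sum.swap)
  also have "\<dots> = (\<Sum>a\<in>I. \<Sum>b\<in>I. \<Sum>k\<in>I. P i a * P j b * (Q a k * Q b k))"
    by (rule sum.cong[OF refl], rule sum.swap)
  also have "\<dots> = (\<Sum>a\<in>I. \<Sum>b\<in>I. P i a * P j b * (if a = b then 1 else 0))"
    by (intro sum.cong refl) (simp add: sum_distrib_left[symmetric] orthogonal_matD(1)[OF assms(3)])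
  also have "\<dots> = (\<Sum>a\<in>I. P i a * P j a)"
    using assms(1) by (simp add: indicator_mult_simps)
  finally show ?thesis using orthogonal_matD(1)[OF assms(2,4,5)] by simp
qed

lemma orthogonal_mat_mult:
  assumes "finite I" "orthogonal_mat I P" "orthogonal_mat I Q"
  shows "orthogonal_mat I (\<lambda>i j. \<Sum>a\<in>I. P i a * Q a j)"
  unfolding orthogonal_mat_def
proof (intro conjI ballI)
  fix i j assume ij: "i \<in> I" "j \<in> I"
  show "(\<Sum>k\<in>I. (\<Sum>a\<in>I. P i a * Q a k) * (\<Sum>a\<in>I. P j a * Q a k)) = (if i = j then 1 else 0)"
    by (rule orthogonal_mat_mult_rows[OF assms ij])
  show "(\<Sum>k\<in>I. (\<Sum>a\<in>I. P k a * Q a i) * (\<Sum>a\<in>I. P k a * Q a j)) = (if i = j then 1 else 0)"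
    using orthogonal_mat_mult_rows[OF assms(1) assms(3,2)[THEN orthogonal_mat_transpose] ij]
    by (simp add: mult.commute)
qed

lemma compact_closed_subset:
  fixes S T :: "'a::topological_space set"
  assumes "compact T" "closed S" "S \<subseteq> T"
  shows "compact S"
  using closed_Int_compact[OF assms(2,1)] assms(3) by (simp add: Int_absorb2)

text \<open>\<open>orthogonal_mat\<close> says nothing about entries outside \<open>I\<close>;
  pinning them to 0 makes the set compact, since the remaining entries have absolute value at most
  1.\<close>

lemma compact_orthogonal_mats:
  fixes I :: "nat set"
  assumes "finite I"
  shows "compact {Q. orthogonal_mat I Q \<and> (\<forall>i j. i \<notin> I \<or> j \<notin> I \<longrightarrow> Q i j = 0)}" (is "compact ?S")
proof -
  have "compact {Q::nat \<Rightarrow> nat \<Rightarrow> real. \<forall>i. Q i \<in> {f. \<forall>j. f j \<in> {-1..1}}}"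
    by (intro compact_Pi_UNIV) auto
  moreover have "closed ?S"
  proof -
    have "closed {Q::nat \<Rightarrow> nat \<Rightarrow> real. (\<Sum>k\<in>I. Q i k * Q j k) = c}"
      "closed {Q::nat \<Rightarrow> nat \<Rightarrow> real. (\<Sum>k\<in>I. Q k i * Q k j) = c}"
      "closed {Q::nat \<Rightarrow> nat \<Rightarrow> real. Q i j = c}" for i j c
      by (intro closed_Collect_eq continuous_on_sum continuous_on_mult continuous_on_entry
          continuous_on_const)+
    moreover have "?S = (\<Inter>i\<in>I. \<Inter>j\<in>I. {Q. (\<Sum>k\<in>I. Q i k * Q j k) = (if i = j then 1 else 0)}
        \<inter> {Q. (\<Sum>k\<in>I. Q k i * Q k j) = (if i = j then 1 else 0)})
        \<inter> (\<Inter>i. \<Inter>j\<in>{j. i \<notin> I \<or> j \<notin> I}. {Q. Q i j = 0})"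
      unfolding orthogonal_mat_def by auto
    ultimately show ?thesis by (simp add: closed_INT closed_Int)
  qed
  moreover have "?S \<subseteq> {Q. \<forall>i. Q i \<in> {f. \<forall>j. f j \<in> {-1..1}}}"
  proof clarify
    fix Q i j assume *: "orthogonal_mat I Q" "\<forall>i j. i \<notin> I \<or> j \<notin> I \<longrightarrow> Q i j = 0"
    show "Q i j \<in> {-1..1}"
    proof (cases "i \<in> I \<and> j \<in> I")
      case True
      then show ?thesis using orthogonal_mat_le_1[OF assms *(1), of i j] by auto
    qed (use * in auto)
  qed
  ultimately show ?thesis by (rule compact_closed_subset)
qed

text \<open>This is the limit \<open>t\<close> to 0 of the hypothesis. If \<open>b\<close> were
  positive, the explicit \<open>t\<close> makes \<open>t * \<bar>d\<bar>\<close> at most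
  \<open>b / 2\<close> while \<open>(1 - t\<^sup>2) * b\<close> is still at least
  \<open>3 / 4 * b\<close>.\<close>

lemma nonpos_of_rotation_inequality:
  fixes b d :: real
  assumes "\<And>t. t > 0 \<Longrightarrow> t * d + (1 - t\<^sup>2) * b \<le> 0"
  shows "b \<le> 0"
proof (rule ccontr)
  assume "\<not> b \<le> 0"
  define t where "t = min (1/2) (b / (2 * (\<bar>d\<bar> + 1)))"
  have "b / (2 * (\<bar>d\<bar> + 1)) > 0"
    using \<open>\<not> b \<le> 0\<close> by (intro divide_pos_pos) auto
  then have t: "t > 0" unfolding t_def by simp
  have t2: "t \<le> 1/2" and t3: "t \<le> b / (2 * (\<bar>d\<bar> + 1))"
    unfolding t_def by (rule min.cobounded1, rule min.cobounded2)
  have "t * (2 * (\<bar>d\<bar> + 1)) \<le> b"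
    using t3 by (simp add: pos_le_divide_eq)
  then have "t * \<bar>d\<bar> \<le> b / 2" using t by (simp add: algebra_simps)
  moreover have "t * d \<ge> - (t * \<bar>d\<bar>)"
    using t by (metis abs_ge_minus_self abs_mult abs_of_pos minus_le_iff)
  moreover have "t\<^sup>2 \<le> 1/4" using power_mono[OF t2, of 2] t by (simp add: power2_eq_square)
  then have "(1 - t\<^sup>2) * b \<ge> 3/4 * b" using \<open>\<not> b \<le> 0\<close> by (intro mult_right_mono) auto
  ultimately show False using assms[OF t] \<open>\<not> b \<le> 0\<close> by linarith
qed

lemma sum_remove2:
  assumes "finite I" "p \<in> I" "q \<in> I" "p \<noteq> q"
  shows "sum f I = f p + f q + sum f (I - {p, q})"
proof -
  have "sum f I = f p + (f q + sum f (I - {p} - {q}))"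
    using assms sum.remove[of I p f] sum.remove[of "I - {p}" q f] by simp
  then show ?thesis by (simp add: Diff_insert2[symmetric] add.assoc)
qed

definition bil :: "nat set \<Rightarrow> (nat \<Rightarrow> nat \<Rightarrow> real) \<Rightarrow> (nat \<Rightarrow> real) \<Rightarrow> (nat \<Rightarrow> real) \<Rightarrow> real" where
  "bil I A x y = (\<Sum>k\<in>I. \<Sum>l\<in>I. x k * A k l * y l)"

lemma bil_lincomb:
  "bil I A (\<lambda>k. c * x k + s * y k) z = c * bil I A x z + s * bil I A y z"
  "bil I A z (\<lambda>k. c * x k + s * y k) = c * bil I A z x + s * bil I A z y"
  by (simp_all add: bil_def sum_distrib_left sum.distrib algebra_simps)

lemma bil_sym:
  assumes "\<And>i j. i \<in> I \<Longrightarrow> j \<in> I \<Longrightarrow> A i j = A j i"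
  shows "bil I A x y = bil I A y x"
proof -
  have "bil I A x y = (\<Sum>l\<in>I. \<Sum>k\<in>I. x k * A k l * y l)"
    unfolding bil_def by (rule sum.swap)
  also have "\<dots> = bil I A y x"
    unfolding bil_def using assms by (intro sum.cong refl) simp
  finally show ?thesis .
qed

text \<open>A maximiser over the orthogonal group of the weighted trace
  \<open>\<Sum>i. i * bil A (row i) (row i)\<close> diagonalises \<open>A\<close>: rotating two rows by a small angle
  changes the value to first order by a multiple of their off-diagonal entry.\<close>
lemma symmetric_mat_diagonalizable:
  assumes I: "finite I" and sym: "\<And>i j. i \<in> I \<Longrightarrow> j \<in> I \<Longrightarrow> A i j = A j i"
  obtains Q where "orthogonal_mat I Q" "\<And>i j. i \<in> I \<Longrightarrow> j \<in> I \<Longrightarrow> i \<noteq> j \<Longrightarrow> bil I A (Q i) (Q j) = 0"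
proof -
  define S where "S = {Q. orthogonal_mat I Q \<and> (\<forall>i j. i \<notin> I \<or> j \<notin> I \<longrightarrow> Q i j = 0)}"
  define \<Phi> where "\<Phi> Q = (\<Sum>i\<in>I. real i * bil I A (Q i) (Q i))" for Q
  have "compact S" unfolding S_def by (rule compact_orthogonal_mats[OF I])
  moreover have "(\<lambda>i j. if i = j \<and> i \<in> I then 1 else 0) \<in> S"
    using orthogonal_mat_id[OF I] unfolding S_def orthogonal_mat_def
    by (simp add: indicator_mult_simps)
  moreover have "continuous_on S \<Phi>"
  proof -
    show ?thesis unfolding \<Phi>_def bil_def by (intro continuous_intros)
  qed
  ultimately obtain Q where Q: "Q \<in> S" and max: "\<And>P. P \<in> S \<Longrightarrow> \<Phi> P \<le> \<Phi> Q"
    using continuous_attains_sup[of S \<Phi>] by blast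
  have orth: "orthogonal_mat I Q" using Q S_def by blast
  have "bil I A (Q p) (Q q) = 0" if pq: "p \<in> I" "q \<in> I" "p < q" for p q
  proof -
    define a b d where "a = bil I A (Q p) (Q p)" and "b = bil I A (Q p) (Q q)"
      and "d = bil I A (Q q) (Q q)"
    have ne: "p \<noteq> q" using pq by simp
    \<comment> \<open>Rotating rows \<open>p\<close> and \<open>q\<close> with cosine
      \<open>c\<close> and sine \<open>s\<close> changes \<open>\<Phi>\<close> by
      \<open>q - p\<close> times this left side. The weights in the trace must therefore differ from
      row to row, and \<open>p < q\<close> fixes the sign.\<close>
    have key: "s\<^sup>2 * (a - d) - 2 * c * s * b \<le> 0" if cs: "c\<^sup>2 + s\<^sup>2 = 1" for c s :: real
    proof -
      define P where "P = Q(p := (\<lambda>k. c * Q p k + s * Q q k), q := (\<lambda>k. (-s) * Q p k + c * Q q k))"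
      have cs1: "c * c + s * s = 1" using cs by (simp add: power2_eq_square)
      have Pp: "P p = (\<lambda>k. c * Q p k + s * Q q k)" and Pq: "P q = (\<lambda>k. (-s) * Q p k + c * Q q k)"
        and Po: "\<And>i. i \<noteq> p \<Longrightarrow> i \<noteq> q \<Longrightarrow> P i = Q i"
        using ne by (auto simp: P_def)
      define g where "g x y = (\<Sum>k\<in>I. x k * y k)" for x y :: "nat \<Rightarrow> real"
      have gl: "g (\<lambda>k. c1 * x k + s1 * y k) z = c1 * g x z + s1 * g y z"
        "g z (\<lambda>k. c1 * x k + s1 * y k) = c1 * g z x + s1 * g z y" for c1 s1 x y z
        by (simp_all add: g_def sum_distrib_left sum.distrib algebra_simps)
      have gQ: "g (Q i) (Q j) = (if i = j then 1 else 0)" if "i \<in> I" "j \<in> I" for i j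
        using orthogonal_matD(1)[OF orth that] by (simp add: g_def)
      note gQ' = gQ[OF pq(1) pq(1)] gQ[OF pq(2) pq(2)] gQ[OF pq(1) pq(2)] gQ[OF pq(2) pq(1)]
      have "g (P i) (P j) = (if i = j then 1 else 0)" if ij: "i \<in> I" "j \<in> I" for i j
      proof -
        have 1: "g (P p) (P p) = 1" "g (P q) (P q) = 1" "g (P p) (P q) = 0" "g (P q) (P p) = 0"
          unfolding Pp Pq gl gQ' using ne cs1 by (simp_all add: algebra_simps)
        have 2: "g (P p) (P k) = 0" "g (P q) (P k) = 0" "g (P k) (P p) = 0" "g (P k) (P q) = 0"
          if k: "k \<in> I" "k \<noteq> p" "k \<noteq> q" for k
          unfolding Pp Pq Po[OF k(2,3)] gl
            gQ[OF pq(1) k(1)] gQ[OF pq(2) k(1)] gQ[OF k(1) pq(1)] gQ[OF k(1) pq(2)]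
          using k by auto
        show ?thesis
        proof (cases "i = p \<or> i = q")
          case True
          then show ?thesis using 1 2[OF ij(2)] ne by (cases "j = p \<or> j = q") auto
        next
          case i: False
          show ?thesis
          proof (cases "j = p \<or> j = q")
            case True
            then show ?thesis using i 2[OF ij(1)] by auto
          next
            case False
            then show ?thesis using i gQ[OF ij] Po by auto
          qed
        qed
      qed
      then have rows: "(\<Sum>k\<in>I. P i k * P j k) = (if i = j then 1 else 0)" if "i \<in> I" "j \<in> I" for i j
        using that unfolding g_def by blast
      have cols: "(\<Sum>k\<in>I. P k i * P k j) = (if i = j then 1 else 0)" if "i \<in> I" "j \<in> I" for i j
      proof -
        have "(\<Sum>k\<in>I. P k i * P k j) = P p i * P p j + P q i * P q j + (\<Sum>k\<in>I-{p,q}. P k i * P k j)"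
          by (rule sum_remove2) (use I pq in auto)
        also have "P p i * P p j + P q i * P q j
            = (c * c + s * s) * (Q p i * Q p j) + (c * c + s * s) * (Q q i * Q q j)"
          by (simp add: Pp Pq algebra_simps)
        also have "\<dots> = Q p i * Q p j + Q q i * Q q j" by (simp add: cs1)
        also have "(\<Sum>k\<in>I-{p,q}. P k i * P k j) = (\<Sum>k\<in>I-{p,q}. Q k i * Q k j)"
          by (intro sum.cong) (auto simp: Po)
        also have "Q p i * Q p j + Q q i * Q q j + (\<Sum>k\<in>I-{p,q}. Q k i * Q k j) = (\<Sum>k\<in>I. Q k i * Q k j)"
          by (rule sum_remove2[symmetric]) (use I pq in auto)
        finally show ?thesis using orthogonal_matD(2)[OF orth that] by simp
      qed
      have "P i j = 0" if "i \<notin> I \<or> j \<notin> I" for i j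
        using that Q pq by (auto simp: P_def S_def)
      then have "P \<in> S" unfolding S_def orthogonal_mat_def using rows cols by auto
      then have "\<Phi> P \<le> \<Phi> Q" by (rule max)
      moreover have "\<Phi> P = real p * bil I A (P p) (P p) + real q * bil I A (P q) (P q)
          + (\<Sum>i\<in>I-{p,q}. real i * bil I A (P i) (P i))"
        unfolding \<Phi>_def by (rule sum_remove2) (use I pq in auto)
      moreover have "(\<Sum>i\<in>I-{p,q}. real i * bil I A (P i) (P i)) = (\<Sum>i\<in>I-{p,q}. real i * bil I A (Q i) (Q i))"
        by (intro sum.cong) (auto simp: Po)
      moreover have "\<Phi> Q = real p * a + real q * d + (\<Sum>i\<in>I-{p,q}. real i * bil I A (Q i) (Q i))"
        unfolding \<Phi>_def a_def d_def by (rule sum_remove2) (use I pq in auto)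
      moreover have "bil I A (P p) (P p) = c\<^sup>2 * a + 2 * c * s * b + s\<^sup>2 * d"
        "bil I A (P q) (P q) = s\<^sup>2 * a - 2 * c * s * b + c\<^sup>2 * d"
        using bil_sym[of I A "Q q" "Q p", OF sym]
        by (simp_all only: Pp Pq bil_lincomb a_def b_def d_def) (simp_all add: algebra_simps power2_eq_square)
      ultimately have "real p * (c\<^sup>2 * a + 2 * c * s * b + s\<^sup>2 * d) + real q * (s\<^sup>2 * a - 2 * c * s * b + c\<^sup>2 * d)
          \<le> real p * a + real q * d" by (simp only: add_le_cancel_right)
      moreover have "real p * (c\<^sup>2 * a + 2 * c * s * b + s\<^sup>2 * d) + real q * (s\<^sup>2 * a - 2 * c * s * b + c\<^sup>2 * d)
         - (real p * a + real q * d) = (real q - real p) * (s\<^sup>2 * (a - d) - 2 * c * s * b)"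
      proof -
        have c2: "c\<^sup>2 = 1 - s\<^sup>2" using cs by simp
        show ?thesis unfolding c2 by (simp add: algebra_simps)
      qed
      ultimately have "(real q - real p) * (s\<^sup>2 * (a - d) - 2 * c * s * b) \<le> 0" by linarith
      then show ?thesis using pq(3) by (simp add: mult_le_0_iff)
    qed
    \<comment> \<open>The rational parametrisation of the circle,
      \<open>c = (1 - t\<^sup>2) / (1 + t\<^sup>2)\<close> and
      \<open>s = 2 * t / (1 + t\<^sup>2)\<close>, avoids square roots. The two signs of
      \<open>t\<close> then give the two inequalities for \<open>b\<close>.\<close>
    have rat: "t * (t * (a - d) - (1 - t\<^sup>2) * b) \<le> 0" for t :: real
    proof -
      have pos: "1 + t\<^sup>2 > 0" by (simp add: add_pos_nonneg)
      have "((1 - t\<^sup>2) / (1 + t\<^sup>2))\<^sup>2 + (2 * t / (1 + t\<^sup>2))\<^sup>2 = ((1 - t\<^sup>2)\<^sup>2 + (2 * t)\<^sup>2) / (1 + t\<^sup>2)\<^sup>2"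
        by (simp add: power_divide add_divide_distrib)
      also have "(1 - t\<^sup>2)\<^sup>2 + (2 * t)\<^sup>2 = (1 + t\<^sup>2)\<^sup>2" by (simp add: power2_eq_square algebra_simps)
      finally have "((1 - t\<^sup>2) / (1 + t\<^sup>2))\<^sup>2 + (2 * t / (1 + t\<^sup>2))\<^sup>2 = 1" using pos by simp
      from key[OF this] have "(2 * t / (1 + t\<^sup>2))\<^sup>2 * (a - d) - 2 * ((1 - t\<^sup>2) / (1 + t\<^sup>2)) * (2 * t / (1 + t\<^sup>2)) * b \<le> 0" .
      moreover have "(2 * t / (1 + t\<^sup>2))\<^sup>2 * (a - d) - 2 * ((1 - t\<^sup>2) / (1 + t\<^sup>2)) * (2 * t / (1 + t\<^sup>2)) * b
        = (4 * (t * (t * (a - d) - (1 - t\<^sup>2) * b))) / (1 + t\<^sup>2)\<^sup>2"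
      proof -
        define D where "D = 1 + t\<^sup>2"
        have "D \<noteq> 0" using pos D_def by simp
        then have "(2 * t / D)\<^sup>2 * (a - d) - 2 * ((1 - t\<^sup>2) / D) * (2 * t / D) * b
            = (4 * t\<^sup>2 * (a - d) - 4 * (1 - t\<^sup>2) * t * b) / D\<^sup>2"
          by (simp add: field_simps power2_eq_square)
        then show ?thesis unfolding D_def by (simp add: algebra_simps power2_eq_square)
      qed
      ultimately have "(4 * (t * (t * (a - d) - (1 - t\<^sup>2) * b))) / (1 + t\<^sup>2)\<^sup>2 \<le> 0" by simp
      then show ?thesis using pos by (simp add: divide_le_0_iff)
    qed
    have "- b \<le> 0"
    proof (rule nonpos_of_rotation_inequality)
      fix t :: real assume "t > 0"
      then show "t * (a - d) + (1 - t\<^sup>2) * (- b) \<le> 0"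
        using rat[of t] by (simp add: mult_le_0_iff)
    qed
    moreover have "b \<le> 0"
    proof (rule nonpos_of_rotation_inequality)
      fix t :: real assume "t > 0"
      then show "t * (a - d) + (1 - t\<^sup>2) * b \<le> 0"
        using rat[of "- t"] by (simp add: zero_le_mult_iff)
    qed
    ultimately show ?thesis by (simp add: b_def)
  qed
  then have "bil I A (Q i) (Q j) = 0" if "i \<in> I" "j \<in> I" "i \<noteq> j" for i j
    using that bil_sym[of I A "Q i" "Q j", OF sym] by (metis linorder_neqE_nat)
  with orth show ?thesis using that by blast
qed

subsection \<open>Selection of coordinates\<close>

lemma orthogonal_mat_expansion:
  assumes "finite I" "orthogonal_mat I P" "a \<in> I"
  shows "(\<Sum>i\<in>I. (\<Sum>c\<in>I. P i c * v c) * P i a) = v a"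
proof -
  have "(\<Sum>i\<in>I. (\<Sum>c\<in>I. P i c * v c) * P i a) = (\<Sum>i\<in>I. \<Sum>c\<in>I. v c * (P i c * P i a))"
    by (simp add: sum_distrib_right sum_distrib_left mult_ac)
  also have "\<dots> = (\<Sum>c\<in>I. \<Sum>i\<in>I. v c * (P i c * P i a))" by (rule sum.swap)
  also have "\<dots> = (\<Sum>c\<in>I. v c * (if c = a then 1 else 0))"
    by (intro sum.cong refl) (simp add: sum_distrib_left[symmetric] orthogonal_matD(2)[OF assms(2)] assms(3))
  also have "\<dots> = v a" using assms by (simp add: indicator_mult_simps)
  finally show ?thesis .
qed

lemma orthogonal_mat_parseval:
  assumes "finite I" "orthogonal_mat I P"
  shows "(\<Sum>i\<in>I. (\<Sum>c\<in>I. P i c * v c)\<^sup>2) = (\<Sum>c\<in>I. (v c)\<^sup>2)"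
proof -
  have "(\<Sum>i\<in>I. (\<Sum>c\<in>I. P i c * v c)\<^sup>2) = (\<Sum>i\<in>I. \<Sum>a\<in>I. v a * ((\<Sum>c\<in>I. P i c * v c) * P i a))"
    by (simp add: power2_eq_square sum_distrib_left sum_distrib_right mult_ac)
  also have "\<dots> = (\<Sum>a\<in>I. \<Sum>i\<in>I. v a * ((\<Sum>c\<in>I. P i c * v c) * P i a))" by (rule sum.swap)
  also have "\<dots> = (\<Sum>a\<in>I. v a * v a)"
    by (intro sum.cong refl) (simp add: sum_distrib_left[symmetric] orthogonal_mat_expansion[OF assms])
  finally show ?thesis by (simp add: power2_eq_square)
qed

text \<open>Expanded in the orthonormal rows, the image of \<open>P i\<close> under \<open>A\<close>
  has the coefficients \<open>bil I A (P j) (P i)\<close>, and only the one with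
  \<open>j = i\<close> survives.\<close>

lemma orthogonal_mat_eigenvector:
  assumes I: "finite I" and P: "orthogonal_mat I P"
    and diag: "\<And>i j. i \<in> I \<Longrightarrow> j \<in> I \<Longrightarrow> i \<noteq> j \<Longrightarrow> bil I A (P i) (P j) = 0"
    and i: "i \<in> I" "a \<in> I"
  shows "(\<Sum>b\<in>I. A a b * P i b) = bil I A (P i) (P i) * P i a"
proof -
  have "(\<Sum>b\<in>I. A a b * P i b) = (\<Sum>j\<in>I. (\<Sum>c\<in>I. P j c * (\<Sum>b\<in>I. A c b * P i b)) * P j a)"
    by (rule orthogonal_mat_expansion[OF I P i(2), symmetric])
  also have "\<dots> = (\<Sum>j\<in>I. bil I A (P j) (P i) * P j a)"
    by (simp add: bil_def sum_distrib_left mult_ac)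
  also have "\<dots> = (\<Sum>j\<in>I. if j = i then bil I A (P i) (P i) * P i a else 0)"
    using diag i by (intro sum.cong) auto
  also have "\<dots> = bil I A (P i) (P i) * P i a" using I i by simp
  finally show ?thesis .
qed

text \<open>The Gram matrix of the columns over the rows in \<open>\<tau>\<close>, that is the sum
  of the rank one matrices of the vectors \<open>z j\<close>, is diagonal with eigenvalues
  \<open>\<mu>\<close>. Always working in an eigenbasis keeps resolvents diagonal, so their traces
  are plain sums of \<open>1 / (\<mu> a - l)\<close>.\<close>

definition frame_diag :: "nat set \<Rightarrow> nat set \<Rightarrow> (nat \<Rightarrow> nat \<Rightarrow> real) \<Rightarrow> (nat \<Rightarrow> real) \<Rightarrow> bool" where
  "frame_diag J \<tau> z \<mu> \<longleftrightarrow> (\<forall>a\<in>J. \<forall>b\<in>J. (\<Sum>j\<in>\<tau>. z j a * z j b) = (if a = b then \<mu> a else 0))"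

lemma frame_diagD:
  "frame_diag J \<tau> z \<mu> \<Longrightarrow> a \<in> J \<Longrightarrow> b \<in> J \<Longrightarrow> (\<Sum>j\<in>\<tau>. z j a * z j b) = (if a = b then \<mu> a else 0)"
  unfolding frame_diag_def by blast

text \<open>Restores the diagonal form after \<open>\<tau>\<close> has changed. The last conclusion
  is the eigenvector equation in the old coordinates, the form in which the rank one formula is
  applied.\<close>

lemma frame_diag_rediagonalize:
  assumes "finite J" "finite \<tau>"
  obtains P \<mu> where "orthogonal_mat J P" "frame_diag J \<tau> (\<lambda>i a. \<Sum>b\<in>J. P a b * z i b) \<mu>"
    "\<And>i a. i \<in> J \<Longrightarrow> a \<in> J \<Longrightarrow> (\<Sum>b\<in>J. (\<Sum>j\<in>\<tau>. z j a * z j b) * P i b) = \<mu> i * P i a"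
proof -
  define A where "A a b = (\<Sum>j\<in>\<tau>. z j a * z j b)" for a b
  obtain P where P: "orthogonal_mat J P"
    "\<And>i j. i \<in> J \<Longrightarrow> j \<in> J \<Longrightarrow> i \<noteq> j \<Longrightarrow> bil J A (P i) (P j) = 0"
    by (rule symmetric_mat_diagonalizable[OF assms(1), of A]) (auto simp: A_def mult.commute)
  have "(\<Sum>i\<in>\<tau>. (\<Sum>b\<in>J. P a b * z i b) * (\<Sum>b\<in>J. P a' b * z i b)) = bil J A (P a) (P a')" for a a'
  proof -
    have "(\<Sum>i\<in>\<tau>. (\<Sum>b\<in>J. P a b * z i b) * (\<Sum>b\<in>J. P a' b * z i b))
       = (\<Sum>i\<in>\<tau>. \<Sum>b\<in>J. \<Sum>c\<in>J. P a b * (z i b * z i c) * P a' c)"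
      unfolding sum_product by (intro sum.cong refl) (simp add: mult_ac)
    also have "\<dots> = (\<Sum>b\<in>J. \<Sum>i\<in>\<tau>. \<Sum>c\<in>J. P a b * (z i b * z i c) * P a' c)" by (rule sum.swap)
    also have "\<dots> = (\<Sum>b\<in>J. \<Sum>c\<in>J. \<Sum>i\<in>\<tau>. P a b * (z i b * z i c) * P a' c)"
      by (rule sum.cong[OF refl], rule sum.swap)
    also have "\<dots> = bil J A (P a) (P a')"
      unfolding bil_def A_def by (simp add: sum_distrib_left sum_distrib_right)
    finally show ?thesis .
  qed
  then have "frame_diag J \<tau> (\<lambda>i a. \<Sum>b\<in>J. P a b * z i b) (\<lambda>i. bil J A (P i) (P i))"
    unfolding frame_diag_def using P(2) by simp
  moreover have "(\<Sum>b\<in>J. (\<Sum>j\<in>\<tau>. z j a * z j b) * P i b) = bil J A (P i) (P i) * P i a"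
    if "i \<in> J" "a \<in> J" for i a
    using orthogonal_mat_eigenvector[OF assms(1) P that] by (simp add: A_def)
  ultimately show ?thesis using that P(1) by blast
qed

text \<open>The eigenvalue form of the Sherman--Morrison formula.\<close>
lemma rank_one_downdate_eigenvector:
  fixes \<nu> z f :: "nat \<Rightarrow> real"
  assumes J: "finite J" and \<nu>: "\<And>a. a \<in> J \<Longrightarrow> \<nu> a > 0"
    and unit: "(\<Sum>a\<in>J. (f a)\<^sup>2) = 1"
    and eig: "\<And>a. a \<in> J \<Longrightarrow> \<nu> a * f a - z a * (\<Sum>b\<in>J. z b * f b) = \<kappa> * f a"
    and om: "(\<Sum>a\<in>J. (z a)\<^sup>2 / \<nu> a) < 1"
  shows "\<kappa> > 0"
    "1 / \<kappa> = (\<Sum>a\<in>J. (f a)\<^sup>2 / \<nu> a) + (\<Sum>a\<in>J. f a * (z a / \<nu> a))\<^sup>2 / (1 - (\<Sum>a\<in>J. (z a)\<^sup>2 / \<nu> a))"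
proof -
  define p h \<omega> F where "p = (\<Sum>b\<in>J. z b * f b)" and "h = (\<Sum>a\<in>J. f a * (z a / \<nu> a))"
    and "\<omega> = (\<Sum>a\<in>J. (z a)\<^sup>2 / \<nu> a)" and "F = (\<Sum>a\<in>J. (f a)\<^sup>2 / \<nu> a)"
  \<comment> \<open>The eigenvector equation is solved for \<open>f\<close>. Testing the result
    against \<open>z\<close> and against \<open>f\<close> gives two scalar equations, and
    eliminating \<open>p\<close> from them yields the formula.\<close>
  have fa: "f a = (\<kappa> * f a + z a * p) / \<nu> a" if "a \<in> J" for a
    using eig[OF that] \<nu>[OF that] by (simp add: p_def field_simps)
  have "p = (\<Sum>a\<in>J. z a * ((\<kappa> * f a + z a * p) / \<nu> a))"
    unfolding p_def[unfolded p_def] using fa by (subst p_def) (intro sum.cong refl, metis)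
  also have "\<dots> = \<kappa> * h + p * \<omega>"
    unfolding h_def \<omega>_def sum_distrib_left sum.distrib[symmetric]
    by (intro sum.cong refl) (simp add: add_divide_distrib power2_eq_square algebra_simps)
  finally have p: "p * (1 - \<omega>) = \<kappa> * h" by (simp add: algebra_simps)
  have "1 = (\<Sum>a\<in>J. f a * ((\<kappa> * f a + z a * p) / \<nu> a))"
    unfolding unit[symmetric] power2_eq_square using fa by (intro sum.cong refl) metis
  also have "\<dots> = \<kappa> * F + p * h"
    unfolding h_def F_def sum_distrib_left sum.distrib[symmetric]
    by (intro sum.cong refl) (simp add: add_divide_distrib power2_eq_square algebra_simps)
  finally have 1: "1 = \<kappa> * F + p * h" .
  have "\<omega> < 1" using om \<omega>_def by simp
  then have "p = \<kappa> * h / (1 - \<omega>)" using p by (simp add: field_simps)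
  then have 2: "1 = \<kappa> * (F + h\<^sup>2 / (1 - \<omega>))"
    using 1 by (simp add: power2_eq_square algebra_simps)
  have "F \<ge> 0" unfolding F_def by (intro sum_nonneg) (use \<nu> in \<open>auto simp: less_imp_le\<close>)
  then have "F + h\<^sup>2 / (1 - \<omega>) \<ge> 0" using \<open>\<omega> < 1\<close> by simp
  then show "\<kappa> > 0" using 2 by (metis mult_not_zero not_one_le_zero order_antisym_conv zero_less_mult_iff zero_less_one order_less_le)
  then show "1 / \<kappa> = F + h\<^sup>2 / (1 - \<omega>)"
    using 2 by (simp add: field_simps)
qed

text \<open>Deleting one vector lowers the barrier from \<open>l\<close> to \<open>l'\<close> and keeps
  \<open>l * trace ((M - l I)^-1) \<le> card J\<close>; the deleted vector is found by averaging.\<close>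
lemma barrier_delete:
  fixes z :: "nat \<Rightarrow> nat \<Rightarrow> real"
  assumes J: "finite J" "J \<noteq> {}" and \<tau>: "finite \<tau>" and fd: "frame_diag J \<tau> z \<mu>"
    and l: "l > 0" "\<And>a. a \<in> J \<Longrightarrow> \<mu> a > l" and pot: "(\<Sum>a\<in>J. 1 / (\<mu> a - l)) \<le> card J / l"
    and m: "card \<tau> > 2 * card J"
    and l': "l' = l * (real (card \<tau>) - 2 * card J) / (real (card \<tau>) - 2 * card J + 1)"
  obtains j P \<mu>' where "j \<in> \<tau>" "orthogonal_mat J P"
    "frame_diag J (\<tau> - {j}) (\<lambda>i a. \<Sum>b\<in>J. P a b * z i b) \<mu>'"
    "\<And>a. a \<in> J \<Longrightarrow> \<mu>' a > l'" "(\<Sum>a\<in>J. 1 / (\<mu>' a - l')) \<le> card J / l'"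
proof -
  define k where "k = real (card J)"
  \<comment> \<open>\<open>r\<close> is the surplus of vectors over \<open>2 * card J\<close>. The
    new barrier is chosen so that \<open>l - l' = \<delta>\<close> and
    \<open>\<delta> * r = l'\<close>, which balances the averaging estimate below.\<close>
  define r where "r = real (card \<tau>) - 2 * k"
  define \<delta> where "\<delta> = l / (r + 1)"
  have r: "r > 0" using m by (simp add: r_def k_def)
  have k: "k > 0" using J by (simp add: k_def card_gt_0_iff)
  have l'r: "l' = l * r / (r + 1)" by (simp add: l' r_def k_def)
  have \<delta>: "\<delta> > 0" "\<delta> * r = l'" "l' > 0" "l = l' + \<delta>"
  proof -
    have "l' + \<delta> = l * (r + 1) / (r + 1)" by (simp add: \<delta>_def l'r add_divide_distrib[symmetric] algebra_simps)
    then show "l = l' + \<delta>" using r by simp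
  qed (use r l in \<open>auto simp: \<delta>_def l'r\<close>)
  define \<nu> where "\<nu> a = \<mu> a - l'" for a
  have \<nu>: "\<nu> a > \<delta>" "\<nu> a > 0" if "a \<in> J" for a
    using l(2)[OF that] \<delta> by (auto simp: \<nu>_def)
  define S1 S2 where "S1 = (\<Sum>a\<in>J. 1 / \<nu> a)" and "S2 = (\<Sum>a\<in>J. 1 / (\<nu> a)\<^sup>2)"
  have S: "S1 \<ge> 0" "S2 \<ge> 0" unfolding S1_def S2_def
    by (auto intro!: sum_nonneg simp: \<nu> less_imp_le)
  \<comment> \<open>Convexity of \<open>1 / x\<close>: lowering the barrier by
    \<open>\<delta>\<close> lowers the trace of the resolvent by at least
    \<open>\<delta> * S2\<close>. This gain pays for the deletion.\<close>
  have "S1 + \<delta> * S2 \<le> (\<Sum>a\<in>J. 1 / (\<mu> a - l))"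
    unfolding S1_def S2_def sum_distrib_left sum.distrib[symmetric]
  proof (rule sum_mono)
    fix a assume a: "a \<in> J"
    define x where "x = \<mu> a - l"
    have x: "x > 0" "\<nu> a = x + \<delta>" using l(2)[OF a] \<delta> by (auto simp: x_def \<nu>_def)
    have "1 / x - 1 / (x + \<delta>) = \<delta> / (x * (x + \<delta>))" using x \<delta> by (simp add: field_simps)
    also have "\<dots> \<ge> \<delta> / (x + \<delta>)\<^sup>2"
      using x \<delta> by (intro divide_left_mono) (auto simp: power2_eq_square)
    finally show "1 / \<nu> a + \<delta> * (1 / (\<nu> a)\<^sup>2) \<le> 1 / (\<mu> a - l)"
      by (simp add: x(2)) (simp add: x_def)
  qed
  then have S1: "S1 + \<delta> * S2 \<le> k / l" using pot by (simp add: k_def)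
  \<comment> \<open>With \<open>R\<close> the resolvent of the Gram matrix at \<open>l'\<close>,
    these are the quadratic forms of \<open>R\<close> and of its square at the vector
    \<open>z j\<close>. Deleting that vector raises the trace of \<open>R\<close> by
    \<open>th j / (1 - om j)\<close>.\<close>
  define om th where "om j = (\<Sum>a\<in>J. (z j a)\<^sup>2 / \<nu> a)" and "th j = (\<Sum>a\<in>J. (z j a)\<^sup>2 / (\<nu> a)\<^sup>2)" for j
  have zz: "(\<Sum>j\<in>\<tau>. (z j a)\<^sup>2) = \<nu> a + l'" if "a \<in> J" for a
    using frame_diagD[OF fd that that] by (simp add: power2_eq_square \<nu>_def)
  have "sum om \<tau> = (\<Sum>a\<in>J. \<Sum>j\<in>\<tau>. (z j a)\<^sup>2 / \<nu> a)" unfolding om_def by (rule sum.swap)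
  also have "\<dots> = (\<Sum>a\<in>J. 1 + l' * (1 / \<nu> a))"
    by (intro sum.cong refl) (use \<nu> in \<open>simp add: sum_divide_distrib[symmetric] zz add_divide_distrib less_imp_neq[symmetric]\<close>)
  finally have som: "sum om \<tau> = k + l' * S1"
    by (simp add: sum.distrib S1_def sum_distrib_left k_def)
  have "sum th \<tau> = (\<Sum>a\<in>J. \<Sum>j\<in>\<tau>. (z j a)\<^sup>2 / (\<nu> a)\<^sup>2)" unfolding th_def by (rule sum.swap)
  also have "\<dots> = (\<Sum>a\<in>J. 1 / \<nu> a + l' * (1 / (\<nu> a)\<^sup>2))"
  proof (intro sum.cong refl)
    fix a assume a: "a \<in> J"
    have "(\<Sum>j\<in>\<tau>. (z j a)\<^sup>2 / (\<nu> a)\<^sup>2) = (\<nu> a + l') / (\<nu> a)\<^sup>2"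
      by (simp add: sum_divide_distrib[symmetric] zz[OF a])
    also have "\<dots> = 1 / \<nu> a + l' * (1 / (\<nu> a)\<^sup>2)"
      using \<nu>(2)[OF a] by (simp add: add_divide_distrib power2_eq_square)
    finally show "(\<Sum>j\<in>\<tau>. (z j a)\<^sup>2 / (\<nu> a)\<^sup>2) = 1 / \<nu> a + l' * (1 / (\<nu> a)\<^sup>2)" .
  qed
  finally have sth: "sum th \<tau> = S1 + l' * S2"
    by (simp add: sum.distrib S1_def S2_def sum_distrib_left)
  \<comment> \<open>The admissible increase of the trace. It remains to find \<open>j\<close> with
    \<open>th j \<le> G * (1 - om j)\<close>, and for this it suffices to compare the sums over
    \<open>\<tau>\<close>.\<close>
  define G where "G = k / l' - S1"
  have "k / l' - k / l = k * \<delta> / (l * l')" using \<delta> l(1) by (simp add: field_simps)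
  then have G: "G \<ge> k * \<delta> / (l * l') + \<delta> * S2" using S1 by (simp add: G_def)
  have "k * \<delta> / (l * l') > 0" using k \<delta> l(1) by simp
  then have Gpos: "G > 0" using G S \<delta> by (smt (verit) mult_nonneg_nonneg)
  \<comment> \<open>Hence the sum of all \<open>om j\<close> is at most \<open>2 * k\<close>. This
    is where the factor 2 in the hypothesis on \<open>card \<tau>\<close> comes from: the average of
    \<open>1 - om j\<close> is at least \<open>r / card \<tau>\<close>.\<close>
  have "l' * S1 \<le> k"
  proof -
    have "l' * S1 \<le> l * (k / l)" using S1 S \<delta> l(1)
      by (intro mult_mono) (auto intro: order_trans[rotated])
    then show ?thesis using l(1) by simp
  qed
  \<comment> \<open>Because \<open>\<delta> * r = l'\<close>, the left side equals
    \<open>k / l + l' * S2\<close>, which dominates \<open>S1 + l' * S2\<close>, the sum of all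
    \<open>th j\<close>.\<close>
  then have "(k * \<delta> / (l * l') + \<delta> * S2) * r \<le> G * (real (card \<tau>) - (k + l' * S1))"
    using G Gpos r by (intro mult_mono) (auto simp: r_def)
  moreover have "(k * \<delta> / (l * l') + \<delta> * S2) * r = k / l + l' * S2"
  proof -
    have "(k * \<delta> / (l * l') + \<delta> * S2) * r = k / l * (\<delta> * r / l') + \<delta> * r * S2"
      by (simp add: algebra_simps)
    then show ?thesis using \<delta>(2,3) by simp
  qed
  moreover have "k / l \<ge> S1" using S1 S \<delta> by (smt (verit) mult_nonneg_nonneg)
  ultimately have "sum th \<tau> \<le> G * (real (card \<tau>) - sum om \<tau>)" by (simp add: som sth)
  also have "\<dots> = (\<Sum>j\<in>\<tau>. G * (1 - om j))"
    by (simp add: sum_distrib_left[symmetric] sum_subtractf)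
  finally have "\<exists>j\<in>\<tau>. th j \<le> G * (1 - om j)"
  proof -
    have "\<tau> \<noteq> {}" using m by auto
    assume "sum th \<tau> \<le> (\<Sum>j\<in>\<tau>. G * (1 - om j))"
    then show ?thesis using sum_strict_mono[OF \<tau> \<open>\<tau> \<noteq> {}\<close>, of "\<lambda>j. G * (1 - om j)" th] by (meson not_le)
  qed
  then obtain j where j: "j \<in> \<tau>" "th j \<le> G * (1 - om j)" by blast
  \<comment> \<open>Otherwise \<open>th j\<close> vanishes, so \<open>z j\<close> is zero on
    \<open>J\<close> and \<open>om j\<close> is 0. Strictness is the condition under which the rank
    one formula keeps all eigenvalues above the barrier.\<close>
  have om1: "om j < 1"
  proof (rule ccontr)
    assume "\<not> om j < 1"
    then have "G * (1 - om j) \<le> 0" using Gpos by (simp add: mult_le_0_iff)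
    then have "th j \<le> 0" using j(2) by linarith
    moreover have nn: "(z j a)\<^sup>2 / (\<nu> a)\<^sup>2 \<ge> 0" for a by simp
    ultimately have "\<forall>a\<in>J. (z j a)\<^sup>2 / (\<nu> a)\<^sup>2 = 0"
      using sum_nonneg_eq_0_iff[OF J(1), of "\<lambda>a. (z j a)\<^sup>2 / (\<nu> a)\<^sup>2"] sum_nonneg[of J "\<lambda>a. (z j a)\<^sup>2 / (\<nu> a)\<^sup>2"]
      unfolding th_def by (metis (no_types, lifting) nn order_antisym)
    then have "om j = 0" unfolding om_def using \<nu> by (intro sum.neutral) force
    then show False using \<open>\<not> om j < 1\<close> by simp
  qed
  obtain P \<mu>' where P: "orthogonal_mat J P" "frame_diag J (\<tau> - {j}) (\<lambda>i a. \<Sum>b\<in>J. P a b * z i b) \<mu>'"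
    and eig: "\<And>i a. i \<in> J \<Longrightarrow> a \<in> J \<Longrightarrow> (\<Sum>b\<in>J. (\<Sum>j\<in>\<tau> - {j}. z j a * z j b) * P i b) = \<mu>' i * P i a"
    using frame_diag_rediagonalize[OF J(1), of "\<tau> - {j}" z] \<tau> by blast
  have e: "\<nu> a * P i a - z j a * (\<Sum>b\<in>J. z j b * P i b) = (\<mu>' i - l') * P i a" if "i \<in> J" "a \<in> J" for i a
  proof -
    have "(\<Sum>b\<in>J. (\<Sum>j\<in>\<tau> - {j}. z j a * z j b) * P i b)
        = (\<Sum>b\<in>J. ((if a = b then \<mu> a else 0) - z j a * z j b) * P i b)"
    proof (intro sum.cong refl)
      fix b assume "b \<in> J"
      then have "(\<Sum>j\<in>\<tau> - {j}. z j a * z j b) = (if a = b then \<mu> a else 0) - z j a * z j b"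
        using sum.remove[OF \<tau> j(1), of "\<lambda>j. z j a * z j b"] frame_diagD[OF fd that(2), of b] by simp
      then show "(\<Sum>j\<in>\<tau> - {j}. z j a * z j b) * P i b = ((if a = b then \<mu> a else 0) - z j a * z j b) * P i b"
        by simp
    qed
    also have "\<dots> = (\<Sum>b\<in>J. (if a = b then \<mu> a * P i a else 0) - z j a * (z j b * P i b))"
      by (intro sum.cong) (auto simp: algebra_simps)
    also have "\<dots> = \<mu> a * P i a - z j a * (\<Sum>b\<in>J. z j b * P i b)"
      using J(1) that by (simp add: sum_subtractf sum_distrib_left[symmetric])
    finally show ?thesis using eig[OF that] by (simp add: \<nu>_def algebra_simps)
  qed
  have unit: "(\<Sum>a\<in>J. (P i a)\<^sup>2) = 1" if "i \<in> J" for i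
    using orthogonal_matD(1)[OF P(1) that that] by (simp add: power2_eq_square)
  have om1': "(\<Sum>a\<in>J. (z j a)\<^sup>2 / \<nu> a) < 1" using om1 by (simp add: om_def)
  note dd = rank_one_downdate_eigenvector[OF J(1) \<nu>(2) unit e om1']
  \<comment> \<open>Summed over the new eigenbasis, the first terms give back \<open>S1\<close> by
    orthonormality of the columns, and Parseval turns the squared correction terms into
    \<open>th j\<close>.\<close>
  have "(\<Sum>i\<in>J. 1 / (\<mu>' i - l'))
      = (\<Sum>i\<in>J. (\<Sum>a\<in>J. (P i a)\<^sup>2 / \<nu> a) + (\<Sum>a\<in>J. P i a * (z j a / \<nu> a))\<^sup>2 / (1 - om j))"
    using dd(2) unfolding om_def by (intro sum.cong refl) auto
  also have "\<dots> = (\<Sum>i\<in>J. \<Sum>a\<in>J. (P i a)\<^sup>2 / \<nu> a) + (\<Sum>i\<in>J. (\<Sum>a\<in>J. P i a * (z j a / \<nu> a))\<^sup>2) / (1 - om j)"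
    by (simp add: sum.distrib sum_divide_distrib)
  also have "(\<Sum>i\<in>J. (\<Sum>a\<in>J. P i a * (z j a / \<nu> a))\<^sup>2) = th j"
    unfolding orthogonal_mat_parseval[OF J(1) P(1)] th_def by (simp add: power_divide)
  also have "(\<Sum>i\<in>J. \<Sum>a\<in>J. (P i a)\<^sup>2 / \<nu> a) = (\<Sum>a\<in>J. \<Sum>i\<in>J. (P i a)\<^sup>2 / \<nu> a)" by (rule sum.swap)
  also have "\<dots> = S1" unfolding S1_def
    by (intro sum.cong refl)
      (use orthogonal_matD(2)[OF P(1)] in \<open>simp add: sum_divide_distrib[symmetric] power2_eq_square\<close>)
  also have "S1 + th j / (1 - om j) \<le> S1 + G"
    using j(2) om1 by (simp add: pos_divide_le_eq)
  finally have "(\<Sum>i\<in>J. 1 / (\<mu>' i - l')) \<le> card J / l'" by (simp add: G_def k_def)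
  moreover have "\<mu>' a > l'" if "a \<in> J" for a using dd(1)[OF _ that] that by auto
  ultimately show ?thesis using that[OF j(1) P] by blast
qed

text \<open>Deletion starts from all \<open>n\<close> rows, where the Gram matrix is the identity
  and the barrier \<open>1 / 2\<close> meets the trace condition with equality, both sides being
  \<open>2 * card J\<close>. The quotients of successive barriers have the form
  \<open>x / (x + 1)\<close> and telescope to the stated bound. \<open>P\<close> accumulates the
  changes of eigenbasis.\<close>

lemma coordinate_subset_selection:
  fixes w :: "nat \<Rightarrow> nat \<Rightarrow> real"
  assumes J: "finite J" "J \<noteq> {}"
    and frame: "\<And>a b. a \<in> J \<Longrightarrow> b \<in> J \<Longrightarrow> (\<Sum>j<n. w j a * w j b) = (if a = b then 1 else 0)"
    and m: "2 * card J \<le> m" "m \<le> n"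
  obtains \<tau> P \<mu> where "\<tau> \<subseteq> {..<n}" "card \<tau> = m" "orthogonal_mat J P"
    "frame_diag J \<tau> (\<lambda>i a. \<Sum>b\<in>J. P a b * w i b) \<mu>"
    "\<And>a. a \<in> J \<Longrightarrow> \<mu> a > (real m - 2 * card J + 1) / (2 * (real n - 2 * card J + 1))"
proof -
  define L where "L m = (real m - 2 * card J + 1) / (2 * (real n - 2 * card J + 1))" for m
  have "\<exists>\<tau> P \<mu>. \<tau> \<subseteq> {..<n} \<and> card \<tau> = m \<and> orthogonal_mat J P \<and>
     frame_diag J \<tau> (\<lambda>i a. \<Sum>b\<in>J. P a b * w i b) \<mu> \<and> (\<forall>a\<in>J. \<mu> a > L m) \<and>
     (\<Sum>a\<in>J. 1 / (\<mu> a - L m)) \<le> card J / L m"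
    using m(2,1)
  proof (induction m rule: inc_induct)
    case base
    have "L n = 1 / 2" using base by (simp add: L_def field_simps)
    have "frame_diag J {..<n} (\<lambda>i a. \<Sum>b\<in>J. (if a = b then 1 else 0) * w i b) (\<lambda>a. 1)"
      unfolding frame_diag_def using frame J(1) by (auto simp: indicator_mult_simps)
    moreover note L1 = \<open>L n = 1 / 2\<close>
    ultimately show ?case using orthogonal_mat_id[OF J(1)]
      by (intro exI[of _ "{..<n}"] exI[of _ "\<lambda>i j. if i = j then 1 else 0"] exI[of _ "\<lambda>a. 1"])
        (simp add: L1)
  next
    case (step m)
    then obtain \<tau> P \<mu> where t: "\<tau> \<subseteq> {..<n}" "card \<tau> = Suc m" "orthogonal_mat J P"
      "frame_diag J \<tau> (\<lambda>i a. \<Sum>b\<in>J. P a b * w i b) \<mu>" "\<forall>a\<in>J. \<mu> a > L (Suc m)"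
      "(\<Sum>a\<in>J. 1 / (\<mu> a - L (Suc m))) \<le> card J / L (Suc m)" by auto
    have fin: "finite \<tau>" using t(1) finite_subset by blast
    have Lpos: "L (Suc m) > 0" unfolding L_def using step.prems step.hyps by (intro divide_pos_pos) auto
    have Leq: "L m = L (Suc m) * (real (card \<tau>) - 2 * card J) / (real (card \<tau>) - 2 * card J + 1)"
    proof -
      define x where "x = real m - 2 * card J + 1"
      have x: "x > 0" "real (card \<tau>) - 2 * card J = x" "real (Suc m) - 2 * card J + 1 = x + 1"
        using step.prems by (auto simp: x_def t(2))
      show ?thesis unfolding L_def x(2,3) x_def[symmetric] using x(1) by simp
    qed
    have c: "card \<tau> > 2 * card J" using step.prems t(2) by simp
    have t5: "\<And>a. a \<in> J \<Longrightarrow> \<mu> a > L (Suc m)" using t(5) by blast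
    show ?case
    proof (rule barrier_delete[OF J fin t(4) Lpos t5 t(6) c Leq])
      fix j P' \<mu>' assume j: "j \<in> \<tau>" "orthogonal_mat J P'"
        "frame_diag J (\<tau> - {j}) (\<lambda>i a. \<Sum>b\<in>J. P' a b * (\<Sum>c\<in>J. P b c * w i c)) \<mu>'"
        "\<And>a. a \<in> J \<Longrightarrow> \<mu>' a > L m" "(\<Sum>a\<in>J. 1 / (\<mu>' a - L m)) \<le> card J / L m"
      have "(\<Sum>b\<in>J. P' a b * (\<Sum>c\<in>J. P b c * w i c)) = (\<Sum>c\<in>J. (\<Sum>b\<in>J. P' a b * P b c) * w i c)" for a i
        by (simp add: sum_distrib_left sum_distrib_right mult.assoc) (rule sum.swap)
      then have "frame_diag J (\<tau> - {j}) (\<lambda>i a. \<Sum>c\<in>J. (\<Sum>b\<in>J. P' a b * P b c) * w i c) \<mu>'"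
        using j(3) by simp
      moreover have "card (\<tau> - {j}) = m" using fin j(1) t(2) by simp
      moreover have "orthogonal_mat J (\<lambda>a c. \<Sum>b\<in>J. P' a b * P b c)"
        by (rule orthogonal_mat_mult[OF J(1) j(2) t(3)])
      ultimately show ?case using j t(1)
        by (intro exI[of _ "\<tau> - {j}"] exI[of _ "\<lambda>a c. \<Sum>b\<in>J. P' a b * P b c"] exI[of _ \<mu>']) auto
    qed
  qed
  then show ?thesis using that unfolding L_def by blast
qed

subsection \<open>Lebesgue measure on the carrier of Euclidean space\<close>

lemma Rn_iff: "x \<in> Rn n \<longleftrightarrow> (\<forall>i\<ge>n. x i = 0)"
  by (simp add: topspace_Euclidean_space)

lemma closed_Rn: "closed (Rn n)"
  using closedin_Euclidean_imp_closed closedin_topspace by blast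

definition Rborel :: "nat \<Rightarrow> (nat \<Rightarrow> real) measure" where
  "Rborel n = restrict_space borel (Rn n)"

lemma space_Rborel [simp]: "space (Rborel n) = Rn n"
  by (simp add: Rborel_def space_restrict_space)

lemma sets_Rborel_iff: "A \<in> sets (Rborel n) \<longleftrightarrow> A \<in> sets borel \<and> A \<subseteq> Rn n"
  unfolding Rborel_def using closed_Rn[of n] by (subst sets_restrict_space_iff) auto

lemma closed_in_Rborel: "closed A \<Longrightarrow> A \<subseteq> Rn n \<Longrightarrow> A \<in> sets (Rborel n)"
  by (simp add: sets_Rborel_iff)

lemma measurable_Rborel_coord [measurable]: "(\<lambda>x. x i) \<in> borel_measurable (Rborel n)"
  unfolding Rborel_def by (intro measurable_restrict_space1 measurable_product_coordinates)

lemma sets_Collect_mem_measurable: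
  assumes "f \<in> measurable M N" "A \<in> sets N"
  shows "{x \<in> space M. f x \<in> A} \<in> sets M"
proof -
  have "{x \<in> space M. f x \<in> A} = f -` A \<inter> space M" by auto
  then show ?thesis using measurable_sets[OF assms] by simp
qed

text \<open>The coordinates from \<open>n\<close> on are constantly 0, so \<open>n\<close>
  measurability conditions settle all coordinates of the product space.\<close>

lemma measurable_into_Rborel:
  assumes "\<And>x. x \<in> space M \<Longrightarrow> f x \<in> Rn n" "\<And>i. i < n \<Longrightarrow> (\<lambda>x. f x i) \<in> borel_measurable M"
  shows "f \<in> measurable M (Rborel n)"
  unfolding Rborel_def
proof (rule measurable_restrict_space2)
  show "f \<in> borel_measurable M"
  proof (rule measurable_coordinatewise_then_product)
    fix i
    show "(\<lambda>x. f x i) \<in> borel_measurable M"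
    proof (cases "i < n")
      case False
      then have "f x i = 0" if "x \<in> space M" for x using assms(1)[OF that] by (simp add: Rn_iff)
      then have "(\<lambda>x. f x i) \<in> borel_measurable M \<longleftrightarrow> (\<lambda>x. 0::real) \<in> borel_measurable M"
        by (intro measurable_cong) auto
      then show ?thesis by simp
    qed (use assms in auto)
  qed
qed (use assms in auto)

definition zero_ext :: "nat \<Rightarrow> (nat \<Rightarrow> real) \<Rightarrow> nat \<Rightarrow> real" where
  "zero_ext n x = (\<lambda>i. if i < n then x i else 0)"

lemma zero_ext_Rn: "zero_ext n x \<in> Rn n"
  by (simp add: zero_ext_def Rn_iff)

lemma zero_ext_id: "x \<in> Rn n \<Longrightarrow> zero_ext n x = x"
  by (auto simp: zero_ext_def Rn_iff)

abbreviation lborel_pow :: "nat \<Rightarrow> (nat \<Rightarrow> real) measure" where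
  "lborel_pow n \<equiv> Pi\<^sub>M {..<n} (\<lambda>_. lborel)"

lemma measurable_lborel_pow_coord [measurable]:
  "i < n \<Longrightarrow> (\<lambda>x. x i) \<in> borel_measurable (lborel_pow n)"
  using measurable_component_singleton[of i "{..<n}" "\<lambda>_. lborel :: real measure"] by simp

lemma measurable_zero_ext: "zero_ext n \<in> measurable (lborel_pow n) (Rborel n)"
proof (rule measurable_into_Rborel)
  fix i assume i: "i < n"
  then have "(\<lambda>x. zero_ext n x i) = (\<lambda>x. x i)" by (simp add: zero_ext_def)
  then show "(\<lambda>x. zero_ext n x i) \<in> borel_measurable (lborel_pow n)"
    using measurable_lborel_pow_coord[OF i] by simp
qed (rule zero_ext_Rn)

text \<open>\<open>vol\<close> measures images under \<open>restrict\<close>. Transporting the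
  product measure along the inverse map \<open>zero_ext\<close> gives a measure on
  \<open>Rn n\<close> itself, where linear maps act directly.\<close>

definition leb :: "nat \<Rightarrow> (nat \<Rightarrow> real) measure" where
  "leb n = distr (lborel_pow n) (Rborel n) (zero_ext n)"

lemma space_leb [simp]: "space (leb n) = Rn n"
  by (simp add: leb_def)

lemma sets_leb [simp, measurable_cong]: "sets (leb n) = sets (Rborel n)"
  by (simp add: leb_def)

lemma emeasure_leb:
  "A \<in> sets (Rborel n) \<Longrightarrow> emeasure (leb n) A =
     emeasure (lborel_pow n) (zero_ext n -` A \<inter> space (lborel_pow n))"
  unfolding leb_def by (rule emeasure_distr[OF measurable_zero_ext])

lemma vol_eq_leb: 
  assumes "A \<in> sets (Rborel n)"
  shows "vol n A = measure (leb n) A"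
proof -
  have A: "A \<subseteq> Rn n" using assms by (simp add: sets_Rborel_iff)
  have "zero_ext n -` A \<inter> space (lborel_pow n) = (\<lambda>x. restrict x {..<n}) ` A"
  proof (intro equalityI subsetI)
    fix x assume x: "x \<in> zero_ext n -` A \<inter> space (lborel_pow n)"
    then have "x = restrict (zero_ext n x) {..<n}"
      by (auto simp: space_PiM zero_ext_def PiE_def extensional_def restrict_def fun_eq_iff)
    then show "x \<in> (\<lambda>x. restrict x {..<n}) ` A" using x by auto
  next
    fix x assume "x \<in> (\<lambda>x. restrict x {..<n}) ` A"
    then obtain y where y: "y \<in> A" "x = restrict y {..<n}" by auto
    have "zero_ext n x = zero_ext n y" by (simp add: y zero_ext_def fun_eq_iff)
    then show "x \<in> zero_ext n -` A \<inter> space (lborel_pow n)"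
      using y A zero_ext_id[of y n] by (auto simp: space_PiM)
  qed
  then show ?thesis
    unfolding vol_def leb_def using assms by (simp add: measure_distr[OF measurable_zero_ext])
qed

interpretation lborel_prod: product_sigma_finite "\<lambda>i::nat. lborel :: real measure"
  by unfold_locales

lemma emeasure_leb_box:
  assumes "\<And>i. i < n \<Longrightarrow> A i \<in> sets borel"
  shows "{x \<in> Rn n. \<forall>i<n. x i \<in> A i} \<in> sets (Rborel n)"
    "emeasure (leb n) {x \<in> Rn n. \<forall>i<n. x i \<in> A i} = (\<Prod>i<n. emeasure lborel (A i))"
proof -
  have "{x \<in> space (Rborel n). \<forall>i\<in>{..<n}. x i \<in> A i} \<in> sets (Rborel n)"
  proof (rule sets.sets_Collect_finite_All)
    fix i assume "i \<in> {..<n}"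
    then show "{x \<in> space (Rborel n). x i \<in> A i} \<in> sets (Rborel n)"
      using assms by (intro sets_Collect_mem_measurable[OF measurable_Rborel_coord]) auto
  qed simp
  moreover have "{x \<in> space (Rborel n). \<forall>i\<in>{..<n}. x i \<in> A i} = {x \<in> Rn n. \<forall>i<n. x i \<in> A i}" by auto
  ultimately show m: "{x \<in> Rn n. \<forall>i<n. x i \<in> A i} \<in> sets (Rborel n)" by metis
  have "zero_ext n -` {x \<in> Rn n. \<forall>i<n. x i \<in> A i} \<inter> space (lborel_pow n)
      = Pi\<^sub>E {..<n} A"
    by (auto simp: space_PiM zero_ext_def Rn_iff PiE_def)
  then show "emeasure (leb n) {x \<in> Rn n. \<forall>i<n. x i \<in> A i} = (\<Prod>i<n. emeasure lborel (A i))"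
    unfolding emeasure_leb[OF m] using assms by (simp only:) (rule lborel_prod.emeasure_PiM, auto)
qed

definition cube :: "nat \<Rightarrow> real \<Rightarrow> (nat \<Rightarrow> real) set" where
  "cube n r = {x \<in> Rn n. \<forall>i<n. x i \<in> {- r .. r}}"

lemma sets_cube: "cube n r \<in> sets (Rborel n)"
  unfolding cube_def by (rule emeasure_leb_box(1)) simp

lemma emeasure_cube:
  assumes "r \<ge> 0"
  shows "emeasure (leb n) (cube n r) = ennreal ((2 * r) ^ n)"
proof -
  have "emeasure (leb n) (cube n r) = (\<Prod>i<n. emeasure lborel {- r .. r})"
    unfolding cube_def by (rule emeasure_leb_box(2)) simp
  then show ?thesis using assms by (simp add: ennreal_power)
qed

section \<open>Diagonal affine maps, translations and uniqueness of translation invariant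
  measures\<close>

lemma emeasure_lborel_affine:
  fixes c t :: real
  assumes "c \<noteq> 0" "A \<in> sets borel"
  shows "emeasure lborel A = ennreal \<bar>c\<bar> * emeasure lborel ((\<lambda>x. t + c * x) -` A)"
proof -
  have "emeasure lborel A = emeasure (density (distr lborel borel (\<lambda>x. t + c * x)) (\<lambda>_. ennreal \<bar>c\<bar>)) A"
    using lborel_real_affine[OF assms(1), of t] by simp
  also have "\<dots> = ennreal \<bar>c\<bar> * emeasure lborel ((\<lambda>x. t + c * x) -` A)"
    using assms(2) by (simp add: emeasure_density_const emeasure_distr)
  finally show ?thesis .
qed

text \<open>A diagonal affine map pulls boxes back to boxes, so the rescaled image measure agrees
  with the product measure on boxes, hence everywhere. Orthogonal maps are treated separately, and
  the two kinds together give every ellipsoid.\<close>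

lemma emeasure_PiM_affine:
  fixes c t :: "nat \<Rightarrow> real"
  assumes c: "\<And>i. i < n \<Longrightarrow> c i \<noteq> 0"
  defines "P \<equiv> lborel_pow n"
  assumes A: "A \<in> sets P"
  shows "emeasure P A = (\<Prod>i<n. ennreal \<bar>c i\<bar>) * emeasure P ((\<lambda>x. \<lambda>i\<in>{..<n}. t i + c i * x i) -` A \<inter> space P)"
proof -
  define g where "g = (\<lambda>x::nat \<Rightarrow> real. \<lambda>i\<in>{..<n}. t i + c i * x i)"
  have g: "g \<in> measurable P P"
    unfolding g_def P_def by (intro measurable_restrict) (simp add: measurable_lborel_pow_coord)
  have "scale_measure (\<Prod>i<n. ennreal \<bar>c i\<bar>) (distr P P g) = P"
    unfolding P_def
  proof (rule lborel_prod.PiM_eqI)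
    fix B :: "nat \<Rightarrow> real set" assume B: "\<And>i. i \<in> {..<n} \<Longrightarrow> B i \<in> sets lborel"
    have "g -` Pi\<^sub>E {..<n} B \<inter> space P = Pi\<^sub>E {..<n} (\<lambda>i. (\<lambda>x. t i + c i * x) -` B i)"
      unfolding g_def P_def by (auto simp: space_PiM PiE_def Pi_def)
    moreover have PB: "Pi\<^sub>E {..<n} B \<in> sets P" unfolding P_def using B by (intro sets_PiM_I_finite) auto
    moreover have "emeasure P (Pi\<^sub>E {..<n} (\<lambda>i. (\<lambda>x. t i + c i * x) -` B i))
        = (\<Prod>i<n. emeasure lborel ((\<lambda>x. t i + c i * x) -` B i))"
      unfolding P_def
    proof (rule lborel_prod.emeasure_PiM)
      fix i assume "i \<in> {..<n}"
      then show "(\<lambda>x. t i + c i * x) -` B i \<in> sets lborel"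
        using B[of i] by (auto intro!: measurable_sets_borel[of _ borel])
    qed simp
    moreover have "(\<Prod>i<n. ennreal \<bar>c i\<bar>) * (\<Prod>i<n. emeasure lborel ((\<lambda>x. t i + c i * x) -` B i))
        = (\<Prod>i<n. emeasure lborel (B i))"
      unfolding prod.distrib[symmetric]
      using B c by (intro prod.cong refl emeasure_lborel_affine[symmetric]) auto
    ultimately show "emeasure (scale_measure (\<Prod>i<n. ennreal \<bar>c i\<bar>) (distr (lborel_pow n) (lborel_pow n) g)) (Pi\<^sub>E {..<n} B)
        = (\<Prod>i\<in>{..<n}. emeasure lborel (B i))"
      using g unfolding P_def by (simp add: emeasure_distr)
  qed (auto simp: P_def)
  then have "emeasure P A = emeasure (scale_measure (\<Prod>i<n. ennreal \<bar>c i\<bar>) (distr P P g)) A" by simp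
  also have "\<dots> = (\<Prod>i<n. ennreal \<bar>c i\<bar>) * emeasure P (g -` A \<inter> space P)"
    using A g by (simp add: emeasure_distr)
  finally show ?thesis by (simp add: g_def)
qed

lemma measurable_affine_Rborel:
  assumes "t \<in> Rn n"
  shows "(\<lambda>x i. t i + c i * x i) \<in> measurable (Rborel n) (Rborel n)"
  by (rule measurable_into_Rborel) (use assms in \<open>auto simp: Rn_iff\<close>)

lemma emeasure_leb_affine:
  assumes c: "\<And>i. i < n \<Longrightarrow> c i \<noteq> 0" and t: "t \<in> Rn n" and A: "A \<in> sets (Rborel n)"
  shows "emeasure (leb n) A = (\<Prod>i<n. ennreal \<bar>c i\<bar>) * emeasure (leb n) {x \<in> Rn n. (\<lambda>i. t i + c i * x i) \<in> A}"
proof -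
  let ?P = "lborel_pow n"
  define B where "B = {x \<in> Rn n. (\<lambda>i. t i + c i * x i) \<in> A}"
  have B: "B \<in> sets (Rborel n)"
    using sets_Collect_mem_measurable[OF measurable_affine_Rborel[OF t, of c] A]
    by (simp add: B_def)
  have "zero_ext n -` A \<inter> space ?P \<in> sets ?P"
    using measurable_sets[OF measurable_zero_ext A] .
  from emeasure_PiM_affine[OF c this, where t = t]
  have "emeasure (leb n) A = (\<Prod>i<n. ennreal \<bar>c i\<bar>) *
      emeasure ?P ((\<lambda>x. \<lambda>i\<in>{..<n}. t i + c i * x i) -` (zero_ext n -` A \<inter> space ?P) \<inter> space ?P)"
    by (simp add: emeasure_leb[OF A])
  also have "(\<lambda>x. \<lambda>i\<in>{..<n}. t i + c i * x i) -` (zero_ext n -` A \<inter> space ?P) \<inter> space ?P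
      = zero_ext n -` B \<inter> space ?P"
  proof -
    have "zero_ext n (\<lambda>i\<in>{..<n}. t i + c i * x i) = (\<lambda>i. t i + c i * zero_ext n x i)" for x
      using t by (auto simp: zero_ext_def Rn_iff fun_eq_iff)
    then show ?thesis by (auto simp: B_def zero_ext_Rn space_PiM)
  qed
  finally show ?thesis using emeasure_leb[OF B] by (simp add: B_def)
qed

lemma measurable_shift: "v \<in> Rn n \<Longrightarrow> (\<lambda>x i. v i + x i) \<in> measurable (Rborel n) (Rborel n)"
  using measurable_affine_Rborel[of v n "\<lambda>_. 1"] by simp

definition shift_invariant :: "nat \<Rightarrow> (nat \<Rightarrow> real) measure \<Rightarrow> bool" where
  "shift_invariant n \<nu> \<longleftrightarrow> sets \<nu> = sets (Rborel n) \<and>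
     (\<forall>v\<in>Rn n. \<forall>A\<in>sets (Rborel n). emeasure \<nu> {x \<in> Rn n. (\<lambda>i. v i + x i) \<in> A} = emeasure \<nu> A)"

lemma shift_invariant_leb: "shift_invariant n (leb n)"
  unfolding shift_invariant_def using emeasure_leb_affine[of n "\<lambda>_. 1"] by simp

lemma shift_invariant_nn_integral:
  assumes \<nu>: "shift_invariant n \<nu>" and v: "v \<in> Rn n" and f: "f \<in> borel_measurable (Rborel n)"
  shows "(\<integral>\<^sup>+x. f (\<lambda>i. v i + x i) \<partial>\<nu>) = (\<integral>\<^sup>+x. f x \<partial>\<nu>)"
proof -
  have s: "sets \<nu> = sets (Rborel n)" using \<nu> by (simp add: shift_invariant_def)
  have m: "(\<lambda>x i. v i + x i) \<in> measurable \<nu> \<nu>"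
    using measurable_shift[OF v] by (simp add: measurable_cong_sets[OF s s])
  have "distr \<nu> \<nu> (\<lambda>x i. v i + x i) = \<nu>"
  proof (rule measure_eqI)
    fix A assume "A \<in> sets (distr \<nu> \<nu> (\<lambda>x i. v i + x i))"
    then have A: "A \<in> sets (Rborel n)" by (simp add: s)
    have "(\<lambda>x i. v i + x i) -` A \<inter> space \<nu> = {x \<in> Rn n. (\<lambda>i. v i + x i) \<in> A}"
      using sets_eq_imp_space_eq[OF s] by auto
    then show "emeasure (distr \<nu> \<nu> (\<lambda>x i. v i + x i)) A = emeasure \<nu> A"
      using \<nu> v A by (simp add: emeasure_distr[OF m] s shift_invariant_def)
  qed simp
  then have "(\<integral>\<^sup>+x. f x \<partial>\<nu>) = (\<integral>\<^sup>+x. f x \<partial>distr \<nu> \<nu> (\<lambda>x i. v i + x i))" by simp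
  also have "\<dots> = (\<integral>\<^sup>+x. f (\<lambda>i. v i + x i) \<partial>\<nu>)"
    using f by (intro nn_integral_distr[OF m]) (simp add: measurable_cong_sets[OF s refl])
  finally show ?thesis by simp
qed

lemma sigma_finite_leb: "sigma_finite_measure (leb n)"
proof
  define C where "C m = cube n (real m)" for m
  have C: "C m \<in> sets (Rborel n)" "emeasure (leb n) (C m) \<noteq> \<infinity>" for m
    by (simp_all add: C_def sets_cube emeasure_cube)
  have "Rn n \<subseteq> (\<Union>m. C m)"
  proof
    fix x assume x: "x \<in> Rn n"
    obtain m where m: "(\<Sum>i<n. \<bar>x i\<bar>) \<le> real m" using real_arch_simple by blast
    have "x i \<in> {- real m .. real m}" if "i < n" for i
    proof -
      have "\<bar>x i\<bar> \<le> (\<Sum>i<n. \<bar>x i\<bar>)"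
        using that by (intro member_le_sum) auto
      then show ?thesis using m by (simp add: abs_le_iff)
    qed
    then have "x \<in> C m" using x by (simp add: C_def cube_def)
    then show "x \<in> (\<Union>m. C m)" by blast
  qed
  moreover have "C m \<subseteq> Rn n" for m by (auto simp: C_def cube_def)
  ultimately show "\<exists>A. countable A \<and> A \<subseteq> sets (leb n) \<and> \<Union> A = space (leb n) \<and> (\<forall>a\<in>A. emeasure (leb n) a \<noteq> \<infinity>)"
    using C by (intro exI[of _ "range C"]) auto
qed

text \<open>Uniqueness of translation invariant measures: both sides equal the double integral of
  \<open>1\<^sub>A (x + y) * 1\<^sub>D y\<close>.\<close>
lemma shift_invariant_unique:
  assumes \<nu>: "shift_invariant n \<nu>" "sigma_finite_measure \<nu>"
    and A: "A \<in> sets (Rborel n)" and D: "D \<in> sets (Rborel n)"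
    and sym: "\<And>x. x \<in> D \<Longrightarrow> (\<lambda>i. - x i) \<in> D"
  shows "emeasure \<nu> A * emeasure (leb n) D = emeasure (leb n) A * emeasure \<nu> D"
proof -
  interpret L: sigma_finite_measure "leb n" by (rule sigma_finite_leb)
  interpret N: sigma_finite_measure \<nu> by (rule \<nu>(2))
  interpret pair_sigma_finite \<nu> "leb n" ..
  have s [measurable_cong]: "sets \<nu> = sets (Rborel n)" using \<nu> by (simp add: shift_invariant_def)
  have sp: "space \<nu> = Rn n" using sets_eq_imp_space_eq[OF s] by simp
  note [measurable] = A D
  have add [measurable]: "(\<lambda>z i. fst z i + snd z i) \<in> measurable (\<nu> \<Otimes>\<^sub>M leb n) (Rborel n)"
  proof (rule measurable_into_Rborel)
    fix z assume "z \<in> space (\<nu> \<Otimes>\<^sub>M leb n)"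
    then show "(\<lambda>i. fst z i + snd z i) \<in> Rn n" by (auto simp: space_pair_measure sp Rn_iff)
  qed measurable
  have sub [measurable]: "(\<lambda>z i. snd z i - fst z i) \<in> measurable (\<nu> \<Otimes>\<^sub>M leb n) (Rborel n)"
  proof (rule measurable_into_Rborel)
    fix z assume "z \<in> space (\<nu> \<Otimes>\<^sub>M leb n)"
    then show "(\<lambda>i. snd z i - fst z i) \<in> Rn n" by (auto simp: space_pair_measure sp Rn_iff)
  qed measurable
  have "emeasure \<nu> A * emeasure (leb n) D = (\<integral>\<^sup>+y. indicator D y * emeasure \<nu> A \<partial>leb n)"
    by (simp add: nn_integral_multc mult.commute)
  also have "\<dots> = (\<integral>\<^sup>+y. \<integral>\<^sup>+x. indicator D y * indicator A (\<lambda>i. x i + y i) \<partial>\<nu> \<partial>leb n)"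
  proof (rule nn_integral_cong)
    fix y assume "y \<in> space (leb n)"
    then have y: "y \<in> Rn n" by simp
    have "(\<lambda>x. indicator A (\<lambda>i. y i + x i) :: ennreal) \<in> borel_measurable \<nu>"
      using measurable_shift[OF y] by measurable
    then have "(\<integral>\<^sup>+x. indicator D y * indicator A (\<lambda>i. y i + x i) \<partial>\<nu>)
        = indicator D y * (\<integral>\<^sup>+x. indicator A (\<lambda>i. y i + x i) \<partial>\<nu>)"
      by (intro nn_integral_cmult)
    also have "(\<integral>\<^sup>+x. indicator A (\<lambda>i. y i + x i) \<partial>\<nu>) = emeasure \<nu> A"
      by (subst shift_invariant_nn_integral[OF \<nu>(1) y]) auto
    finally show "indicator D y * emeasure \<nu> A = (\<integral>\<^sup>+x. indicator D y * indicator A (\<lambda>i. x i + y i) \<partial>\<nu>)"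
      by (simp add: add.commute)
  qed
  also have "\<dots> = (\<integral>\<^sup>+x. \<integral>\<^sup>+y. indicator D y * indicator A (\<lambda>i. x i + y i) \<partial>leb n \<partial>\<nu>)"
    by (rule Fubini'[of "\<lambda>x y. indicator D y * indicator A (\<lambda>i. x i + y i)"]) (simp add: split_beta)
  \<comment> \<open>Invariance of \<open>leb\<close> under the shift by \<open>x\<close> moves the
    translation from \<open>A\<close> to \<open>D\<close>. Symmetry of \<open>D\<close> later
    replaces \<open>y - x\<close> by \<open>x - y\<close>, which makes the inner integral a shift
    for \<open>\<nu>\<close>.\<close>
  also have "\<dots> = (\<integral>\<^sup>+x. \<integral>\<^sup>+y. indicator D (\<lambda>i. y i - x i) * indicator A y \<partial>leb n \<partial>\<nu>)"
  proof (rule nn_integral_cong)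
    fix x assume "x \<in> space \<nu>"
    then have x: "x \<in> Rn n" by (simp add: sp)
    then have "(\<lambda>y i. - x i + y i) \<in> measurable (Rborel n) (Rborel n)"
      by (intro measurable_shift) (simp add: Rn_iff)
    then have "(\<lambda>y. indicator D (\<lambda>i. - x i + y i) * indicator A y :: ennreal) \<in> borel_measurable (Rborel n)"
      by measurable
    from shift_invariant_nn_integral[OF shift_invariant_leb x this]
    show "(\<integral>\<^sup>+y. indicator D y * indicator A (\<lambda>i. x i + y i) \<partial>leb n)
        = (\<integral>\<^sup>+y. indicator D (\<lambda>i. y i - x i) * indicator A y \<partial>leb n)"
      by simp
  qed
  also have "\<dots> = (\<integral>\<^sup>+y. \<integral>\<^sup>+x. indicator D (\<lambda>i. y i - x i) * indicator A y \<partial>\<nu> \<partial>leb n)"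
    by (rule Fubini'[symmetric, of "\<lambda>x y. indicator D (\<lambda>i. y i - x i) * indicator A y"]) (simp add: split_beta)
  also have "\<dots> = (\<integral>\<^sup>+y. indicator A y * emeasure \<nu> D \<partial>leb n)"
  proof (rule nn_integral_cong)
    fix y assume "y \<in> space (leb n)"
    then have y: "(\<lambda>i. - y i) \<in> Rn n" by (simp add: Rn_iff)
    have e: "indicator D (\<lambda>i. y i - x i) = (indicator D (\<lambda>i. - y i + x i) :: ennreal)" for x
      using sym[of "\<lambda>i. y i - x i"] sym[of "\<lambda>i. - y i + x i"] by (auto simp: indicator_def)
    have "(\<lambda>x. indicator D (\<lambda>i. - y i + x i) :: ennreal) \<in> borel_measurable \<nu>"
      using measurable_shift[OF y] by measurable
    then have "(\<integral>\<^sup>+x. indicator D (\<lambda>i. - y i + x i) * indicator A y \<partial>\<nu>)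
        = (\<integral>\<^sup>+x. indicator D (\<lambda>i. - y i + x i) \<partial>\<nu>) * indicator A y"
      by (intro nn_integral_multc)
    also have "(\<integral>\<^sup>+x. indicator D (\<lambda>i. - y i + x i) \<partial>\<nu>) = emeasure \<nu> D"
      by (subst shift_invariant_nn_integral[OF \<nu>(1) y]) auto
    finally show "(\<integral>\<^sup>+x. indicator D (\<lambda>i. y i - x i) * indicator A y \<partial>\<nu>) = indicator A y * emeasure \<nu> D"
      by (simp add: e mult.commute)
  qed
  also have "\<dots> = emeasure (leb n) A * emeasure \<nu> D"
    by (simp add: nn_integral_multc)
  finally show ?thesis .
qed

subsection \<open>Orthogonal maps\<close>

lemma inner_n_commute: "inner_n n x y = inner_n n y x"
  by (simp add: inner_n_def mult.commute)

lemma inner_n_add: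
  "inner_n n (\<lambda>i. x i + y i) z = inner_n n x z + inner_n n y z"
  "inner_n n z (\<lambda>i. x i + y i) = inner_n n z x + inner_n n z y"
  "inner_n n (\<lambda>i. x i - y i) z = inner_n n x z - inner_n n y z"
  "inner_n n z (\<lambda>i. x i - y i) = inner_n n z x - inner_n n z y"
  "inner_n n (\<lambda>i. a * x i) z = a * inner_n n x z"
  "inner_n n z (\<lambda>i. a * x i) = a * inner_n n z x"
  "inner_n n (\<lambda>i. x i / a) z = inner_n n x z / a"
  "inner_n n z (\<lambda>i. x i / a) = inner_n n z x / a"
  by (simp_all add: inner_n_def sum.distrib sum_distrib_left sum_subtractf sum_divide_distrib algebra_simps)

lemma inner_n_sum:
  "inner_n n (\<lambda>i. \<Sum>j\<in>J. c j * f j i) z = (\<Sum>j\<in>J. c j * inner_n n (f j) z)"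
  "inner_n n z (\<lambda>i. \<Sum>j\<in>J. c j * f j i) = (\<Sum>j\<in>J. c j * inner_n n z (f j))"
proof -
  show "inner_n n (\<lambda>i. \<Sum>j\<in>J. c j * f j i) z = (\<Sum>j\<in>J. c j * inner_n n (f j) z)" for z
    unfolding inner_n_def sum_distrib_left sum_distrib_right
    by (subst sum.swap) (simp add: mult.assoc)
  then show "inner_n n z (\<lambda>i. \<Sum>j\<in>J. c j * f j i) = (\<Sum>j\<in>J. c j * inner_n n z (f j))"
    by (simp add: inner_n_commute[of n z])
qed

lemma inner_n_nonneg [simp]: "inner_n n x x \<ge> 0"
  by (simp add: inner_n_def sum_nonneg)

lemma norm_n_nonneg [simp]: "norm_n n x \<ge> 0"
  by (simp add: norm_n_def)

lemma norm_n_sq: "(norm_n n x)\<^sup>2 = inner_n n x x"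
  by (simp add: norm_n_def)

lemma norm_n_sq_sum: "(norm_n n x)\<^sup>2 = (\<Sum>i<n. (x i)\<^sup>2)"
  unfolding norm_n_sq inner_n_def by (simp add: power2_eq_square)

lemma norm_n_le_iff: "r \<ge> 0 \<Longrightarrow> norm_n n x \<le> r \<longleftrightarrow> inner_n n x x \<le> r\<^sup>2"
  unfolding norm_n_def using real_sqrt_le_iff[of "inner_n n x x" "r\<^sup>2"] by simp

lemma norm_n_scale: "norm_n n (\<lambda>i. a * x i) = \<bar>a\<bar> * norm_n n x"
  by (simp add: norm_n_def inner_n_add real_sqrt_mult[symmetric] mult.assoc[symmetric])
     (simp add: real_sqrt_mult)

lemma norm_n_divide: "norm_n n (\<lambda>i. x i / a) = norm_n n x / \<bar>a\<bar>"
  using norm_n_scale[of n "1 / a" x] by (simp add: field_simps)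

lemma abs_le_norm_n: "i < n \<Longrightarrow> \<bar>x i\<bar> \<le> norm_n n x"
proof -
  assume "i < n"
  then have "(x i)\<^sup>2 \<le> (norm_n n x)\<^sup>2"
    unfolding norm_n_sq_sum by (intro member_le_sum) auto
  then show ?thesis by (simp add: power2_le_iff_abs_le)
qed

lemma norm_n_le_imp_cube:
  assumes "x \<in> Rn n" "norm_n n x \<le> r"
  shows "x \<in> cube n r"
proof -
  have "x i \<in> {- r .. r}" if "i < n" for i
    using abs_le_norm_n[OF that, of x] assms(2) by (simp add: abs_le_iff)
  then show ?thesis using assms(1) by (simp add: cube_def)
qed

lemma norm_n_eq_0_iff: "x \<in> Rn n \<Longrightarrow> norm_n n x = 0 \<longleftrightarrow> x = (\<lambda>i. 0)"
proof
  assume x: "x \<in> Rn n" "norm_n n x = 0"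
  show "x = (\<lambda>i. 0)"
  proof
    fix i show "x i = 0" using abs_le_norm_n[of i n x] x by (cases "i < n") (auto simp: Rn_iff)
  qed
qed (simp add: norm_n_def inner_n_def)

lemma continuous_on_inner_n [continuous_intros]:
  assumes "continuous_on S f" "continuous_on S g"
  shows "continuous_on S (\<lambda>x. inner_n n (f x) (g x))"
  unfolding inner_n_def
  by (intro continuous_intros assms[THEN continuous_on_product_then_coordinatewise])

lemma continuous_on_norm_n [continuous_intros]:
  "continuous_on S f \<Longrightarrow> continuous_on S (\<lambda>x. norm_n n (f x))"
  unfolding norm_n_def by (intro continuous_on_real_sqrt continuous_on_inner_n)

lemma measurable_norm_n [measurable]: "norm_n n \<in> borel_measurable (Rborel n)"
  unfolding norm_n_def inner_n_def by measurable

definition unit_vec :: "nat \<Rightarrow> nat \<Rightarrow> real" where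
  "unit_vec j = (\<lambda>i. if i = j then 1 else 0)"

lemma unit_vec_Rn: "j < n \<Longrightarrow> unit_vec j \<in> Rn n"
  by (auto simp: unit_vec_def Rn_iff)

lemma inner_n_unit_vec: "j < n \<Longrightarrow> inner_n n x (unit_vec j) = x j"
  by (simp add: inner_n_def unit_vec_def indicator_mult_simps)

lemma linear_n_expansion:
  assumes T: "linear_n n T" and x: "x \<in> Rn n"
  shows "T x = (\<lambda>i. \<Sum>j<n. x j * T (unit_vec j) i)"
proof -
  have "T (\<lambda>i. if i < m then x i else 0) = (\<lambda>i. \<Sum>j<m. x j * T (unit_vec j) i)" if "m \<le> n" for m
    using that
  proof (induction m)
    case 0
    have "T (\<lambda>i. 0 * x i) = (\<lambda>i. 0 * T x i)" using T x unfolding linear_n_def by blast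
    then show ?case by simp
  next
    case (Suc m)
    have "(\<lambda>i. if i < Suc m then x i else 0) = (\<lambda>i. (if i < m then x i else 0) + x m * unit_vec m i)"
      by (auto simp: unit_vec_def fun_eq_iff less_Suc_eq)
    moreover have "(\<lambda>i. if i < m then x i else 0) \<in> Rn n" "(\<lambda>i. x m * unit_vec m i) \<in> Rn n"
      "unit_vec m \<in> Rn n"
      using Suc.prems by (auto simp: Rn_iff unit_vec_def)
    ultimately show ?case using T Suc unfolding linear_n_def by (simp add: fun_eq_iff)
  qed
  from this[of n] zero_ext_id[OF x] show ?thesis by (simp add: zero_ext_def)
qed

text \<open>The value 0 from index \<open>n\<close> on puts every result into \<open>Rn n\<close>,
  whatever \<open>Q\<close> and \<open>x\<close> are outside the first \<open>n\<close>
  indices.\<close>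

definition mat_app :: "nat \<Rightarrow> (nat \<Rightarrow> nat \<Rightarrow> real) \<Rightarrow> (nat \<Rightarrow> real) \<Rightarrow> (nat \<Rightarrow> real)" where
  "mat_app n Q x = (\<lambda>i. if i < n then \<Sum>j<n. Q i j * x j else 0)"

abbreviation (input) transp :: "(nat \<Rightarrow> nat \<Rightarrow> real) \<Rightarrow> nat \<Rightarrow> nat \<Rightarrow> real" where
  "transp Q \<equiv> \<lambda>i j. Q j i"

abbreviation orth_n :: "nat \<Rightarrow> (nat \<Rightarrow> nat \<Rightarrow> real) \<Rightarrow> bool" where
  "orth_n n \<equiv> orthogonal_mat {..<n}"

lemma mat_app_Rn: "mat_app n Q x \<in> Rn n"
  by (simp add: mat_app_def Rn_iff)

lemma mat_app_lincomb:
  "mat_app n Q (\<lambda>i. x i + y i) = (\<lambda>i. mat_app n Q x i + mat_app n Q y i)"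
  "mat_app n Q (\<lambda>i. a * x i) = (\<lambda>i. a * mat_app n Q x i)"
  by (auto simp: mat_app_def fun_eq_iff sum.distrib sum_distrib_left algebra_simps)

lemma linear_n_mat:
  assumes "linear_n n T" "x \<in> Rn n"
  shows "T x = mat_app n (\<lambda>i j. T (unit_vec j) i) x"
proof -
  have "T x \<in> Rn n" using assms unfolding linear_n_def by blast
  then show ?thesis
    using linear_n_expansion[OF assms] by (auto simp: mat_app_def Rn_iff fun_eq_iff mult.commute)
qed

lemma inner_n_mat_app: "inner_n n (mat_app n Q x) y = inner_n n x (mat_app n (transp Q) y)"
proof -
  have "inner_n n (mat_app n Q x) y = (\<Sum>i<n. \<Sum>j<n. Q i j * x j * y i)"
    unfolding inner_n_def mat_app_def by (intro sum.cong refl) (simp add: sum_distrib_right)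
  also have "\<dots> = (\<Sum>j<n. \<Sum>i<n. Q i j * x j * y i)" by (rule sum.swap)
  also have "\<dots> = inner_n n x (mat_app n (transp Q) y)"
    unfolding inner_n_def mat_app_def by (intro sum.cong refl) (simp add: sum_distrib_left mult_ac)
  finally show ?thesis .
qed

lemma mat_app_transp_cancel:
  assumes Q: "orth_n n Q" and x: "x \<in> Rn n"
  shows "mat_app n (transp Q) (mat_app n Q x) = x" "mat_app n Q (mat_app n (transp Q) x) = x"
proof -
  have *: "mat_app n (transp Q) (mat_app n Q x) = x" if Q: "orth_n n Q" for Q
  proof
    fix i
    show "mat_app n (transp Q) (mat_app n Q x) i = x i"
    proof (cases "i < n")
      case True
      have "(\<Sum>j<n. Q j i * (\<Sum>k<n. Q j k * x k)) = (\<Sum>k<n. \<Sum>j<n. x k * (Q j i * Q j k))"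
        unfolding sum_distrib_left by (subst sum.swap) (intro sum.cong refl, simp add: mult_ac)
      also have "\<dots> = (\<Sum>k<n. x k * (if i = k then 1 else 0))"
        using True by (intro sum.cong refl) (simp add: sum_distrib_left[symmetric] orthogonal_matD(2)[OF Q])
      also have "\<dots> = x i" using True by (simp add: indicator_mult_simps)
      finally show ?thesis using True by (simp add: mat_app_def)
    qed (use x in \<open>auto simp: mat_app_def Rn_iff\<close>)
  qed
  show "mat_app n (transp Q) (mat_app n Q x) = x" by (rule *[OF Q])
  show "mat_app n Q (mat_app n (transp Q) x) = x"
    using *[OF orthogonal_mat_transpose[OF Q]] by simp
qed

lemma inner_n_mat_app_orth:
  assumes "orth_n n Q" "y \<in> Rn n"
  shows "inner_n n (mat_app n Q x) (mat_app n Q y) = inner_n n x y"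
  by (simp add: inner_n_mat_app mat_app_transp_cancel[OF assms])

lemma norm_n_mat_app_orth: "orth_n n Q \<Longrightarrow> x \<in> Rn n \<Longrightarrow> norm_n n (mat_app n Q x) = norm_n n x"
  by (simp add: norm_n_def inner_n_mat_app_orth)

text \<open>Every row has norm at most 1 by Bessel's inequality, and the squared norms of all rows
  add up to \<open>n\<close>.\<close>
lemma orthonormal_columns_imp_orth_n:
  assumes cols: "\<And>j k. j < n \<Longrightarrow> k < n \<Longrightarrow> (\<Sum>i<n. Q i j * Q i k) = (if j = k then 1 else 0)"
  shows "orth_n n Q"
proof -
  define P where "P a b = (\<Sum>j<n. Q a j * Q b j)" for a b
  \<comment> \<open>\<open>P\<close> is \<open>Q\<close> times its transpose and is idempotent
    because the columns are orthonormal. Hence the squared distance between row \<open>a\<close> of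
    \<open>P\<close> and the unit vector \<open>a\<close> is \<open>1 - P a a\<close>; as the trace
    of \<open>P\<close> is \<open>n\<close>, all these distances vanish.\<close>
  have dev: "(\<Sum>i<n. ((if i = a then 1 else 0) - P a i)\<^sup>2) = 1 - P a a" if a: "a < n" for a
  proof -
    have "(\<Sum>i<n. (P a i)\<^sup>2) = (\<Sum>i<n. \<Sum>j<n. \<Sum>k<n. Q a j * Q a k * (Q i j * Q i k))"
      unfolding P_def power2_eq_square sum_product by (intro sum.cong refl) (simp add: mult_ac)
    also have "\<dots> = (\<Sum>j<n. \<Sum>i<n. \<Sum>k<n. Q a j * Q a k * (Q i j * Q i k))" by (rule sum.swap)
    also have "\<dots> = (\<Sum>j<n. \<Sum>k<n. \<Sum>i<n. Q a j * Q a k * (Q i j * Q i k))"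
      by (rule sum.cong[OF refl], rule sum.swap)
    also have "\<dots> = (\<Sum>j<n. \<Sum>k<n. Q a j * Q a k * (if j = k then 1 else 0))"
      by (intro sum.cong refl) (simp add: sum_distrib_left[symmetric] cols)
    also have "\<dots> = P a a" by (simp add: indicator_mult_simps P_def)
    finally have PP: "(\<Sum>i<n. (P a i)\<^sup>2) = P a a" .
    have "(\<Sum>i<n. ((if i = a then 1 else 0) - P a i)\<^sup>2)
        = (\<Sum>i<n. (if i = a then 1 - 2 * P a a else 0) + (P a i)\<^sup>2)"
      by (intro sum.cong refl) (auto simp: power2_eq_square algebra_simps)
    also have "\<dots> = 1 - P a a" using a by (simp add: sum.distrib PP)
    finally show ?thesis .
  qed
  have le: "P a a \<le> 1" if "a < n" for a
    using dev[OF that] sum_nonneg[of "{..<n}" "\<lambda>i. ((if i = a then 1 else 0) - P a i)\<^sup>2"] by simp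
  have "(\<Sum>a<n. P a a) = (\<Sum>j<n. \<Sum>a<n. Q a j * Q a j)" unfolding P_def by (rule sum.swap)
  also have "\<dots> = (\<Sum>a<n. 1)" by (simp add: cols)
  finally have "(\<Sum>a<n. 1 - P a a) = 0" by (simp add: sum_subtractf)
  then have "\<forall>a\<in>{..<n}. 1 - P a a = 0"
    by (subst (asm) sum_nonneg_eq_0_iff) (auto simp: le)
  then have "(\<Sum>i<n. ((if i = a then 1 else 0) - P a i)\<^sup>2) = 0" if "a < n" for a
    using dev[OF that] that by simp
  then have "\<forall>i\<in>{..<n}. ((if i = a then 1 else 0) - P a i)\<^sup>2 = 0" if "a < n" for a
    using that by (subst (asm) sum_nonneg_eq_0_iff) auto
  then have "P a i = (if a = i then 1 else 0)" if "a < n" "i < n" for a i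
  proof -
    have "(if i = a then 1 else 0) = P a i"
      using \<open>\<And>a. a < n \<Longrightarrow> \<forall>i\<in>{..<n}. ((if i = a then 1 else 0) - P a i)\<^sup>2 = 0\<close>[OF that(1)] that(2)
      by (simp only: zero_eq_power2 right_minus_eq) blast
    then show ?thesis by auto
  qed
  then show ?thesis unfolding orthogonal_mat_def using cols by (auto simp: P_def)
qed

lemma orthogonal_n_mat:
  assumes "orthogonal_n n U"
  obtains Q where "orth_n n Q" "\<And>x. x \<in> Rn n \<Longrightarrow> U x = mat_app n Q x"
proof
  let ?Q = "\<lambda>i j. U (unit_vec j) i"
  have lin: "linear_n n U" using assms by (simp add: orthogonal_n_def)
  show "U x = mat_app n ?Q x" if "x \<in> Rn n" for x by (rule linear_n_mat[OF lin that])
  show "orth_n n ?Q"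
  proof (rule orthonormal_columns_imp_orth_n)
    fix j k assume jk: "j < n" "k < n"
    have "(\<Sum>i<n. ?Q i j * ?Q i k) = inner_n n (unit_vec j) (unit_vec k)"
      using assms unit_vec_Rn[OF jk(1)] unit_vec_Rn[OF jk(2)]
      unfolding orthogonal_n_def inner_n_def by blast
    also have "\<dots> = (if j = k then 1 else 0)"
      using jk by (simp add: inner_n_unit_vec) (simp add: unit_vec_def)
    finally show "(\<Sum>i<n. ?Q i j * ?Q i k) = (if j = k then 1 else 0)" .
  qed
qed

lemma measurable_mat_app [measurable]: "mat_app n Q \<in> measurable (Rborel n) (Rborel n)"
proof (rule measurable_into_Rborel)
  fix i assume "i < n"
  then show "(\<lambda>x. mat_app n Q x i) \<in> borel_measurable (Rborel n)"
    unfolding mat_app_def by simp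
qed (rule mat_app_Rn)

section \<open>Invariance of Lebesgue measure under orthogonal matrices\<close>

lemma sets_unit_ball: "unit_ball n \<in> sets (Rborel n)"
proof -
  have "{x \<in> space (Rborel n). norm_n n x \<le> 1} \<in> sets (Rborel n)" by measurable
  then show ?thesis by (simp add: unit_ball_def)
qed

text \<open>The ball lies between two cubes. In the inner one each of the \<open>n\<close> squared
  coordinates is at most \<open>1 / (n + 1)\<close>, so they add up to at most 1.\<close>

lemma emeasure_unit_ball: "emeasure (leb n) (unit_ball n) \<noteq> 0" "emeasure (leb n) (unit_ball n) \<noteq> \<infinity>"
proof -
  define B where "B = cube n"
  note B = sets_cube[of n, folded B_def] emeasure_cube[of _ n, folded B_def]
  have "unit_ball n \<subseteq> B 1"
    unfolding B_def unit_ball_def using norm_n_le_imp_cube by blast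
  then have "emeasure (leb n) (unit_ball n) \<le> ennreal ((2 * 1) ^ n)"
    using emeasure_mono[of "unit_ball n" "B 1" "leb n"] B[of 1] by simp
  then show "emeasure (leb n) (unit_ball n) \<noteq> \<infinity>" by (auto simp: top_unique)
  have "B (1 / real (Suc n)) \<subseteq> unit_ball n"
  proof
    fix x assume x: "x \<in> B (1 / real (Suc n))"
    have "(norm_n n x)\<^sup>2 \<le> (\<Sum>i<n. 1 / real (Suc n))"
      unfolding norm_n_sq_sum
    proof (rule sum_mono)
      fix i assume "i \<in> {..<n}"
      then have "\<bar>x i\<bar> \<le> 1 / real (Suc n)" using x by (auto simp: B_def cube_def abs_le_iff)
      then have "(x i)\<^sup>2 \<le> (1 / real (Suc n))\<^sup>2" by (metis abs_ge_zero power2_abs power_mono)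
      also have "\<dots> \<le> 1 / real (Suc n)" unfolding power2_eq_square by (rule mult_left_le) auto
      finally show "(x i)\<^sup>2 \<le> 1 / real (Suc n)" .
    qed
    also have "\<dots> \<le> 1\<^sup>2" by simp
    finally have "norm_n n x \<le> 1" by (rule power2_le_imp_le) simp
    then show "x \<in> unit_ball n" using x by (simp add: B_def cube_def unit_ball_def)
  qed
  then have "ennreal ((2 * (1 / real (Suc n))) ^ n) \<le> emeasure (leb n) (unit_ball n)"
    using emeasure_mono[of "B (1 / real (Suc n))" "unit_ball n" "leb n"] B[of "1 / real (Suc n)"]
      sets_unit_ball by simp
  moreover have "ennreal ((2 * (1 / real (Suc n))) ^ n) > 0" by simp
  ultimately show "emeasure (leb n) (unit_ball n) \<noteq> 0" by (metis not_le)
qed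

text \<open>The image of \<open>leb\<close> under an orthogonal matrix is again translation
  invariant, hence proportional to \<open>leb\<close>. The unit ball is mapped to itself, so the
  factor is 1.\<close>

lemma emeasure_leb_orth:
  assumes Q: "orth_n n Q" and A: "A \<in> sets (Rborel n)"
  shows "emeasure (leb n) {x \<in> Rn n. mat_app n Q x \<in> A} = emeasure (leb n) A"
proof -
  define \<nu> where "\<nu> = distr (leb n) (Rborel n) (mat_app n Q)"
  have m: "mat_app n P \<in> measurable (leb n) (Rborel n)" for P
    using measurable_mat_app by (simp add: measurable_cong_sets[OF sets_leb refl])
  have \<nu>: "emeasure \<nu> B = emeasure (leb n) {x \<in> Rn n. mat_app n Q x \<in> B}" if "B \<in> sets (Rborel n)" for B
  proof -
    have "mat_app n Q -` B \<inter> space (leb n) = {x \<in> Rn n. mat_app n Q x \<in> B}" by auto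
    then show ?thesis unfolding \<nu>_def using emeasure_distr[OF m that] by simp
  qed
  have pre: "{x \<in> Rn n. mat_app n P x \<in> B} \<in> sets (Rborel n)" if "B \<in> sets (Rborel n)" for B P
    using sets_Collect_mem_measurable[OF measurable_mat_app that] by simp
  have "shift_invariant n \<nu>"
    unfolding shift_invariant_def
  proof (intro conjI ballI)
    fix v B assume v: "v \<in> Rn n" and B: "B \<in> sets (Rborel n)"
    have "{x \<in> Rn n. (\<lambda>i. v i + x i) \<in> B} \<in> sets (Rborel n)"
      using sets_Collect_mem_measurable[OF measurable_shift[OF v] B] by simp
    then have "emeasure \<nu> {x \<in> Rn n. (\<lambda>i. v i + x i) \<in> B}
        = emeasure (leb n) {x \<in> Rn n. (\<lambda>i. v i + mat_app n Q x i) \<in> B}"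
      by (simp add: \<nu> mat_app_Rn)
    also have "{x \<in> Rn n. (\<lambda>i. v i + mat_app n Q x i) \<in> B}
        = {x \<in> Rn n. (\<lambda>i. mat_app n (transp Q) v i + x i) \<in> {x \<in> Rn n. mat_app n Q x \<in> B}}"
      using mat_app_Rn[of n "transp Q" v]
      by (auto simp: mat_app_lincomb mat_app_transp_cancel[OF Q v] Rn_iff)
    also have "emeasure (leb n) \<dots> = emeasure (leb n) {x \<in> Rn n. mat_app n Q x \<in> B}"
      using shift_invariant_leb[of n] mat_app_Rn[of n "transp Q" v] pre[OF B, of Q]
      unfolding shift_invariant_def by blast
    also have "\<dots> = emeasure \<nu> B" by (simp add: \<nu>[OF B])
    finally show "emeasure \<nu> {x \<in> Rn n. (\<lambda>i. v i + x i) \<in> B} = emeasure \<nu> B" .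
  qed (simp add: \<nu>_def)
  \<comment> \<open>Pushing \<open>\<nu>\<close> forward by the transpose gives back
    \<open>leb\<close>, and sigma-finiteness of an image measure passes to its source.\<close>
  moreover have "sigma_finite_measure \<nu>"
  proof (rule sigma_finite_measure_distr)
    have "distr \<nu> (Rborel n) (mat_app n (transp Q))
        = distr (leb n) (Rborel n) (mat_app n (transp Q) \<circ> mat_app n Q)"
      unfolding \<nu>_def by (rule distr_distr[OF measurable_mat_app m])
    also have "\<dots> = distr (leb n) (leb n) (\<lambda>x. x)"
      by (intro distr_cong) (auto simp: mat_app_transp_cancel[OF Q])
    also have "\<dots> = leb n" by simp
    finally have "distr \<nu> (Rborel n) (mat_app n (transp Q)) = leb n" .
    then show "sigma_finite_measure (distr \<nu> (Rborel n) (mat_app n (transp Q)))"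
      using sigma_finite_leb by simp
    show "mat_app n (transp Q) \<in> measurable \<nu> (Rborel n)" by (simp add: \<nu>_def)
  qed
  moreover have "(\<lambda>i. - x i) \<in> unit_ball n" if "x \<in> unit_ball n" for x
    using that norm_n_scale[of n "-1" x] by (simp add: unit_ball_def Rn_iff)
  ultimately have "emeasure \<nu> A * emeasure (leb n) (unit_ball n)
      = emeasure (leb n) A * emeasure \<nu> (unit_ball n)"
    using shift_invariant_unique[OF _ _ A sets_unit_ball] by blast
  moreover have "emeasure \<nu> (unit_ball n) = emeasure (leb n) (unit_ball n)"
  proof -
    have "{x \<in> Rn n. mat_app n Q x \<in> unit_ball n} = unit_ball n"
      using norm_n_mat_app_orth[OF Q] mat_app_Rn by (auto simp: unit_ball_def)
    then show ?thesis by (simp add: \<nu>[OF sets_unit_ball])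
  qed
  ultimately have "emeasure \<nu> A = emeasure (leb n) A"
    using emeasure_unit_ball[of n] by (simp add: mult.commute[of _ "emeasure (leb n) (unit_ball n)"] ennreal_mult_cancel_left)
  then show ?thesis using \<nu>[OF A] by simp
qed

subsection \<open>The invariant measure on the sphere\<close>

lemma inner_n_zero [simp]: "inner_n n (\<lambda>i. 0) x = 0" "inner_n n x (\<lambda>i. 0) = 0"
  by (simp_all add: inner_n_def)

definition punctured_ball :: "nat \<Rightarrow> (nat \<Rightarrow> real) set" where
  "punctured_ball n = {x \<in> Rn n. 0 < norm_n n x \<and> norm_n n x \<le> 1}"

lemma sets_punctured_ball: "punctured_ball n \<in> sets (Rborel n)"
proof -
  have "{x \<in> space (Rborel n). 0 < norm_n n x \<and> norm_n n x \<le> 1} \<in> sets (Rborel n)" by measurable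
  then show ?thesis by (simp add: punctured_ball_def)
qed

lemma emeasure_punctured_ball:
  assumes "n \<ge> 1"
  shows "emeasure (leb n) (punctured_ball n) = emeasure (leb n) (unit_ball n)"
proof -
  define Z where "Z = {x \<in> Rn n. \<forall>i<n. x i \<in> {0}}"
  have Z: "Z \<in> sets (Rborel n)" unfolding Z_def by (rule emeasure_leb_box(1)) simp
  have "emeasure (leb n) Z = (\<Prod>i<n. emeasure lborel {0::real})" unfolding Z_def
    by (rule emeasure_leb_box(2)) simp
  then have "emeasure (leb n) Z = 0" using assms by (simp add: power_0_left)
  then have "Z \<in> null_sets (leb n)" using Z by auto
  then have "emeasure (leb n) (punctured_ball n \<union> Z) = emeasure (leb n) (punctured_ball n)"
    using sets_punctured_ball by (intro emeasure_Un_null_set) auto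
  moreover have "punctured_ball n \<union> Z = unit_ball n"
  proof -
    have "x \<in> Z \<longleftrightarrow> x = (\<lambda>i. 0)" for x
    proof
      assume x: "x \<in> Z"
      have "x i = 0" for i using x by (cases "i < n") (auto simp: Z_def Rn_iff)
      then show "x = (\<lambda>i. 0)" by blast
    qed (simp add: Z_def Rn_iff)
    then have "x \<in> Z \<longleftrightarrow> x \<in> Rn n \<and> norm_n n x = 0" for x
      using norm_n_eq_0_iff[of x n] by (auto simp: Rn_iff)
    then show ?thesis
      using norm_n_nonneg[of n] by (auto simp: punctured_ball_def unit_ball_def order_less_le)
  qed
  ultimately show ?thesis by simp
qed

lemma closed_unit_sphere: "closed (unit_sphere n)"
proof -
  have "closed {x. norm_n n x = 1}"
    by (intro closed_Collect_eq continuous_on_norm_n continuous_on_id continuous_on_const)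
  moreover have "unit_sphere n = Rn n \<inter> {x. norm_n n x = 1}" by (auto simp: unit_sphere_def)
  ultimately show ?thesis using closed_Rn by auto
qed

lemma compact_unit_sphere: "compact (unit_sphere n)"
proof (rule compact_closed_subset)
  show "compact {x::nat \<Rightarrow> real. \<forall>i. x i \<in> {-1..1}}" by (rule compact_Pi_UNIV) simp
  show "unit_sphere n \<subseteq> {x. \<forall>i. x i \<in> {-1..1}}"
  proof clarify
    fix x i assume x: "x \<in> unit_sphere n"
    show "x i \<in> {-1..1}"
    proof (cases "i < n")
      case True
      then show ?thesis using abs_le_norm_n[OF True, of x] x by (simp add: unit_sphere_def abs_le_iff)
    qed (use x in \<open>auto simp: unit_sphere_def Rn_iff\<close>)
  qed
qed (rule closed_unit_sphere)

definition Sborel :: "nat \<Rightarrow> (nat \<Rightarrow> real) measure" where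
  "Sborel n = restrict_space borel (unit_sphere n)"

lemma space_Sborel [simp]: "space (Sborel n) = unit_sphere n"
  by (simp add: Sborel_def space_restrict_space)

lemma sets_Sborel_iff: "A \<in> sets (Sborel n) \<longleftrightarrow> A \<in> sets borel \<and> A \<subseteq> unit_sphere n"
  unfolding Sborel_def using closed_unit_sphere[of n] by (subst sets_restrict_space_iff) auto

lemma Sborel_imp_Rborel: "A \<in> sets (Sborel n) \<Longrightarrow> A \<in> sets (Rborel n)"
  by (auto simp: sets_Sborel_iff sets_Rborel_iff unit_sphere_def)

lemma measurable_Sborel_coord [measurable]: "(\<lambda>x. x i) \<in> borel_measurable (Sborel n)"
  unfolding Sborel_def by (intro measurable_restrict_space1 measurable_product_coordinates)

lemma measurable_into_Sborel:
  assumes "f \<in> measurable M (Rborel n)" "\<And>x. x \<in> space M \<Longrightarrow> f x \<in> unit_sphere n"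
  shows "f \<in> measurable M (Sborel n)"
proof (rule measurableI)
  fix A assume "A \<in> sets (Sborel n)"
  then show "f -` A \<inter> space M \<in> sets M" by (intro measurable_sets[OF assms(1)] Sborel_imp_Rborel)
qed (use assms in auto)

text \<open>The value at vectors of norm 0 is an arbitrary point of the sphere, so that for
  \<open>n \<ge> 1\<close> the map sends all of \<open>Rn n\<close> into the sphere. The measure
  below lives on the punctured ball and does not see this choice.\<close>

definition normalize_n :: "nat \<Rightarrow> (nat \<Rightarrow> real) \<Rightarrow> (nat \<Rightarrow> real)" where
  "normalize_n n x = (if norm_n n x = 0 then unit_vec 0 else (\<lambda>i. x i / norm_n n x))"

lemma normalize_n_sphere:
  assumes "n \<ge> 1" "x \<in> Rn n"
  shows "normalize_n n x \<in> unit_sphere n"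
proof (cases "norm_n n x = 0")
  case True
  have "unit_vec 0 \<in> Rn n" using assms by (intro unit_vec_Rn) simp
  moreover have "inner_n n (unit_vec 0) (unit_vec 0) = 1"
    using assms by (simp add: inner_n_unit_vec) (simp add: unit_vec_def)
  ultimately show ?thesis using True by (simp add: normalize_n_def unit_sphere_def norm_n_def)
next
  case False
  then show ?thesis using assms(2) norm_n_nonneg[of n x]
    by (simp add: normalize_n_def unit_sphere_def norm_n_divide) (simp add: Rn_iff)
qed

lemma measurable_normalize_n:
  assumes "n \<ge> 1"
  shows "normalize_n n \<in> measurable (Rborel n) (Sborel n)"
proof (rule measurable_into_Sborel)
  show "normalize_n n \<in> measurable (Rborel n) (Rborel n)"
  proof (rule measurable_into_Rborel)
    fix i assume "i < n"
    have "(\<lambda>x. if norm_n n x = 0 then unit_vec 0 i else x i / norm_n n x) \<in> borel_measurable (Rborel n)"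
      by measurable
    moreover have "(\<lambda>x. normalize_n n x i) = (\<lambda>x. if norm_n n x = 0 then unit_vec 0 i else x i / norm_n n x)"
      by (auto simp: normalize_n_def)
    ultimately show "(\<lambda>x. normalize_n n x i) \<in> borel_measurable (Rborel n)" by simp
  qed (use normalize_n_sphere[OF assms] in \<open>auto simp: unit_sphere_def\<close>)
qed (use normalize_n_sphere[OF assms] in auto)

definition cone_n :: "nat \<Rightarrow> (nat \<Rightarrow> real) set \<Rightarrow> (nat \<Rightarrow> real) set" where
  "cone_n n A = {x \<in> punctured_ball n. (\<lambda>i. x i / norm_n n x) \<in> A}"

lemma cone_n_eq: "cone_n n A = punctured_ball n \<inter> {x \<in> Rn n. normalize_n n x \<in> A}"
  by (auto simp: cone_n_def punctured_ball_def normalize_n_def)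

lemma sets_cone_n:
  assumes "n \<ge> 1" "A \<in> sets (Sborel n)"
  shows "cone_n n A \<in> sets (Rborel n)"
  using sets_Collect_mem_measurable[OF measurable_normalize_n[OF assms(1)] assms(2)] sets_punctured_ball[of n]
  by (simp add: cone_n_eq)

text \<open>The cone measure: the mass of \<open>A\<close> is the proportion of the ball filled by
  the cone over \<open>A\<close>. In this form estimates on the sphere carry over to volumes in the
  ball.\<close>

definition sphere_unif :: "nat \<Rightarrow> (nat \<Rightarrow> real) measure" where
  "sphere_unif n = distr (uniform_measure (leb n) (punctured_ball n)) (Sborel n) (normalize_n n)"

lemma emeasure_sphere_unif:
  assumes n: "n \<ge> 1" and A: "A \<in> sets (Sborel n)"
  shows "emeasure (sphere_unif n) A = emeasure (leb n) (cone_n n A) / emeasure (leb n) (unit_ball n)"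
proof -
  have m: "normalize_n n \<in> measurable (uniform_measure (leb n) (punctured_ball n)) (Sborel n)"
  proof -
    have "sets (uniform_measure (leb n) (punctured_ball n)) = sets (Rborel n)" by simp
    from measurable_cong_sets[OF this refl] measurable_normalize_n[OF n] show ?thesis by blast
  qed
  have "{x \<in> Rn n. normalize_n n x \<in> A} \<in> sets (Rborel n)"
    using sets_Collect_mem_measurable[OF measurable_normalize_n[OF n] A] by simp
  moreover have "normalize_n n -` A \<inter> Rn n = {x \<in> Rn n. normalize_n n x \<in> A}" by auto
  ultimately show ?thesis
    unfolding sphere_unif_def using emeasure_distr[OF m A] sets_punctured_ball[of n]
    by (simp add: cone_n_eq emeasure_punctured_ball[OF n])
qed

lemma sets_sphere_unif: "sets (sphere_unif n) = sets (Sborel n)"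
  by (simp add: sphere_unif_def)

lemma measurable_mat_app_sphere:
  assumes "orth_n n Q"
  shows "mat_app n Q \<in> measurable (Sborel n) (Sborel n)"
proof (rule measurable_into_Sborel)
  show "mat_app n Q \<in> measurable (Sborel n) (Rborel n)"
  proof (rule measurable_into_Rborel)
    fix i assume "i < n"
    then show "(\<lambda>x. mat_app n Q x i) \<in> borel_measurable (Sborel n)"
      unfolding mat_app_def by simp
  qed (rule mat_app_Rn)
  fix x assume "x \<in> space (Sborel n)"
  then show "mat_app n Q x \<in> unit_sphere n"
    using norm_n_mat_app_orth[OF assms, of x] mat_app_Rn by (simp add: unit_sphere_def)
qed

text \<open>Orthogonal matrices preserve norms and commute with scalars, so the cone over a preimage
  is the preimage of the cone, and Lebesgue measure is invariant.\<close>

lemma rotation_invariant_sphere_unif: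
  assumes n: "n \<ge> 1"
  shows "rotation_invariant_prob n (sphere_unif n)"
  unfolding rotation_invariant_prob_def
proof (intro conjI allI impI)
  show "prob_space (sphere_unif n)"
  proof
    have "cone_n n (unit_sphere n) = punctured_ball n"
      using normalize_n_sphere[OF n] by (auto simp: cone_n_eq punctured_ball_def)
    moreover have "unit_sphere n \<in> sets (Sborel n)"
      using closed_unit_sphere by (simp add: sets_Sborel_iff)
    ultimately have "emeasure (sphere_unif n) (unit_sphere n) = 1"
      using emeasure_unit_ball[of n]
      by (simp add: emeasure_sphere_unif[OF n] emeasure_punctured_ball[OF n] ennreal_divide_self less_top)
    then show "emeasure (sphere_unif n) (space (sphere_unif n)) = 1"
      using sets_eq_imp_space_eq[OF sets_sphere_unif[of n]] by simp
  qed
  show "sets (sphere_unif n) = sets (restrict_space borel (unit_sphere n))"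
    by (simp add: sets_sphere_unif Sborel_def)
  fix U assume "orthogonal_n n U"
  then obtain Q where Q: "orth_n n Q" "\<And>x. x \<in> Rn n \<Longrightarrow> U x = mat_app n Q x"
    using orthogonal_n_mat by blast
  have sp: "space (sphere_unif n) = unit_sphere n"
    using sets_eq_imp_space_eq[OF sets_sphere_unif[of n]] by simp
  have m: "U \<in> measurable (sphere_unif n) (sphere_unif n)"
    unfolding measurable_cong_sets[OF sets_sphere_unif sets_sphere_unif]
    using measurable_mat_app_sphere[OF Q(1)] Q(2)
    by (subst measurable_cong[of _ _ "mat_app n Q"]) (auto simp: unit_sphere_def)
  show "distr (sphere_unif n) (sphere_unif n) U = sphere_unif n"
  proof (rule measure_eqI)
    fix A assume "A \<in> sets (distr (sphere_unif n) (sphere_unif n) U)"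
    then have A: "A \<in> sets (Sborel n)" by (simp add: sets_sphere_unif)
    define B where "B = {x \<in> unit_sphere n. U x \<in> A}"
    have B: "B \<in> sets (Sborel n)"
      using sets_Collect_mem_measurable[OF m, of A] A by (simp add: B_def sp sets_sphere_unif)
    have "U -` A \<inter> space (sphere_unif n) = B" by (auto simp: B_def sp)
    then have "emeasure (distr (sphere_unif n) (sphere_unif n) U) A = emeasure (sphere_unif n) B"
      using emeasure_distr[OF m, of A] A by (simp add: sets_sphere_unif)
    also have "cone_n n B = {x \<in> Rn n. mat_app n Q x \<in> cone_n n A}"
    proof -
      have "x \<in> cone_n n B \<longleftrightarrow> mat_app n Q x \<in> cone_n n A" if x: "x \<in> Rn n" for x
      proof -
        define r where "r = norm_n n x"
        have xr: "(\<lambda>i. x i / r) \<in> Rn n" using x by (simp add: Rn_iff)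
        have "U (\<lambda>i. x i / r) = (\<lambda>i. mat_app n Q x i / r)"
          using mat_app_lincomb(2)[of n Q "1 / r" x] Q(2)[OF xr] by simp
        moreover have "(\<lambda>i. x i / r) \<in> unit_sphere n" if "r > 0"
          using that xr by (simp add: unit_sphere_def norm_n_divide r_def)
        ultimately show ?thesis
          using x mat_app_Rn[of n Q x] norm_n_mat_app_orth[OF Q(1) x]
          by (auto simp: cone_n_def punctured_ball_def B_def r_def[symmetric])
      qed
      moreover have "cone_n n B \<subseteq> Rn n" by (auto simp: cone_n_def punctured_ball_def)
      ultimately show ?thesis by blast
    qed
    then have "emeasure (sphere_unif n) B = emeasure (sphere_unif n) A"
      unfolding emeasure_sphere_unif[OF n B] emeasure_sphere_unif[OF n A]
      using emeasure_leb_orth[OF Q(1) sets_cone_n[OF n A]] by simp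
    finally show "emeasure (distr (sphere_unif n) (sphere_unif n) U) A = emeasure (sphere_unif n) A" .
  qed simp
qed

text \<open>Householder reflections show that the orthogonal group acts transitively on the sphere.\<close>
lemma orthogonal_transitive_sphere:
  assumes x: "x \<in> unit_sphere n" and y: "y \<in> unit_sphere n"
  obtains U where "orthogonal_n n U" "U x = y"
proof -
  define u where "u = (\<lambda>i. x i - y i)"
  define s where "s = inner_n n u u"
  define U where "U z = (\<lambda>i. z i - 2 * inner_n n z u / s * u i)" for z
  have xy: "x \<in> Rn n" "y \<in> Rn n" "inner_n n x x = 1" "inner_n n y y = 1"
    using assms by (auto simp: unit_sphere_def norm_n_def)
  have u: "u \<in> Rn n" using xy by (simp add: u_def Rn_iff)
  have "U \<in> Rn n \<rightarrow> Rn n" using u by (auto simp: U_def Rn_iff)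
  moreover have "U (\<lambda>i. z i + w i) = (\<lambda>i. U z i + U w i)" for z w
    by (simp add: U_def inner_n_add add_divide_distrib algebra_simps)
  moreover have "U (\<lambda>i. a * z i) = (\<lambda>i. a * U z i)" for a z
    by (simp add: U_def inner_n_add algebra_simps)
  moreover have "inner_n n (U z) (U w) = inner_n n z w" for z w
  proof -
    have "inner_n n (U z) (U w) = inner_n n z w - 2 * inner_n n w u / s * inner_n n z u
        - 2 * inner_n n z u / s * (inner_n n u w - 2 * inner_n n w u / s * s)"
      unfolding U_def inner_n_add s_def by (simp add: inner_n_commute)
    also have "\<dots> = inner_n n z w"
      by (cases "s = 0") (simp_all add: inner_n_commute[of n u w] algebra_simps)
    finally show ?thesis .
  qed
  ultimately have "orthogonal_n n U" unfolding orthogonal_n_def linear_n_def by blast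
  moreover have "U x = y"
  proof (cases "s = 0")
    case True
    then have "norm_n n u = 0" by (simp add: norm_n_def s_def)
    then have "u = (\<lambda>i. 0)" using norm_n_eq_0_iff[OF u] by simp
    then show ?thesis by (simp add: U_def u_def fun_eq_iff)
  next
    case False
    have "s = 2 * inner_n n x u"
      by (simp add: s_def u_def inner_n_add xy inner_n_commute[of n y x])
    then show ?thesis using False by (simp add: U_def u_def)
  qed
  ultimately show ?thesis using that by blast
qed

section \<open>Uniqueness of the rotation invariant probability, by comparing caps\<close>

lemma norm_n_diff_commute: "norm_n n (\<lambda>i. x i - y i) = norm_n n (\<lambda>i. y i - x i)"
  using norm_n_scale[of n "-1" "\<lambda>i. y i - x i"] by simp

definition cap :: "nat \<Rightarrow> real \<Rightarrow> (nat \<Rightarrow> real) \<Rightarrow> (nat \<Rightarrow> real) set" where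
  "cap n r y = {x \<in> unit_sphere n. norm_n n (\<lambda>i. x i - y i) < r}"

lemma open_norm_n_ball: "open {x. norm_n n (\<lambda>i. x i - y i) < r}"
  by (intro open_Collect_less continuous_on_norm_n continuous_on_coordinatewise_then_product
      continuous_on_diff continuous_on_const continuous_on_product_coordinates)

lemma sets_UN_cap: "(\<Union>y\<in>C. cap n r y) \<in> sets (Sborel n)"
proof -
  have "(\<Union>y\<in>C. cap n r y) = unit_sphere n \<inter> (\<Union>y\<in>C. {x. norm_n n (\<lambda>i. x i - y i) < r})"
    by (auto simp: cap_def)
  moreover have "open (\<Union>y\<in>C. {x. norm_n n (\<lambda>i. x i - y i) < r})"
    by (intro open_UN ballI open_norm_n_ball)
  ultimately show ?thesis using closed_unit_sphere[of n] by (auto simp: sets_Sborel_iff)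
qed

lemma sets_cap: "cap n r y \<in> sets (Sborel n)"
  using sets_UN_cap[of n r "{y}"] by simp

lemma rotation_invariant_cap:
  assumes \<mu>: "rotation_invariant_prob n \<mu>" and "x \<in> unit_sphere n" "y \<in> unit_sphere n"
  shows "emeasure \<mu> (cap n r x) = emeasure \<mu> (cap n r y)"
proof -
  have s: "sets \<mu> = sets (Sborel n)" using \<mu> by (simp add: rotation_invariant_prob_def Sborel_def)
  then have sp: "space \<mu> = unit_sphere n" using sets_eq_imp_space_eq[OF s] by simp
  obtain U where U: "orthogonal_n n U" "U x = y" by (rule orthogonal_transitive_sphere[OF assms(2,3)])
  obtain Q where Q: "orth_n n Q" "\<And>x. x \<in> Rn n \<Longrightarrow> U x = mat_app n Q x"
    using orthogonal_n_mat[OF U(1)] by blast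
  have x: "x \<in> Rn n" using assms by (simp add: unit_sphere_def)
  have m: "U \<in> measurable \<mu> \<mu>"
    unfolding measurable_cong_sets[OF s s]
    using measurable_mat_app_sphere[OF Q(1)] Q(2)
    by (subst measurable_cong[of _ _ "mat_app n Q"]) (auto simp: unit_sphere_def)
  have "emeasure \<mu> (cap n r y) = emeasure (distr \<mu> \<mu> U) (cap n r y)"
    using \<mu> U by (simp add: rotation_invariant_prob_def)
  also have "\<dots> = emeasure \<mu> (U -` cap n r y \<inter> space \<mu>)"
    using sets_cap by (intro emeasure_distr[OF m]) (simp add: s)
  also have "U -` cap n r y \<inter> space \<mu> = cap n r x"
  proof -
    have "norm_n n (\<lambda>i. U z i - y i) = norm_n n (\<lambda>i. z i - x i)" "U z \<in> unit_sphere n" if "z \<in> unit_sphere n" for z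
    proof -
      have z: "z \<in> Rn n" using that by (simp add: unit_sphere_def)
      have zx: "(\<lambda>i. z i - x i) \<in> Rn n" using z x by (simp add: Rn_iff)
      have "(\<lambda>i. U z i - y i) = mat_app n Q (\<lambda>i. z i - x i)"
        using mat_app_lincomb(1)[of n Q "\<lambda>i. z i - x i" x]
        by (auto simp: Q(2)[OF z] U(2)[symmetric] Q(2)[OF x] fun_eq_iff)
      then show "norm_n n (\<lambda>i. U z i - y i) = norm_n n (\<lambda>i. z i - x i)"
        using norm_n_mat_app_orth[OF Q(1) zx] by simp
      show "U z \<in> unit_sphere n"
        using that norm_n_mat_app_orth[OF Q(1) z] by (simp add: Q(2)[OF z] unit_sphere_def mat_app_Rn)
    qed
    then show ?thesis by (auto simp: cap_def sp)
  qed
  finally show ?thesis by simp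
qed

text \<open>By compactness finitely many caps of radius \<open>r\<close> cover the sphere. They all
  have the same mass, so mass 0 would make the whole sphere null.\<close>

lemma emeasure_cap_pos:
  assumes \<mu>: "rotation_invariant_prob n \<mu>" and r: "r > 0" and y: "y \<in> unit_sphere n"
  shows "emeasure \<mu> (cap n r y) \<noteq> 0"
proof
  assume 0: "emeasure \<mu> (cap n r y) = 0"
  interpret prob_space \<mu> using \<mu> by (simp add: rotation_invariant_prob_def)
  have s: "sets \<mu> = sets (Sborel n)" using \<mu> by (simp add: rotation_invariant_prob_def Sborel_def)
  then have sp: "space \<mu> = unit_sphere n" using sets_eq_imp_space_eq[OF s] by simp
  have "unit_sphere n \<subseteq> (\<Union>z\<in>unit_sphere n. {x. norm_n n (\<lambda>i. x i - z i) < r})"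
  proof
    fix x assume "x \<in> unit_sphere n"
    moreover have "norm_n n (\<lambda>i. x i - x i) < r" using r by (simp add: norm_n_def)
    ultimately show "x \<in> (\<Union>z\<in>unit_sphere n. {x. norm_n n (\<lambda>i. x i - z i) < r})" by blast
  qed
  then obtain C where C: "C \<subseteq> unit_sphere n" "finite C"
    "unit_sphere n \<subseteq> (\<Union>z\<in>C. {x. norm_n n (\<lambda>i. x i - z i) < r})"
    using compactE_image[OF compact_unit_sphere, of "unit_sphere n" "\<lambda>z. {x. norm_n n (\<lambda>i. x i - z i) < r}" n]
      open_norm_n_ball by blast
  have "(\<Union>z\<in>C. cap n r z) \<in> null_sets \<mu>"
  proof (rule null_sets_UN')
    show "countable C" using C(2) by (rule countable_finite)
    fix z assume "z \<in> C"
    then show "cap n r z \<in> null_sets \<mu>"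
      using rotation_invariant_cap[OF \<mu> _ y, of z r] 0 C(1) sets_cap by (intro null_setsI) (auto simp: s)
  qed
  moreover have "space \<mu> = (\<Union>z\<in>C. cap n r z)" using C by (auto simp: cap_def sp)
  ultimately have "emeasure \<mu> (space \<mu>) = 0" by (metis null_setsD1)
  then show False using emeasure_space_1 by simp
qed

lemma continuous_on_norm_n_diff: "continuous_on S (\<lambda>w. norm_n n (\<lambda>i. x i - w i))"
  by (rule continuous_on_subset[OF _ subset_UNIV])
    (intro continuous_on_norm_n continuous_on_coordinatewise_then_product continuous_on_diff
      continuous_on_const continuous_on_product_coordinates)

text \<open>By Fubini, all caps of radius \<open>r\<close> have the same mass for \<open>\<mu>\<close> as for \<open>\<nu>\<close>; averaging the
  indicator of \<open>C\<close> over caps compares \<open>\<nu> C\<close> with \<open>\<mu>\<close> of the \<open>r\<close>-neighbourhood of \<open>C\<close>.\<close>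
lemma rotation_invariant_closed_le_nbhd:
  assumes \<mu>: "rotation_invariant_prob n \<mu>" and \<nu>: "rotation_invariant_prob n \<nu>"
    and C: "closed C" "C \<subseteq> unit_sphere n" and r: "r > 0" and ne: "C \<noteq> {}"
  shows "emeasure \<nu> C \<le> emeasure \<mu> (\<Union>y\<in>C. cap n r y)"
proof -
  have s [measurable_cong]: "sets \<mu> = sets (Sborel n)" "sets \<nu> = sets (Sborel n)"
    using \<mu> \<nu> by (simp_all add: rotation_invariant_prob_def Sborel_def)
  have sp: "space \<mu> = unit_sphere n" "space \<nu> = unit_sphere n"
    using s[THEN sets_eq_imp_space_eq] by simp_all
  interpret M: prob_space \<mu> using \<mu> by (simp add: rotation_invariant_prob_def)
  interpret N: prob_space \<nu> using \<nu> by (simp add: rotation_invariant_prob_def)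
  interpret pair_sigma_finite \<mu> \<nu> ..
  obtain z where z: "z \<in> unit_sphere n" using ne C(2) by blast
  define a b where "a = emeasure \<mu> (cap n r z)" and "b = emeasure \<nu> (cap n r z)"
  define G where "G = (\<Union>y\<in>C. cap n r y)"
  have G: "G \<in> sets (Sborel n)" unfolding G_def by (rule sets_UN_cap)
  have C': "C \<in> sets (Sborel n)" using C by (auto simp: sets_Sborel_iff)
  note [measurable] = G C'
  define P where "P x y \<longleftrightarrow> norm_n n (\<lambda>i. x i - y i) < r" for x y
  define p :: "(nat \<Rightarrow> real) \<Rightarrow> (nat \<Rightarrow> real) \<Rightarrow> ennreal" where "p x y = (if P x y then 1 else 0)" for x y
  have mP [measurable]: "Measurable.pred (\<mu> \<Otimes>\<^sub>M \<nu>) (\<lambda>z. P (fst z) (snd z))"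
    unfolding P_def norm_n_def inner_n_def by measurable
  have cap1: "(\<integral>\<^sup>+x. p x y \<partial>\<mu>) = a" if "y \<in> unit_sphere n" for y
  proof -
    have "(\<integral>\<^sup>+x. p x y \<partial>\<mu>) = (\<integral>\<^sup>+x. indicator (cap n r y) x \<partial>\<mu>)"
      by (intro nn_integral_cong) (auto simp: cap_def P_def p_def sp indicator_def)
    also have "\<dots> = emeasure \<mu> (cap n r y)" using sets_cap by (simp add: s)
    also have "\<dots> = a" unfolding a_def by (rule rotation_invariant_cap[OF \<mu> that z])
    finally show ?thesis .
  qed
  have cap2: "(\<integral>\<^sup>+y. p x y \<partial>\<nu>) = b" if "x \<in> unit_sphere n" for x
  proof -
    have "(\<integral>\<^sup>+y. p x y \<partial>\<nu>) = (\<integral>\<^sup>+y. indicator (cap n r x) y \<partial>\<nu>)"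
      by (intro nn_integral_cong) (auto simp: cap_def P_def p_def sp indicator_def norm_n_diff_commute[of n x])
    also have "\<dots> = emeasure \<nu> (cap n r x)" using sets_cap by (simp add: s)
    also have "\<dots> = b" unfolding b_def by (rule rotation_invariant_cap[OF \<nu> that z])
    finally show ?thesis .
  qed
  have fub: "(\<integral>\<^sup>+y. \<integral>\<^sup>+x. f x y \<partial>\<mu> \<partial>\<nu>) = (\<integral>\<^sup>+x. \<integral>\<^sup>+y. f x y \<partial>\<nu> \<partial>\<mu>)"
    if "(\<lambda>(x, y). f x y) \<in> borel_measurable (\<mu> \<Otimes>\<^sub>M \<nu>)" for f :: "_ \<Rightarrow> _ \<Rightarrow> ennreal"
    by (rule Fubini'[OF that])
  have mI: "(\<lambda>(x, y). p x y) \<in> borel_measurable (\<mu> \<Otimes>\<^sub>M \<nu>)"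
    unfolding split_beta p_def by measurable
  have "a = (\<integral>\<^sup>+y. \<integral>\<^sup>+x. p x y \<partial>\<mu> \<partial>\<nu>)"
  proof -
    have "(\<integral>\<^sup>+y. \<integral>\<^sup>+x. p x y \<partial>\<mu> \<partial>\<nu>) = (\<integral>\<^sup>+y. a \<partial>\<nu>)"
      by (rule nn_integral_cong, rule cap1) (simp add: sp)
    then show ?thesis using N.emeasure_space_1 by simp
  qed
  also have "\<dots> = (\<integral>\<^sup>+x. \<integral>\<^sup>+y. p x y \<partial>\<nu> \<partial>\<mu>)" by (rule fub[OF mI])
  also have "\<dots> = (\<integral>\<^sup>+x. b \<partial>\<mu>)" by (rule nn_integral_cong, rule cap2) (simp add: sp)
  also have "\<dots> = b" using M.emeasure_space_1 by simp
  finally have ab: "a = b" .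
  have a: "a \<noteq> 0" "a \<noteq> \<infinity>" unfolding a_def using emeasure_cap_pos[OF \<mu> r z] by auto
  have m1: "(\<lambda>(x, y). indicator C y * p x y) \<in> borel_measurable (\<mu> \<Otimes>\<^sub>M \<nu>)"
    using mI unfolding split_beta by measurable
  have mx: "(\<lambda>x. p x y) \<in> borel_measurable \<mu>" if "y \<in> space \<nu>" for y
    using measurable_compose[OF measurable_Pair2'[OF that, of \<mu>] mI] by simp
  have my: "(\<lambda>y. p x y) \<in> borel_measurable \<nu>" if "x \<in> space \<mu>" for x
    using measurable_compose[OF measurable_Pair1'[OF that, of \<nu>] mI] by simp
  have "emeasure \<nu> C * a = (\<integral>\<^sup>+y. indicator C y * a \<partial>\<nu>)"
    using C' by (simp add: nn_integral_multc s)
  also have "\<dots> = (\<integral>\<^sup>+y. \<integral>\<^sup>+x. indicator C y * p x y \<partial>\<mu> \<partial>\<nu>)"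
    by (rule nn_integral_cong, subst nn_integral_cmult[OF mx]) (auto simp: cap1 sp)
  also have "\<dots> = (\<integral>\<^sup>+x. \<integral>\<^sup>+y. indicator C y * p x y \<partial>\<nu> \<partial>\<mu>)"
    by (rule fub[OF m1])
  also have "\<dots> \<le> (\<integral>\<^sup>+x. \<integral>\<^sup>+y. indicator G x * p x y \<partial>\<nu> \<partial>\<mu>)"
  proof (intro nn_integral_mono)
    fix x y assume "x \<in> space \<mu>" "y \<in> space \<nu>"
    then have "y \<in> C \<Longrightarrow> P x y \<Longrightarrow> x \<in> G" by (auto simp: G_def cap_def P_def sp)
    then show "indicator C y * p x y \<le> (indicator G x * p x y)"
      by (auto simp: indicator_def p_def)
  qed
  also have "\<dots> = (\<integral>\<^sup>+x. indicator G x * b \<partial>\<mu>)"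
  proof (rule nn_integral_cong)
    fix x assume x: "x \<in> space \<mu>"
    have "(\<integral>\<^sup>+y. p x y \<partial>\<nu>) = b"
      using cap2[of x] x by (simp add: sp)
    then show "(\<integral>\<^sup>+y. indicator G x * p x y \<partial>\<nu>) = indicator G x * b"
      by (subst nn_integral_cmult[OF my[OF x]]) simp
  qed
  also have "\<dots> = emeasure \<mu> G * a"
    using G by (simp add: nn_integral_multc s ab)
  finally show ?thesis
    using a by (simp add: G_def mult.commute[of _ a] ennreal_mult_le_mult_iff)
qed

text \<open>A closed subset of the sphere is the intersection of its decreasing neighbourhoods of
  radius \<open>1 / (m + 1)\<close>: compactness provides a nearest point, whose distance must be 0.
  Continuity from above then removes the radius.\<close>

lemma rotation_invariant_closed_le:
  assumes \<mu>: "rotation_invariant_prob n \<mu>" and \<nu>: "rotation_invariant_prob n \<nu>"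
    and C: "closed C" "C \<subseteq> unit_sphere n"
  shows "emeasure \<nu> C \<le> emeasure \<mu> C"
proof (cases "C = {}")
  case ne: False
  have s: "sets \<mu> = sets (Sborel n)" using \<mu> by (simp add: rotation_invariant_prob_def Sborel_def)
  interpret M: prob_space \<mu> using \<mu> by (simp add: rotation_invariant_prob_def)
  define G where "G m = (\<Union>y\<in>C. cap n (1 / real (Suc m)) y)" for m
  have G: "G m \<in> sets \<mu>" for m unfolding G_def s by (rule sets_UN_cap)
  have "decseq G"
  proof (rule decseq_SucI)
    fix m
    have "1 / real (Suc (Suc m)) \<le> 1 / real (Suc m)" by (simp add: frac_le)
    then show "G (Suc m) \<subseteq> G m" unfolding G_def cap_def by fastforce
  qed
  have "(\<Inter>m. G m) = C"
  proof (intro equalityI subsetI)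
    fix x assume x: "x \<in> (\<Inter>m. G m)"
    then have xs: "x \<in> Rn n" by (auto simp: G_def cap_def unit_sphere_def)
    have "compact C" by (rule compact_closed_subset[OF compact_unit_sphere C])
    then obtain y where y: "y \<in> C" "\<And>w. w \<in> C \<Longrightarrow> norm_n n (\<lambda>i. x i - y i) \<le> norm_n n (\<lambda>i. x i - w i)"
      using continuous_attains_inf[OF _ ne continuous_on_norm_n_diff] by blast
    have small: "norm_n n (\<lambda>i. x i - y i) < 1 / real (Suc m)" for m
    proof -
      obtain w where "w \<in> C" "norm_n n (\<lambda>i. x i - w i) < 1 / real (Suc m)"
        using x unfolding G_def cap_def by blast
      then show ?thesis using y(2)[of w] by linarith
    qed
    have "norm_n n (\<lambda>i. x i - y i) = 0"
    proof (rule ccontr)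
      assume "norm_n n (\<lambda>i. x i - y i) \<noteq> 0"
      then have "norm_n n (\<lambda>i. x i - y i) > 0" using norm_n_nonneg[of n "\<lambda>i. x i - y i"] by linarith
      from nat_approx_posE[OF this] small show False by (metis not_less_iff_gr_or_eq)
    qed
    moreover have "(\<lambda>i. x i - y i) \<in> Rn n" using xs y(1) C(2) by (auto simp: Rn_iff unit_sphere_def)
    ultimately have "(\<lambda>i. x i - y i) = (\<lambda>i. 0)" using norm_n_eq_0_iff by blast
    then have "x = y" by (simp add: fun_eq_iff)
    then show "x \<in> C" using y by simp
  next
    fix x assume x: "x \<in> C"
    have "x \<in> cap n (1 / real (Suc m)) x" for m using x C by (auto simp: cap_def norm_n_def)
    then show "x \<in> (\<Inter>m. G m)" using x by (auto simp: G_def)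
  qed
  moreover have "(\<lambda>m. emeasure \<mu> (G m)) \<longlonglongrightarrow> emeasure \<mu> (\<Inter>m. G m)"
    using G \<open>decseq G\<close> by (intro Lim_emeasure_decseq) auto
  moreover have "emeasure \<nu> C \<le> emeasure \<mu> (G m)" for m
    unfolding G_def by (rule rotation_invariant_closed_le_nbhd[OF \<mu> \<nu> C _ ne]) simp
  ultimately show ?thesis by (metis LIMSEQ_le_const)
qed simp

text \<open>The comparison on closed sets, used in both directions, gives equality there, and closed
  sets form an intersection stable generator. Both measures are first pushed to the Borel sets of
  the whole function space, where the generator is simply \<open>Collect closed\<close>.\<close>

lemma rotation_invariant_unique:
  assumes \<mu>: "rotation_invariant_prob n \<mu>" and \<nu>: "rotation_invariant_prob n \<nu>"
  shows "\<mu> = \<nu>"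
proof -
  have s: "sets \<mu> = sets (Sborel n)" "sets \<nu> = sets (Sborel n)"
    using \<mu> \<nu> by (simp_all add: rotation_invariant_prob_def Sborel_def)
  have sp: "space \<mu> = unit_sphere n" "space \<nu> = unit_sphere n"
    using s[THEN sets_eq_imp_space_eq] by simp_all
  have m: "(\<lambda>x. x) \<in> measurable (Sborel n) borel"
    unfolding Sborel_def by (rule measurable_restrict_space1) simp
  have m': "(\<lambda>x. x) \<in> measurable \<mu> borel" "(\<lambda>x. x) \<in> measurable \<nu> borel"
    using m by (simp_all add: measurable_cong_sets[OF s(1) refl] measurable_cong_sets[OF s(2) refl])
  have sb: "sets (borel :: (nat \<Rightarrow> real) measure) = sigma_sets UNIV (Collect closed)"
    by (subst borel_eq_closed) simp
  have "distr \<mu> borel (\<lambda>x. x) = distr \<nu> borel (\<lambda>x. x)"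
  proof (rule measure_eqI_generator_eq[where E = "Collect closed" and \<Omega> = UNIV and A = "\<lambda>_. UNIV"])
    show "Int_stable (Collect closed :: (nat \<Rightarrow> real) set set)" by (auto simp: Int_stable_def)
    show "emeasure (distr \<mu> borel (\<lambda>x. x)) X = emeasure (distr \<nu> borel (\<lambda>x. x)) X"
      if "X \<in> Collect closed" for X
    proof -
      have X: "closed (X \<inter> unit_sphere n)" using that closed_unit_sphere by auto
      have "emeasure \<mu> (X \<inter> unit_sphere n) = emeasure \<nu> (X \<inter> unit_sphere n)"
        using rotation_invariant_closed_le[OF \<mu> \<nu> X] rotation_invariant_closed_le[OF \<nu> \<mu> X]
        by (simp add: order_antisym)
      then show ?thesis using that m' by (simp add: emeasure_distr sp)
    qed
    show "emeasure (distr \<mu> borel (\<lambda>x. x)) UNIV \<noteq> \<infinity>"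
    proof -
      interpret prob_space \<mu> using \<mu> by (simp add: rotation_invariant_prob_def)
      show ?thesis using m' by (simp add: emeasure_distr)
    qed
  qed (auto simp: sb)
  then have eq: "emeasure (distr \<mu> borel (\<lambda>x. x)) A = emeasure (distr \<nu> borel (\<lambda>x. x)) A" for A by simp
  show ?thesis
  proof (rule measure_eqI)
    fix A assume "A \<in> sets \<mu>"
    then have "A \<in> sets borel" "A \<subseteq> unit_sphere n" by (auto simp: s sets_Sborel_iff)
    then show "emeasure \<mu> A = emeasure \<nu> A"
      using eq[of A] m' by (simp add: emeasure_distr sp Int_absorb2)
  qed (simp add: s)
qed

lemma sphere_measure_eq: "n \<ge> 1 \<Longrightarrow> sphere_measure n = sphere_unif n"
  unfolding sphere_measure_def
  by (rule the_equality) (use rotation_invariant_sphere_unif rotation_invariant_unique in blast)+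

subsection \<open>Convex bodies and ellipsoids\<close>

lemma symmetric_convex_bodyD:
  assumes "symmetric_convex_body n K"
  shows "compact K" "K \<subseteq> Rn n" "K \<in> sets (Rborel n)"
    and "\<And>x y t. x \<in> K \<Longrightarrow> y \<in> K \<Longrightarrow> 0 \<le> t \<Longrightarrow> t \<le> 1 \<Longrightarrow> (\<lambda>i. (1 - t) * x i + t * y i) \<in> K"
    and "\<And>x. x \<in> K \<Longrightarrow> (\<lambda>i. - x i) \<in> K"
proof -
  have c: "compactin (Euclidean_space n) K" using assms by (simp add: symmetric_convex_body_def)
  then show K: "K \<subseteq> Rn n" by (rule compactin_subset_topspace)
  show "compact K"
    using c by (simp add: Euclidean_space_def compactin_subtopology euclidean_product_topology)
  then have "closed K" by (rule compact_imp_closed)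
  then show "K \<in> sets (Rborel n)" using K by (rule closed_in_Rborel)
  show "\<And>x y t. x \<in> K \<Longrightarrow> y \<in> K \<Longrightarrow> 0 \<le> t \<Longrightarrow> t \<le> 1 \<Longrightarrow> (\<lambda>i. (1 - t) * x i + t * y i) \<in> K"
    using assms by (simp add: symmetric_convex_body_def convex_n_def)
  show "\<And>x. x \<in> K \<Longrightarrow> (\<lambda>i. - x i) \<in> K"
    using assms by (simp add: symmetric_convex_body_def)
qed

lemma open_contains_cube:
  fixes p :: "nat \<Rightarrow> real"
  assumes "open T" "p \<in> T"
  obtains \<epsilon> where "\<epsilon> > 0" "\<And>y. (\<And>i. i < n \<Longrightarrow> \<bar>y i - p i\<bar> < \<epsilon>) \<Longrightarrow> (\<And>i. i \<ge> n \<Longrightarrow> y i = p i) \<Longrightarrow> y \<in> T"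
proof -
  have o: "openin (product_topology (\<lambda>i. euclidean) UNIV) T"
    using assms(1) by (simp add: euclidean_product_topology)
  obtain X where X: "p \<in> Pi\<^sub>E UNIV X" "\<And>i. open (X i)" "Pi\<^sub>E UNIV X \<subseteq> T"
    using product_topology_open_contains_basis[OF o assms(2)] by auto
  have "\<exists>\<epsilon>>0. \<forall>t. \<bar>t - p i\<bar> < \<epsilon> \<longrightarrow> t \<in> X i" for i
  proof -
    have "p i \<in> X i" using X(1) by auto
    then obtain e where "e > 0" "\<forall>t. dist t (p i) < e \<longrightarrow> t \<in> X i" using X(2)[of i] unfolding open_dist by blast
    then show ?thesis by (auto simp: dist_real_def)
  qed
  then obtain \<epsilon> where \<epsilon>: "\<And>i. \<epsilon> i > 0" "\<And>i t. \<bar>t - p i\<bar> < \<epsilon> i \<Longrightarrow> t \<in> X i" by metis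
  \<comment> \<open>The element 1 keeps the minimum over a nonempty set when \<open>n\<close> is
    0.\<close>
  define e where "e = Min (insert 1 (\<epsilon> ` {..<n}))"
  have e: "e > 0" "\<And>i. i < n \<Longrightarrow> e \<le> \<epsilon> i" using \<epsilon>(1) by (auto simp: e_def)
  have "y \<in> T" if y: "\<And>i. i < n \<Longrightarrow> \<bar>y i - p i\<bar> < e" "\<And>i. i \<ge> n \<Longrightarrow> y i = p i" for y
  proof -
    have "y i \<in> X i" for i
    proof (cases "i < n")
      case True
      then show ?thesis using y(1)[of i] e(2)[of i] \<epsilon>(2)[of "y i" i] by linarith
    next
      case False
      then show ?thesis using y(2)[of i] \<epsilon>(2)[of "p i" i] \<epsilon>(1)[of i] by simp
    qed
    then show ?thesis using X(3) by auto
  qed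
  with e(1) show ?thesis using that by blast
qed

text \<open>A small cube around an interior point \<open>p\<close> is recentred by symmetry:
  \<open>x\<close> is the midpoint of \<open>p + x\<close> and \<open>- (p - x)\<close>.\<close>

lemma body_contains_ball:
  assumes K: "symmetric_convex_body n K"
  obtains \<epsilon> where "\<epsilon> > 0" "\<And>x. x \<in> Rn n \<Longrightarrow> norm_n n x \<le> \<epsilon> \<Longrightarrow> x \<in> K"
proof -
  obtain p where "p \<in> Euclidean_space n interior_of K" using K by (auto simp: symmetric_convex_body_def)
  then obtain O' where O': "openin (Euclidean_space n) O'" "p \<in> O'" "O' \<subseteq> K"
    by (auto simp: interior_of_def)
  then obtain T where T: "open T" "O' = T \<inter> {x. \<forall>i\<ge>n. x i = 0}"
    by (auto simp: Euclidean_space_def openin_subtopology euclidean_product_topology)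
  have p: "p \<in> T" "\<And>i. i \<ge> n \<Longrightarrow> p i = 0" using O' T by auto
  obtain \<epsilon> where \<epsilon>: "\<epsilon> > 0"
    "\<And>y. (\<And>i. i < n \<Longrightarrow> \<bar>y i - p i\<bar> < \<epsilon>) \<Longrightarrow> (\<And>i. i \<ge> n \<Longrightarrow> y i = p i) \<Longrightarrow> y \<in> T"
    using open_contains_cube[OF T(1) p(1)] by blast
  have "x \<in> K" if x: "x \<in> Rn n" "norm_n n x \<le> \<epsilon> / 2" for x
  proof -
    have "(\<lambda>i. p i + x i) \<in> T"
    proof (rule \<epsilon>(2))
      fix i assume "i < n"
      then show "\<bar>p i + x i - p i\<bar> < \<epsilon>" using abs_le_norm_n[of i n x] x(2) \<epsilon>(1) by simp
    qed (use x in \<open>simp add: Rn_iff\<close>)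
    then have 1: "(\<lambda>i. p i + x i) \<in> K" using O' T p x by (auto simp: Rn_iff)
    have "(\<lambda>i. p i - x i) \<in> T"
    proof (rule \<epsilon>(2))
      fix i assume "i < n"
      then show "\<bar>p i - x i - p i\<bar> < \<epsilon>" using abs_le_norm_n[of i n x] x(2) \<epsilon>(1) by simp
    qed (use x in \<open>simp add: Rn_iff\<close>)
    then have "(\<lambda>i. p i - x i) \<in> K" using O' T p x by (auto simp: Rn_iff)
    then have "(\<lambda>i. - (p i - x i)) \<in> K" by (rule symmetric_convex_bodyD(5)[OF K])
    from symmetric_convex_bodyD(4)[OF K 1 this, of "1/2"]
    show "x \<in> K" by (simp add: field_simps)
  qed
  then show ?thesis using that[of "\<epsilon> / 2"] \<epsilon>(1) by simp
qed

lemma body_bounded: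
  assumes K: "symmetric_convex_body n K"
  obtains R where "R > 0" "\<And>x. x \<in> K \<Longrightarrow> norm_n n x \<le> R"
proof -
  have "compact (norm_n n ` K)"
    by (intro compact_continuous_image continuous_on_norm_n continuous_on_id symmetric_convex_bodyD(1)[OF K])
  then have "bounded (norm_n n ` K)" by (rule compact_imp_bounded)
  then obtain R where R: "R > 0" "\<forall>t\<in>norm_n n ` K. norm t \<le> R" unfolding bounded_pos by blast
  have "norm_n n x \<le> R" if "x \<in> K" for x using R(2) that by fastforce
  with R(1) show ?thesis using that by blast
qed

lemma body_zero: "symmetric_convex_body n K \<Longrightarrow> (\<lambda>i. 0) \<in> K"
  by (rule body_contains_ball) (auto simp: Rn_iff norm_n_def)

lemma body_combine:
  assumes K: "symmetric_convex_body n K" and "x \<in> K" "y \<in> K" "0 \<le> a" "0 \<le> b" "0 < a + b"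
  shows "(\<lambda>i. (a * x i + b * y i) / (a + b)) \<in> K"
proof -
  have "1 - b / (a + b) = a / (a + b)" using assms(6) by (simp add: field_simps)
  then show ?thesis
    using symmetric_convex_bodyD(4)[OF K assms(2,3), of "b / (a + b)"] assms(4-6)
    by (simp add: add_divide_distrib)
qed

lemma body_shrink:
  assumes K: "symmetric_convex_body n K" and "x \<in> K" "0 \<le> t" "t \<le> 1"
  shows "(\<lambda>i. t * x i) \<in> K"
  using symmetric_convex_bodyD(4)[OF K body_zero[OF K] assms(2-4)] by simp

section \<open>Ellipsoids in terms of their axes, and their volume\<close>

lemma mat_app_cong:
  assumes "\<And>i j. i < n \<Longrightarrow> j < n \<Longrightarrow> Q i j = P i j" "\<And>i. i < n \<Longrightarrow> x i = y i"
  shows "mat_app n Q x = mat_app n P y"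
  unfolding mat_app_def using assms by (auto intro!: sum.cong)

lemma shift_invariantD:
  "shift_invariant n \<nu> \<Longrightarrow> v \<in> Rn n \<Longrightarrow> A \<in> sets (Rborel n) \<Longrightarrow>
     emeasure \<nu> {x \<in> Rn n. (\<lambda>i. v i + x i) \<in> A} = emeasure \<nu> A"
  by (simp add: shift_invariant_def)

text \<open>The columns of \<open>Q\<close> are the directions of the axes, \<open>a\<close> the
  half-lengths and \<open>v\<close> the centre. Translation, rotation and diagonal scaling are
  exactly the maps whose effect on volume has been computed.\<close>

definition ell :: "nat \<Rightarrow> (nat \<Rightarrow> nat \<Rightarrow> real) \<Rightarrow> (nat \<Rightarrow> real) \<Rightarrow> (nat \<Rightarrow> real) \<Rightarrow> (nat \<Rightarrow> real) set" where
  "ell n Q a v = (\<lambda>c i. v i + mat_app n Q (\<lambda>i. a i * c i) i) ` unit_ball n"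

lemma ell_eq:
  assumes Q: "orth_n n Q" and a: "\<And>i. i < n \<Longrightarrow> a i > 0" and v: "v \<in> Rn n"
  shows "ell n Q a v = {x \<in> Rn n. (\<lambda>i. mat_app n (transp Q) (\<lambda>i. - v i + x i) i / a i) \<in> unit_ball n}"
    (is "_ = ?R")
proof (intro equalityI subsetI)
  fix x assume "x \<in> ell n Q a v"
  then obtain c where c: "c \<in> unit_ball n" "x = (\<lambda>i. v i + mat_app n Q (\<lambda>i. a i * c i) i)"
    by (auto simp: ell_def)
  have ac: "(\<lambda>i. a i * c i) \<in> Rn n" using c by (simp add: unit_ball_def Rn_iff)
  have "(\<lambda>i. - v i + x i) = mat_app n Q (\<lambda>i. a i * c i)" by (simp add: c fun_eq_iff)
  then have "mat_app n (transp Q) (\<lambda>i. - v i + x i) = (\<lambda>i. a i * c i)"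
    using mat_app_transp_cancel(1)[OF Q ac] by simp
  moreover have "(\<lambda>i. a i * c i / a i) = c"
  proof
    fix i show "a i * c i / a i = c i"
      using a[of i] c by (cases "i < n") (auto simp: unit_ball_def Rn_iff)
  qed
  moreover have "x \<in> Rn n" using v mat_app_Rn[of n Q "\<lambda>i. a i * c i"] by (simp add: c Rn_iff)
  ultimately show "x \<in> ?R" using c by simp
next
  fix x assume x: "x \<in> ?R"
  define c where "c = (\<lambda>i. mat_app n (transp Q) (\<lambda>i. - v i + x i) i / a i)"
  have xv: "(\<lambda>i. - v i + x i) \<in> Rn n" using x v by (simp add: Rn_iff)
  have "mat_app n Q (\<lambda>i. a i * c i) = mat_app n Q (mat_app n (transp Q) (\<lambda>i. - v i + x i))"
    by (rule mat_app_cong) (use a in \<open>auto simp: c_def less_imp_neq[symmetric]\<close>)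
  also have "\<dots> = (\<lambda>i. - v i + x i)" by (rule mat_app_transp_cancel(2)[OF Q xv])
  finally have "x = (\<lambda>i. v i + mat_app n Q (\<lambda>i. a i * c i) i)" by (simp add: fun_eq_iff)
  moreover have "c \<in> unit_ball n" using x by (simp add: c_def)
  ultimately show "x \<in> ell n Q a v" unfolding ell_def by (rule image_eqI)
qed

lemma sets_ell_vol_ell:
  assumes Q: "orth_n n Q" and a: "\<And>i. i < n \<Longrightarrow> a i > 0" and v: "v \<in> Rn n"
  shows "ell n Q a v \<in> sets (Rborel n)"
    and "vol n (ell n Q a v) = (\<Prod>i<n. a i) * vol n (unit_ball n)"
proof -
  define C where "C = {z \<in> Rn n. (\<lambda>i. 0 + 1 / a i * z i) \<in> unit_ball n}"
  define B where "B = {y \<in> Rn n. mat_app n (transp Q) y \<in> C}"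
  have z: "(\<lambda>i. 0) \<in> Rn n" and v': "(\<lambda>i. - v i) \<in> Rn n" using v by (simp_all add: Rn_iff)
  have C: "C \<in> sets (Rborel n)"
    using sets_Collect_mem_measurable[OF measurable_affine_Rborel[OF z, of "\<lambda>i. 1 / a i"] sets_unit_ball]
    by (simp add: C_def)
  have B: "B \<in> sets (Rborel n)"
    using sets_Collect_mem_measurable[OF measurable_mat_app C] by (simp add: B_def)
  have E: "ell n Q a v = {x \<in> Rn n. (\<lambda>i. - v i + x i) \<in> B}"
  proof -
    have "{x \<in> Rn n. (\<lambda>i. mat_app n (transp Q) (\<lambda>i. - v i + x i) i / a i) \<in> unit_ball n}
        = {x \<in> Rn n. (\<lambda>i. - v i + x i) \<in> B}"
      using v mat_app_Rn[of n "transp Q"] by (auto simp: B_def C_def Rn_iff)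
    then show ?thesis using ell_eq[OF assms] by simp
  qed
  show sE: "ell n Q a v \<in> sets (Rborel n)"
    using sets_Collect_mem_measurable[OF measurable_shift[OF v'] B] by (simp add: E)
  have "emeasure (leb n) (ell n Q a v) = emeasure (leb n) B"
    unfolding E by (rule shift_invariantD[OF shift_invariant_leb v' B])
  also have "\<dots> = emeasure (leb n) C"
    unfolding B_def by (rule emeasure_leb_orth[OF orthogonal_mat_transpose[OF Q] C])
  finally have EC: "measure (leb n) (ell n Q a v) = measure (leb n) C" by (simp add: measure_def)
  have "emeasure (leb n) (unit_ball n) = (\<Prod>i<n. ennreal \<bar>1 / a i\<bar>) * emeasure (leb n) C"
    unfolding C_def by (rule emeasure_leb_affine[OF _ z sets_unit_ball]) (use a in force)
  also have "(\<Prod>i<n. ennreal \<bar>1 / a i\<bar>) = ennreal (\<Prod>i<n. 1 / a i)"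
    using a by (subst prod_ennreal[symmetric]) (auto simp: less_imp_le intro!: prod.cong)
  finally have "measure (leb n) (unit_ball n) = (\<Prod>i<n. 1 / a i) * measure (leb n) C"
  proof -
    have "(\<Prod>i<n. 1 / a i) \<ge> 0" using a by (intro prod_nonneg) (auto simp: less_imp_le)
    moreover assume "emeasure (leb n) (unit_ball n) = ennreal (\<Prod>i<n. 1 / a i) * emeasure (leb n) C"
    ultimately show ?thesis by (simp add: measure_def enn2real_mult)
  qed
  moreover have "(\<Prod>i<n. a i) * (\<Prod>i<n. 1 / a i) = 1"
    unfolding prod.distrib[symmetric] using a by (intro prod.neutral) (auto simp: less_imp_neq[symmetric])
  ultimately have "measure (leb n) C = (\<Prod>i<n. a i) * measure (leb n) (unit_ball n)"
    by (simp add: mult.assoc[symmetric])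
  then show "vol n (ell n Q a v) = (\<Prod>i<n. a i) * vol n (unit_ball n)"
    by (simp add: vol_eq_leb[OF sE] vol_eq_leb[OF sets_unit_ball] EC)
qed

lemma vol_unit_ball_pos: "vol n (unit_ball n) > 0"
  using emeasure_unit_ball[of n]
  by (simp add: vol_eq_leb[OF sets_unit_ball] measure_def enn2real_positive_iff less_top zero_less_iff_neq_zero)

lemma ellipsoid_ell:
  assumes Q: "orth_n n Q" and a: "\<And>i. i < n \<Longrightarrow> a i > 0" and v: "v \<in> Rn n"
  shows "ellipsoid n (ell n Q a v)"
proof -
  define T where "T c = mat_app n Q (\<lambda>i. a i * c i)" for c
  have "linear_n n T"
    unfolding linear_n_def T_def
  proof (intro conjI ballI allI funcsetI)
    fix x y :: "nat \<Rightarrow> real" and b :: real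
    show "mat_app n Q (\<lambda>i. a i * x i) \<in> Rn n" by (rule mat_app_Rn)
    show "mat_app n Q (\<lambda>i. a i * (x i + y i)) = (\<lambda>i. mat_app n Q (\<lambda>i. a i * x i) i + mat_app n Q (\<lambda>i. a i * y i) i)"
      using mat_app_lincomb(1)[of n Q "\<lambda>i. a i * x i" "\<lambda>i. a i * y i"] by (simp add: distrib_left)
    show "mat_app n Q (\<lambda>i. a i * (b * x i)) = (\<lambda>i. b * mat_app n Q (\<lambda>i. a i * x i) i)"
      using mat_app_lincomb(2)[of n Q b "\<lambda>i. a i * x i"] by (simp add: mult.left_commute)
  qed
  moreover have "bij_betw T (Rn n) (Rn n)"
  proof (rule bij_betw_byWitness[where f' = "\<lambda>x i. mat_app n (transp Q) x i / a i"])
    show "\<forall>c\<in>Rn n. (\<lambda>i. mat_app n (transp Q) (T c) i / a i) = c"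
    proof
      fix c assume c: "c \<in> Rn n"
      then have "(\<lambda>i. a i * c i) \<in> Rn n" by (simp add: Rn_iff)
      then have e: "mat_app n (transp Q) (T c) = (\<lambda>i. a i * c i)"
        unfolding T_def by (rule mat_app_transp_cancel(1)[OF Q])
      show "(\<lambda>i. mat_app n (transp Q) (T c) i / a i) = c"
      proof
        fix i show "mat_app n (transp Q) (T c) i / a i = c i"
          unfolding e using a[of i] c by (cases "i < n") (auto simp: Rn_iff)
      qed
    qed
    show "\<forall>x\<in>Rn n. T (\<lambda>i. mat_app n (transp Q) x i / a i) = x"
    proof
      fix x assume x: "x \<in> Rn n"
      have "T (\<lambda>i. mat_app n (transp Q) x i / a i) = mat_app n Q (mat_app n (transp Q) x)"
        unfolding T_def by (rule mat_app_cong) (use a in \<open>auto simp: less_imp_neq[symmetric]\<close>)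
      then show "T (\<lambda>i. mat_app n (transp Q) x i / a i) = x" by (simp add: mat_app_transp_cancel(2)[OF Q x])
    qed
    show "T ` Rn n \<subseteq> Rn n" by (auto simp: T_def mat_app_Rn)
    show "(\<lambda>x i. mat_app n (transp Q) x i / a i) ` Rn n \<subseteq> Rn n"
      using mat_app_Rn by (auto simp: Rn_iff)
  qed
  moreover have "ell n Q a v = (\<lambda>x i. v i + T x i) ` unit_ball n" by (simp add: ell_def T_def)
  ultimately show ?thesis unfolding ellipsoid_def using v by blast
qed

lemma linear_n_add:
  "linear_n n T \<Longrightarrow> x \<in> Rn n \<Longrightarrow> y \<in> Rn n \<Longrightarrow> T (\<lambda>i. x i + y i) = (\<lambda>i. T x i + T y i)"
  by (simp add: linear_n_def)

lemma linear_n_scale: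
  "linear_n n T \<Longrightarrow> x \<in> Rn n \<Longrightarrow> T (\<lambda>i. b * x i) = (\<lambda>i. b * T x i)"
  by (simp add: linear_n_def)

lemma inner_n_linear_bil:
  assumes T: "linear_n n T" and x: "x \<in> Rn n" and y: "y \<in> Rn n"
  shows "inner_n n (T x) (T y) = bil {..<n} (\<lambda>k l. inner_n n (T (unit_vec k)) (T (unit_vec l))) x y"
  unfolding linear_n_expansion[OF T x] linear_n_expansion[OF T y] inner_n_sum bil_def
  by (simp add: sum_distrib_left mult_ac)

text \<open>With \<open>S\<close> the inverse of \<open>T\<close>, the centred ellipsoid consists of
  the \<open>x\<close> with \<open>S x\<close> in the unit ball. Diagonalising the quadratic form of
  \<open>S\<close> gives the axis directions \<open>f i\<close>, and the eigenvalue
  \<open>s i\<close> gives the half-axis \<open>1 / sqrt (s i)\<close>.\<close>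

lemma ellipsoid_axes:
  assumes "ellipsoid n E"
  obtains Q a v where "orth_n n Q" "\<And>i. i < n \<Longrightarrow> a i > 0" "v \<in> Rn n" "E = ell n Q a v"
proof -
  obtain T v where v: "v \<in> Rn n" and T: "linear_n n T" "bij_betw T (Rn n) (Rn n)"
    and E: "E = (\<lambda>x i. v i + T x i) ` unit_ball n"
    using assms unfolding ellipsoid_def by blast
  define S where "S = the_inv_into (Rn n) T"
  have inj: "inj_on T (Rn n)" and im: "T ` Rn n = Rn n" using T(2) by (auto simp: bij_betw_def)
  have ST: "S (T x) = x" if "x \<in> Rn n" for x unfolding S_def by (rule the_inv_into_f_f[OF inj that])
  have TS: "T (S x) = x" "S x \<in> Rn n" if "x \<in> Rn n" for x
    unfolding S_def using f_the_inv_into_f[OF inj, of x] the_inv_into_into[OF inj, of x "Rn n"] im that by auto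
  have Sl: "linear_n n S"
    unfolding linear_n_def
  proof (intro conjI ballI allI funcsetI)
    fix x assume x: "x \<in> Rn n"
    show "S x \<in> Rn n" by (rule TS(2)[OF x])
    show "S (\<lambda>i. b * x i) = (\<lambda>i. b * S x i)" for b
    proof -
      have "T (\<lambda>i. b * S x i) = (\<lambda>i. b * x i)"
        using T(1) TS[OF x] unfolding linear_n_def by simp
      moreover have "(\<lambda>i. b * S x i) \<in> Rn n" using TS(2)[OF x] by (simp add: Rn_iff)
      ultimately show ?thesis using ST by metis
    qed
    fix y assume y: "y \<in> Rn n"
    show "S (\<lambda>i. x i + y i) = (\<lambda>i. S x i + S y i)"
    proof -
      have "T (\<lambda>i. S x i + S y i) = (\<lambda>i. x i + y i)"
        using T(1) TS[OF x] TS[OF y] unfolding linear_n_def by simp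
      moreover have "(\<lambda>i. S x i + S y i) \<in> Rn n" using TS(2)[OF x] TS(2)[OF y] by (simp add: Rn_iff)
      ultimately show ?thesis using ST by metis
    qed
  qed
  define A where "A = (\<lambda>k l. inner_n n (S (unit_vec k)) (S (unit_vec l)))"
  obtain P where P: "orth_n n P" "\<And>i j. i < n \<Longrightarrow> j < n \<Longrightarrow> i \<noteq> j \<Longrightarrow> bil {..<n} A (P i) (P j) = 0"
    using symmetric_mat_diagonalizable[of "{..<n}" A] by (auto simp: A_def inner_n_commute)
  define Q where "Q = (\<lambda>i j. P j i)"
  have Q: "orth_n n Q" unfolding Q_def by (rule orthogonal_mat_transpose[OF P(1)])
  define f where "f i = zero_ext n (P i)" for i
  have f: "f i \<in> Rn n" for i by (simp add: f_def zero_ext_Rn)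
  define s where "s i = inner_n n (S (f i)) (S (f i))" for i
  have Sf: "inner_n n (S (f i)) (S (f j)) = bil {..<n} A (P i) (P j)" for i j
    unfolding inner_n_linear_bil[OF Sl f f] A_def[symmetric]
    by (simp add: bil_def f_def zero_ext_def)
  have sp: "s i > 0" if "i < n" for i
  proof (rule ccontr)
    assume "\<not> s i > 0"
    then have "norm_n n (S (f i)) = 0" using inner_n_nonneg[of n "S (f i)"] by (simp add: norm_n_def s_def)
    then have "S (f i) = (\<lambda>i. 0)" using norm_n_eq_0_iff TS(2)[OF f] by blast
    moreover have "T (\<lambda>i. 0) = (\<lambda>i. 0)"
      using linear_n_expansion[OF T(1), of "\<lambda>i. 0"] by (simp add: Rn_iff)
    ultimately have "f i = (\<lambda>i. 0)" using TS(1)[OF f, of i] by simp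
    then have "P i k = 0" if "k < n" for k using that by (auto simp: f_def zero_ext_def fun_eq_iff split: if_splits)
    then have "(\<Sum>k<n. P i k * P i k) = 0" by simp
    then show False using orthogonal_matD(1)[OF P(1), of i i] that by simp
  qed
  define a where "a i = 1 / sqrt (s i)" for i
  have a: "a i > 0" if "i < n" for i using sp[OF that] by (simp add: a_def)
  \<comment> \<open>Composed with \<open>S\<close>, scaling by \<open>a\<close> and rotating by
    \<open>Q\<close> is an isometry. Hence \<open>T\<close> and this map have the same image of the
    unit ball.\<close>
  have iso: "norm_n n (S (mat_app n Q (\<lambda>i. a i * c i))) = norm_n n c" for c
  proof -
    have "mat_app n Q (\<lambda>i. a i * c i) = (\<lambda>k. \<Sum>i<n. (a i * c i) * f i k)"
      by (auto simp: mat_app_def Q_def f_def zero_ext_def fun_eq_iff mult_ac intro!: sum.cong)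
    moreover have "S (\<lambda>k. \<Sum>i<m. (a i * c i) * f i k) = (\<lambda>k. \<Sum>i<m. (a i * c i) * S (f i) k)" for m
    proof (induction m)
      case 0
      have "S (\<lambda>k. 0) = (\<lambda>k. 0)" using linear_n_expansion[OF Sl, of "\<lambda>i. 0"] by (simp add: Rn_iff)
      then show ?case by simp
    next
      case (Suc m)
      have 1: "(\<lambda>k. \<Sum>i<m. (a i * c i) * f i k) \<in> Rn n" "(\<lambda>k. (a m * c m) * f m k) \<in> Rn n"
        using f by (auto simp: Rn_iff)
      have "S (\<lambda>k. (\<Sum>i<m. (a i * c i) * f i k) + (a m * c m) * f m k)
          = (\<lambda>k. S (\<lambda>k. \<Sum>i<m. (a i * c i) * f i k) k + S (\<lambda>k. (a m * c m) * f m k) k)"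
        by (rule linear_n_add[OF Sl 1])
      also have "S (\<lambda>k. (a m * c m) * f m k) = (\<lambda>k. (a m * c m) * S (f m) k)"
        by (rule linear_n_scale[OF Sl f])
      finally show ?case using Suc by simp
    qed
    ultimately have "inner_n n (S (mat_app n Q (\<lambda>i. a i * c i))) (S (mat_app n Q (\<lambda>i. a i * c i)))
        = (\<Sum>i<n. (a i * c i) * (\<Sum>j<n. (a j * c j) * inner_n n (S (f i)) (S (f j))))"
      by (simp add: inner_n_sum)
    also have "\<dots> = (\<Sum>i<n. (a i * c i) * (\<Sum>j<n. if j = i then a i * c i * s i else 0))"
      using P(2) by (intro sum.cong refl arg_cong2[where f = "(*)"]) (auto simp: Sf s_def)
    also have "\<dots> = inner_n n c c"
      unfolding inner_n_def
    proof (intro sum.cong refl)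
      fix i assume "i \<in> {..<n}"
      then have "a i * a i * s i = 1" using sp[of i] by (simp add: a_def)
      then show "(a i * c i) * (\<Sum>j<n. if j = i then a i * c i * s i else 0) = c i * c i"
        using \<open>i \<in> {..<n}\<close> by (simp add: algebra_simps)
    qed
    finally show ?thesis by (simp add: norm_n_def)
  qed
  have "T ` unit_ball n = (\<lambda>c. mat_app n Q (\<lambda>i. a i * c i)) ` unit_ball n"
  proof (intro equalityI subsetI)
    fix x assume "x \<in> T ` unit_ball n"
    then obtain u where u: "u \<in> unit_ball n" "x = T u" by blast
    then have ur: "u \<in> Rn n" by (simp add: unit_ball_def)
    then have x: "x \<in> Rn n" using im u by blast
    define c where "c = (\<lambda>i. mat_app n (transp Q) x i / a i)"
    have c: "c \<in> Rn n" using mat_app_Rn by (auto simp: c_def Rn_iff)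
    have "mat_app n Q (\<lambda>i. a i * c i) = mat_app n Q (mat_app n (transp Q) x)"
      by (rule mat_app_cong) (use a in \<open>auto simp: c_def less_imp_neq[symmetric]\<close>)
    then have xc: "mat_app n Q (\<lambda>i. a i * c i) = x" by (simp add: mat_app_transp_cancel(2)[OF Q x])
    have "norm_n n c = norm_n n u" using iso[of c] ST[OF ur] by (simp add: xc u(2))
    then have "c \<in> unit_ball n" using c u by (simp add: unit_ball_def)
    with xc show "x \<in> (\<lambda>c. mat_app n Q (\<lambda>i. a i * c i)) ` unit_ball n" by blast
  next
    fix x assume "x \<in> (\<lambda>c. mat_app n Q (\<lambda>i. a i * c i)) ` unit_ball n"
    then obtain c where c: "c \<in> unit_ball n" "x = mat_app n Q (\<lambda>i. a i * c i)" by blast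
    have x: "x \<in> Rn n" by (simp add: c mat_app_Rn)
    have "S x \<in> unit_ball n" using iso[of c] c TS(2)[OF x] by (simp add: unit_ball_def)
    moreover have "x = T (S x)" using TS(1)[OF x] by simp
    ultimately show "x \<in> T ` unit_ball n" by blast
  qed
  then have "(\<lambda>y i. v i + y i) ` T ` unit_ball n
      = (\<lambda>y i. v i + y i) ` (\<lambda>c. mat_app n Q (\<lambda>i. a i * c i)) ` unit_ball n" by simp
  then have "E = ell n Q a v" by (simp add: E ell_def image_image)
  from that[of Q a v, OF Q a v this] show ?thesis .
qed

lemma ell_cong:
  assumes "\<And>i j. i < n \<Longrightarrow> j < n \<Longrightarrow> Q i j = P i j" "\<And>i. i < n \<Longrightarrow> a i = b i"
  shows "ell n Q a v = ell n P b v"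
proof -
  have "mat_app n Q (\<lambda>i. a i * c i) = mat_app n P (\<lambda>i. b i * c i)" for c
    by (rule mat_app_cong) (use assms in auto)
  then show ?thesis by (simp add: ell_def)
qed

lemma orthogonal_mat_cong:
  assumes "orthogonal_mat I Q" "\<And>i j. i \<in> I \<Longrightarrow> j \<in> I \<Longrightarrow> Q i j = P i j"
  shows "orthogonal_mat I P"
proof -
  have "(\<Sum>k\<in>I. P i k * P j k) = (\<Sum>k\<in>I. Q i k * Q j k)" "(\<Sum>k\<in>I. P k i * P k j) = (\<Sum>k\<in>I. Q k i * Q k j)"
    if "i \<in> I" "j \<in> I" for i j
    using that assms(2) by (auto intro!: sum.cong)
  then show ?thesis using assms(1) unfolding orthogonal_mat_def by simp
qed

lemma unit_vec_unit_ball: "j < n \<Longrightarrow> unit_vec j \<in> unit_ball n"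
  by (simp add: unit_ball_def unit_vec_Rn norm_n_def inner_n_unit_vec) (simp add: unit_vec_def)

type_synonym ell_param = "(nat \<Rightarrow> nat \<Rightarrow> real) \<times> (nat \<Rightarrow> real) \<times> (nat \<Rightarrow> real)"

text \<open>The maximum is taken over the compact set of all \<open>(Q, a, v)\<close> with \<open>a \<ge> 0\<close>, degenerate
  ellipsoids included; the volume is proportional to the product of the half-axes.\<close>
lemma max_volume_ellipsoid_exists:
  assumes K: "symmetric_convex_body n K"
  obtains E where "max_volume_ellipsoid n K E"
proof -
  obtain R where R: "R > 0" "\<And>x. x \<in> K \<Longrightarrow> norm_n n x \<le> R" using body_bounded[OF K] by blast
  obtain \<epsilon> where \<epsilon>: "\<epsilon> > 0" "\<And>x. x \<in> Rn n \<Longrightarrow> norm_n n x \<le> \<epsilon> \<Longrightarrow> x \<in> K"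
    using body_contains_ball[OF K] by blast
  \<comment> \<open>An a priori bound for the half-axes. Centre and axis endpoints lie in
    \<open>K\<close>, so each entry \<open>b i * P j i\<close> is at most \<open>2 * R\<close> in
    absolute value; weighting these with \<open>P j i\<close> and summing over \<open>j\<close>
    recovers \<open>b i\<close>.\<close>
  define B where "B = 2 * R * real n"
  define O' where "O' = {Q. orth_n n Q \<and> (\<forall>i j. i \<notin> {..<n} \<or> j \<notin> {..<n} \<longrightarrow> Q i j = 0)}"
  define A where "A = {a :: nat \<Rightarrow> real. \<forall>i. a i \<in> (if i < n then {0..B} else {0})}"
  define V where "V = {v :: nat \<Rightarrow> real. \<forall>i. v i \<in> (if i < n then {-R..R} else {0})}"
  \<comment> \<open>Inclusion in \<open>K\<close> is split into one condition for each point
    \<open>c\<close> of the unit ball. Each is closed in the parameters, so their intersection with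
    the compact box is compact.\<close>
  define F where "F c = {p :: ell_param.
     (\<lambda>i. snd (snd p) i + mat_app n (fst p) (\<lambda>i. fst (snd p) i * c i) i) \<in> K}" for c
  define W where "W = (O' \<times> A \<times> V) \<inter> (\<Inter>c\<in>unit_ball n. F c)"
  have "compact O'" unfolding O'_def by (rule compact_orthogonal_mats) simp
  moreover have "compact A" unfolding A_def by (rule compact_Pi_UNIV) simp
  moreover have "compact V" unfolding V_def by (rule compact_Pi_UNIV) simp
  ultimately have "compact (O' \<times> A \<times> V)" by (intro compact_Times)
  moreover have "closed (F c)" for c
  proof -
    have c1: "continuous_on UNIV (\<lambda>p :: ell_param. fst p i j)" for i j
      by (rule continuous_on_product_then_coordinatewise, rule continuous_on_product_then_coordinatewise,
          rule continuous_on_fst, rule continuous_on_id)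
    have c2: "continuous_on UNIV (\<lambda>p :: ell_param. fst (snd p) i)" for i
      by (rule continuous_on_product_then_coordinatewise,
          rule continuous_on_fst, rule continuous_on_snd, rule continuous_on_id)
    have c3: "continuous_on UNIV (\<lambda>p :: ell_param. snd (snd p) i)" for i
      by (rule continuous_on_product_then_coordinatewise,
          rule continuous_on_snd, rule continuous_on_snd, rule continuous_on_id)
    have "continuous_on UNIV (\<lambda>p :: ell_param.
        snd (snd p) i + mat_app n (fst p) (\<lambda>i. fst (snd p) i * c i) i)" for i
    proof (cases "i < n")
      case True
      then show ?thesis unfolding mat_app_def
        by (simp only: if_True) (intro continuous_on_add continuous_on_sum continuous_on_mult c1 c2 c3 continuous_on_const)
    next
      case False
      then show ?thesis unfolding mat_app_def by (simp add: c3)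
    qed
    then have "continuous_on UNIV (\<lambda>p :: ell_param.
        \<lambda>i. snd (snd p) i + mat_app n (fst p) (\<lambda>i. fst (snd p) i * c i) i)"
      by (rule continuous_on_coordinatewise_then_product)
    moreover have "closed K" using symmetric_convex_bodyD(1)[OF K] by (rule compact_imp_closed)
    ultimately have "closed ((\<lambda>p :: ell_param.
        \<lambda>i. snd (snd p) i + mat_app n (fst p) (\<lambda>i. fst (snd p) i * c i) i) -` K)"
      by (intro closed_vimage)
    then show ?thesis by (simp add: F_def vimage_def)
  qed
  ultimately have "compact W" unfolding W_def by (intro compact_Int_closed closed_INT) auto
  define f where "f p = (\<Prod>i<n. fst (snd p) i)" for p :: "(nat \<Rightarrow> nat \<Rightarrow> real) \<times> (nat \<Rightarrow> real) \<times> (nat \<Rightarrow> real)"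
  have cf: "continuous_on W f"
    unfolding f_def
    by (intro continuous_on_prod, rule continuous_on_product_then_coordinatewise,
        rule continuous_on_fst, rule continuous_on_snd, rule continuous_on_id)
  have inW: "\<exists>p\<in>W. f p = (\<Prod>i<n. a i)"
    if Q: "orth_n n Q" and a: "\<And>i. i < n \<Longrightarrow> a i > 0" and v: "v \<in> Rn n" and E: "ell n Q a v \<subseteq> K" for Q a v
  proof -
    define P where "P = (\<lambda>i j. if i < n \<and> j < n then Q i j else 0)"
    define b where "b = zero_ext n a"
    have PQ: "orth_n n P" by (rule orthogonal_mat_cong[OF Q]) (simp add: P_def)
    then have "P \<in> O'" by (auto simp: O'_def P_def)
    have "ell n P b v = ell n Q a v" by (rule ell_cong) (simp_all add: P_def b_def zero_ext_def)
    then have EK: "(\<lambda>i. v i + mat_app n P (\<lambda>i. b i * c i) i) \<in> K" if "c \<in> unit_ball n" for c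
      using E that by (auto simp: ell_def)
    have vK: "\<bar>v i\<bar> \<le> R" if "i < n" for i
    proof -
      have "(\<lambda>i. 0) \<in> unit_ball n" by (simp add: unit_ball_def Rn_iff norm_n_def)
      from EK[OF this] have "v \<in> K" by (simp add: mat_app_def cong: if_cong)
      then show ?thesis using R(2)[of v] abs_le_norm_n[OF that, of v] by linarith
    qed
    then have "v \<in> V" using v by (auto simp: V_def Rn_iff abs_le_iff) (metis minus_le_iff)
    have "b i \<le> B" if i: "i < n" for i
    proof -
      have e: "mat_app n P (\<lambda>k. b k * unit_vec i k) = (\<lambda>j. b i * P j i)"
      proof
        fix j
        have "(\<Sum>k<n. P j k * (b k * unit_vec i k)) = (\<Sum>k<n. if k = i then P j i * b i else 0)"
          by (intro sum.cong) (auto simp: unit_vec_def)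
        then show "mat_app n P (\<lambda>k. b k * unit_vec i k) j = b i * P j i"
          using i by (simp add: mat_app_def mult.commute) (simp add: P_def)
      qed
      have col: "\<bar>b i * P j i\<bar> \<le> 2 * R" if j: "j < n" for j
      proof -
        have "(\<lambda>j. v j + b i * P j i) \<in> K" using EK[OF unit_vec_unit_ball[OF i]] by (simp add: e)
        then have "\<bar>v j + b i * P j i\<bar> \<le> R"
          using R(2) abs_le_norm_n[OF j, of "\<lambda>j. v j + b i * P j i"] by (meson order_trans)
        then show ?thesis using vK[OF j] by linarith
      qed
      have "b i = b i * (\<Sum>j<n. P j i * P j i)"
        using orthogonal_matD(2)[OF PQ, of i i] i by simp
      also have "\<dots> = (\<Sum>j<n. P j i * (b i * P j i))" by (simp add: sum_distrib_left mult_ac)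
      also have "\<dots> \<le> (\<Sum>j<n. 2 * R)"
      proof (rule sum_mono)
        fix j assume "j \<in> {..<n}"
        then have j: "j < n" by simp
        have "P j i * (b i * P j i) \<le> \<bar>P j i\<bar> * \<bar>b i * P j i\<bar>" by (simp add: abs_mult[symmetric])
        also have "\<dots> \<le> 1 * (2 * R)"
          using orthogonal_mat_le_1[OF _ PQ, of j i] i j col[OF j] by (intro mult_mono) auto
        finally show "P j i * (b i * P j i) \<le> 2 * R" by simp
      qed
      finally show ?thesis by (simp add: B_def mult_ac)
    qed
    then have "b \<in> A" using a by (auto simp: A_def b_def zero_ext_def less_imp_le)
    then have "(P, b, v) \<in> W" using \<open>P \<in> O'\<close> \<open>v \<in> V\<close> EK by (simp add: W_def F_def)
    moreover have "f (P, b, v) = (\<Prod>i<n. a i)" by (simp add: f_def b_def zero_ext_def)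
    ultimately show ?thesis by blast
  qed
  \<comment> \<open>A small ball inside \<open>K\<close> makes the maximal product positive, so the
    maximiser has no degenerate axis.\<close>
  obtain p0 where p0: "p0 \<in> W" "f p0 > 0"
  proof -
    have I: "orth_n n (\<lambda>i j. if i = j then 1 else 0)" by (rule orthogonal_mat_id) simp
    have "ell n (\<lambda>i j. if i = j then 1 else 0) (\<lambda>i. \<epsilon>) (\<lambda>i. 0) \<subseteq> K"
    proof
      fix x assume "x \<in> ell n (\<lambda>i j. if i = j then 1 else 0) (\<lambda>i. \<epsilon>) (\<lambda>i. 0)"
      then obtain c where c: "c \<in> unit_ball n" "x = mat_app n (\<lambda>i j. if i = j then 1 else 0) (\<lambda>i. \<epsilon> * c i)"
        by (auto simp: ell_def)
      have ec: "(\<lambda>i. \<epsilon> * c i) \<in> Rn n" using c by (simp add: unit_ball_def Rn_iff)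
      have "norm_n n x = \<epsilon> * norm_n n c"
        using norm_n_mat_app_orth[OF I ec] \<epsilon>(1) by (simp add: c norm_n_scale)
      also have "\<dots> \<le> \<epsilon>" using c \<epsilon>(1) by (simp add: unit_ball_def mult_left_le)
      finally show "x \<in> K" using \<epsilon>(2) by (simp add: c mat_app_Rn)
    qed
    then obtain p where "p \<in> W" "f p = (\<Prod>i<n. \<epsilon>)"
      using inW[OF I, of "\<lambda>i. \<epsilon>" "\<lambda>i. 0"] \<epsilon>(1) by (auto simp: Rn_iff)
    then show ?thesis using that \<epsilon>(1) by (simp add: prod_pos)
  qed
  then have "W \<noteq> {}" by blast
  then obtain p where p: "p \<in> W" "\<And>q. q \<in> W \<Longrightarrow> f q \<le> f p"
    using continuous_attains_sup[OF \<open>compact W\<close> _ cf] by blast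
  obtain Q a v where pe: "p = (Q, a, v)" by (cases p) auto
  have Q: "orth_n n Q" and aA: "a \<in> A" and vV: "v \<in> V" and EK: "ell n Q a v \<subseteq> K"
    using p(1) by (auto simp: W_def pe O'_def F_def ell_def)
  have v: "v \<in> Rn n" using vV by (auto simp: V_def Rn_iff) (metis not_less singletonD)
  have a0: "a i \<ge> 0" if "i < n" for i
    using aA that unfolding A_def by (metis (mono_tags, lifting) mem_Collect_eq atLeastAtMost_iff)
  have "f p > 0" using p(2)[OF p0(1)] p0(2) by linarith
  then have "(\<Prod>i<n. a i) > 0" by (simp add: f_def pe)
  have a: "a i > 0" if "i < n" for i
  proof -
    have "a i \<noteq> 0"
    proof
      assume "a i = 0"
      then have "(\<Prod>i<n. a i) = 0" using that by (intro prod_zero) auto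
      with \<open>(\<Prod>i<n. a i) > 0\<close> show False by linarith
    qed
    then show ?thesis using a0[OF that] by simp
  qed
  have "max_volume_ellipsoid n K (ell n Q a v)"
    unfolding max_volume_ellipsoid_def
  proof (intro conjI allI impI)
    show "ellipsoid n (ell n Q a v)" by (rule ellipsoid_ell[OF Q a v])
    fix E assume E: "ellipsoid n E \<and> E \<subseteq> K"
    then obtain P b w where P: "orth_n n P" "\<And>i. i < n \<Longrightarrow> b i > 0" "w \<in> Rn n" "E = ell n P b w"
      using ellipsoid_axes by metis
    obtain q where "q \<in> W" "f q = (\<Prod>i<n. b i)" using inW[of P b w, OF P(1) P(2) P(3)] P(4) E by blast
    then have "(\<Prod>i<n. b i) \<le> (\<Prod>i<n. a i)" using p(2)[of q] by (simp add: f_def pe)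
    then show "vol n E \<le> vol n (ell n Q a v)"
      using vol_unit_ball_pos[of n] sets_ell_vol_ell(2)[of n P b w, OF P(1) P(2) P(3)] sets_ell_vol_ell(2)[of n Q a v, OF Q a v]
      by (simp add: P(4))
  qed (rule EK)
  then show ?thesis using that by blast
qed

text \<open>If \<open>x\<close> lies in the centred copy, then \<open>v + x\<close> and
  \<open>v - x\<close> both lie in the chosen ellipsoid, and \<open>x\<close> is the midpoint of
  \<open>v + x\<close> and \<open>- (v - x)\<close>. Recentring keeps the half-axes, so the volume
  identity with \<open>vr\<close> carries over.\<close>

lemma centered_ellipsoid_vr:
  assumes K: "symmetric_convex_body n K" and n: "n \<ge> 1"
  obtains Q a where "orth_n n Q" "\<And>i. i < n \<Longrightarrow> a i > 0" "ell n Q a (\<lambda>i. 0) \<subseteq> K"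
    "vol n K = vr n K ^ n * ((\<Prod>i<n. a i) * vol n (unit_ball n))" "vr n K \<ge> 1"
proof -
  define E where "E = (SOME E. max_volume_ellipsoid n K E)"
  have "\<exists>E. max_volume_ellipsoid n K E" using max_volume_ellipsoid_exists[OF K] by blast
  then have "max_volume_ellipsoid n K E" unfolding E_def by (rule someI_ex)
  then have E: "ellipsoid n E" "E \<subseteq> K" by (auto simp: max_volume_ellipsoid_def)
  obtain Q a v where Q: "orth_n n Q" and a: "\<And>i. i < n \<Longrightarrow> a i > 0" and v: "v \<in> Rn n"
    and Ee: "E = ell n Q a v" using ellipsoid_axes[OF E(1)] by metis
  have "ell n Q a (\<lambda>i. 0) \<subseteq> K"
  proof
    fix x assume "x \<in> ell n Q a (\<lambda>i. 0)"
    then obtain c where c: "c \<in> unit_ball n" "x = mat_app n Q (\<lambda>i. a i * c i)" by (auto simp: ell_def)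
    have "(\<lambda>i. - c i) \<in> unit_ball n"
      using c(1) norm_n_scale[of n "-1" c] by (simp add: unit_ball_def Rn_iff)
    moreover have "mat_app n Q (\<lambda>i. a i * (- c i)) = (\<lambda>i. - x i)"
      using mat_app_lincomb(2)[of n Q "-1" "\<lambda>i. a i * c i"] by (simp add: c(2))
    ultimately have "(\<lambda>i. v i - x i) \<in> E"
      unfolding Ee ell_def by (intro image_eqI[where x = "\<lambda>i. - c i"]) auto
    then have "(\<lambda>i. v i - x i) \<in> K" using E(2) by blast
    then have 1: "(\<lambda>i. - (v i - x i)) \<in> K" by (rule symmetric_convex_bodyD(5)[OF K])
    have "(\<lambda>i. v i + x i) \<in> E" unfolding Ee ell_def using c by blast
    then have "(\<lambda>i. v i + x i) \<in> K" using E(2) by blast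
    from symmetric_convex_bodyD(4)[OF K this 1, of "1/2"]
    show "x \<in> K" by (simp add: field_simps)
  qed
  define w where "w = (\<Prod>i<n. a i) * vol n (unit_ball n)"
  have w: "vol n E = w" "w > 0"
    using sets_ell_vol_ell(2)[OF Q a v] vol_unit_ball_pos[of n] a by (auto simp: Ee w_def intro!: mult_pos_pos prod_pos)
  have sE: "E \<in> sets (Rborel n)" unfolding Ee by (rule sets_ell_vol_ell(1)[OF Q a v])
  have sK: "K \<in> sets (Rborel n)" by (rule symmetric_convex_bodyD(3)[OF K])
  have fin: "emeasure (leb n) K \<noteq> \<infinity>"
  proof -
    obtain R where R: "R > 0" "\<And>x. x \<in> K \<Longrightarrow> norm_n n x \<le> R" using body_bounded[OF K] by blast
    have "K \<subseteq> cube n R"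
      using R(2) symmetric_convex_bodyD(2)[OF K] norm_n_le_imp_cube by blast
    then have "emeasure (leb n) K \<le> ennreal ((2 * R) ^ n)"
      using emeasure_mono[of K "cube n R" "leb n"] sets_cube emeasure_cube[of R n] R(1) by simp
    then show ?thesis by (auto simp: top_unique)
  qed
  have "vol n E \<le> vol n K"
    unfolding vol_eq_leb[OF sE] vol_eq_leb[OF sK]
    using measure_mono_fmeasurable[of E K "leb n"] E(2) sE sK fin by (simp add: fmeasurable_def less_top)
  then have r: "vol n K / w \<ge> 1" using w by simp
  have vr: "vr n K = (vol n K / w) powr (1 / real n)" unfolding vr_def E_def[symmetric] by (simp add: w)
  have one: "x powr (1 / real n * real n) = x" if "x \<ge> 1" for x :: real using that n by simp
  have "vr n K ^ n = (vol n K / w) powr (1 / real n * real n)"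
    unfolding vr using r by (subst powr_realpow[symmetric]) (auto simp: powr_powr)
  also have "\<dots> = vol n K / w" by (rule one[OF r])
  finally have "vol n K = vr n K ^ n * w" using w by simp
  moreover have "vr n K \<ge> 1" unfolding vr using r by (simp add: ge_one_powr_ge_zero)
  ultimately show ?thesis
    using that[of Q a, OF Q a \<open>ell n Q a (\<lambda>i. 0) \<subseteq> K\<close>] unfolding w_def by blast
qed

subsection \<open>Volume comparison\<close>

text \<open>The ball inside \<open>K\<close> makes the set under the infimum nonempty. The strict
  inequality avoids asking whether the infimum is attained.\<close>

lemma body_norm_less_iff:
  assumes K: "symmetric_convex_body n K" and x: "x \<in> Rn n"
  shows "body_norm K x < t \<longleftrightarrow> (\<exists>s. 0 < s \<and> s < t \<and> (\<lambda>i. x i / s) \<in> K)"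
proof -
  obtain \<epsilon> where \<epsilon>: "\<epsilon> > 0" "\<And>x. x \<in> Rn n \<Longrightarrow> norm_n n x \<le> \<epsilon> \<Longrightarrow> x \<in> K"
    using body_contains_ball[OF K] by blast
  define T where "T = {t. t > 0 \<and> (\<lambda>i. x i / t) \<in> K}"
  define s where "s = (norm_n n x + 1) / \<epsilon>"
  have s: "s > 0" unfolding s_def using \<epsilon>(1) by (intro divide_pos_pos add_nonneg_pos) auto
  have "norm_n n x \<le> \<epsilon> * s" using \<epsilon>(1) by (simp add: s_def)
  then have "norm_n n (\<lambda>i. x i / s) \<le> \<epsilon>" using s by (simp add: norm_n_divide pos_divide_le_eq)
  moreover have "(\<lambda>i. x i / s) \<in> Rn n" using x by (simp add: Rn_iff)
  ultimately have "s \<in> T" using \<epsilon>(2) s by (simp add: T_def)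
  then have "T \<noteq> {}" by blast
  moreover have "bdd_below T" by (rule bdd_belowI[of _ 0]) (simp add: T_def)
  ultimately have "Inf T < t \<longleftrightarrow> (\<exists>s\<in>T. s < t)" by (rule cInf_less_iff)
  then show ?thesis unfolding body_norm_def T_def by auto
qed

lemma body_divide_mono:
  assumes K: "symmetric_convex_body n K" and "0 < s" "s \<le> t" "(\<lambda>i. x i / s) \<in> K"
  shows "(\<lambda>i. x i / t) \<in> K"
proof -
  have "(\<lambda>i. s / t * (x i / s)) \<in> K" using assms by (intro body_shrink[OF K]) auto
  then show ?thesis using assms(2) by simp
qed

text \<open>The upper bound makes the squared norm integrable over the sphere; the positive lower
  bound is what makes \<open>M_body\<close> positive.\<close>

lemma body_norm_bounds:
  assumes K: "symmetric_convex_body n K"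
  obtains c C where "c > 0" "\<And>x. x \<in> unit_sphere n \<Longrightarrow> c \<le> body_norm K x"
    "\<And>x. x \<in> unit_sphere n \<Longrightarrow> body_norm K x \<le> C"
proof -
  obtain \<epsilon> where \<epsilon>: "\<epsilon> > 0" "\<And>x. x \<in> Rn n \<Longrightarrow> norm_n n x \<le> \<epsilon> \<Longrightarrow> x \<in> K"
    using body_contains_ball[OF K] by blast
  obtain R where R: "R > 0" "\<And>x. x \<in> K \<Longrightarrow> norm_n n x \<le> R" using body_bounded[OF K] by blast
  have "1 / R \<le> body_norm K x" if x: "x \<in> unit_sphere n" for x
  proof (rule ccontr)
    assume "\<not> 1 / R \<le> body_norm K x"
    then obtain s where s: "0 < s" "s < 1 / R" "(\<lambda>i. x i / s) \<in> K"
      using body_norm_less_iff[OF K, of x "1 / R"] x by (auto simp: unit_sphere_def)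
    have "1 / s \<le> R" using R(2)[OF s(3)] x s(1) by (simp add: norm_n_divide unit_sphere_def)
    then show False using s R(1) by (simp add: field_simps)
  qed
  moreover have "body_norm K x \<le> 2 / \<epsilon>" if x: "x \<in> unit_sphere n" for x
  proof -
    have "(\<lambda>i. \<epsilon> * x i) \<in> K"
      using x \<epsilon>(1) by (intro \<epsilon>(2)) (auto simp: unit_sphere_def norm_n_scale Rn_iff)
    then have "(\<lambda>i. x i / (1 / \<epsilon>)) \<in> K" by (simp add: mult.commute)
    then have "body_norm K x < 2 / \<epsilon>"
      using body_norm_less_iff[OF K, of x "2 / \<epsilon>"] x \<epsilon>(1)
      by (auto simp: unit_sphere_def intro!: exI[of _ "1 / \<epsilon>"] divide_strict_right_mono)
    then show ?thesis by simp
  qed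
  ultimately show ?thesis using that[of "1 / R" "2 / \<epsilon>"] R(1) by simp
qed

text \<open>Membership of \<open>x / s\<close> in \<open>K\<close> persists when \<open>s\<close>
  grows, so the sets of small norm are unions over rational scales only, a countable family.\<close>

lemma measurable_body_norm:
  assumes K: "symmetric_convex_body n K"
  shows "body_norm K \<in> borel_measurable (Sborel n)"
proof (rule borel_measurableI_less)
  fix t :: real
  have sK: "K \<in> sets (Rborel n)" by (rule symmetric_convex_bodyD(3)[OF K])
  have "{x \<in> space (Sborel n). body_norm K x < t}
      = (\<Union>q\<in>{q\<in>\<rat>. 0 < q \<and> q < t}. {x \<in> space (Sborel n). (\<lambda>i. x i / q) \<in> K})"
  proof (intro equalityI subsetI)
    fix x assume x: "x \<in> {x \<in> space (Sborel n). body_norm K x < t}"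
    then obtain s where s: "0 < s" "s < t" "(\<lambda>i. x i / s) \<in> K"
      using body_norm_less_iff[OF K, of x t] by (auto simp: unit_sphere_def)
    obtain q where q: "q \<in> \<rat>" "s < q" "q < t" using Rats_dense_in_real[OF s(2)] by blast
    then have "(\<lambda>i. x i / q) \<in> K" using body_divide_mono[OF K s(1) _ s(3), of q] by simp
    then show "x \<in> (\<Union>q\<in>{q\<in>\<rat>. 0 < q \<and> q < t}. {x \<in> space (Sborel n). (\<lambda>i. x i / q) \<in> K})"
      using x q s by auto
  next
    fix x assume "x \<in> (\<Union>q\<in>{q\<in>\<rat>. 0 < q \<and> q < t}. {x \<in> space (Sborel n). (\<lambda>i. x i / q) \<in> K})"
    then show "x \<in> {x \<in> space (Sborel n). body_norm K x < t}"
      using body_norm_less_iff[OF K, of x t] by (auto simp: unit_sphere_def)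
  qed
  moreover have "{x \<in> space (Sborel n). (\<lambda>i. x i / q) \<in> K} \<in> sets (Sborel n)" for q
  proof (rule sets_Collect_mem_measurable[OF _ sK])
    show "(\<lambda>x i. x i / q) \<in> measurable (Sborel n) (Rborel n)"
      by (rule measurable_into_Rborel) (auto simp: unit_sphere_def Rn_iff)
  qed
  moreover have "countable {q\<in>\<rat>. 0 < q \<and> q < t}"
    using countable_rat by (rule countable_subset[rotated]) auto
  ultimately show "{x \<in> space (Sborel n). body_norm K x < t} \<in> sets (Sborel n)"
    by (simp only:) (intro sets.countable_UN', auto)
qed

text \<open>Markov's inequality: the multiple \<open>3 M K\<close> of the body contains most of the unit ball.\<close>
lemma ball_portion_in_body:
  assumes K: "symmetric_convex_body n K" and n: "n \<ge> 1"
  defines "M \<equiv> M_body n K"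
  defines "C \<equiv> {x \<in> unit_ball n. (\<lambda>i. x i / (3 * M)) \<in> K}"
  shows "M > 0" "C \<in> sets (Rborel n)" "8 / 9 * vol n (unit_ball n) \<le> vol n C"
proof -
  have sm: "sphere_measure n = sphere_unif n" by (rule sphere_measure_eq[OF n])
  define \<mu> where "\<mu> = sphere_unif n"
  have s: "sets \<mu> = sets (Sborel n)" by (simp add: \<mu>_def sets_sphere_unif)
  have sp: "space \<mu> = unit_sphere n" using sets_eq_imp_space_eq[OF s] by simp
  interpret prob_space \<mu>
    using rotation_invariant_sphere_unif[OF n] by (simp add: rotation_invariant_prob_def \<mu>_def)
  obtain c0 c1 where c: "c0 > 0" "\<And>x. x \<in> unit_sphere n \<Longrightarrow> c0 \<le> body_norm K x"
    "\<And>x. x \<in> unit_sphere n \<Longrightarrow> body_norm K x \<le> c1" using body_norm_bounds[OF K] by blast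
  have "body_norm K \<in> borel_measurable \<mu>"
    using measurable_body_norm[OF K] measurable_cong_sets[OF s refl] by blast
  then have m: "(\<lambda>x. (body_norm K x)\<^sup>2) \<in> borel_measurable \<mu>" by measurable
  have sq: "c0\<^sup>2 \<le> (body_norm K x)\<^sup>2" "(body_norm K x)\<^sup>2 \<le> c1\<^sup>2" if "x \<in> unit_sphere n" for x
    using c(2,3)[OF that] c(1) by (auto intro!: power_mono)
  have int: "integrable \<mu> (\<lambda>x. (body_norm K x)\<^sup>2)"
    by (rule integrable_const_bound[OF _ m, of "c1\<^sup>2"]) (use sq in \<open>auto simp: sp\<close>)
  have "c0\<^sup>2 \<le> (LINT x|\<mu>. (body_norm K x)\<^sup>2)"
    by (rule integral_ge_const[OF int]) (use sq in \<open>auto simp: sp\<close>)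
  then have I: "(LINT x|\<mu>. (body_norm K x)\<^sup>2) > 0" using c(1) by (smt (verit) zero_less_power)
  have M2: "M\<^sup>2 = (LINT x|\<mu>. (body_norm K x)\<^sup>2)"
    using I by (simp add: M_def M_body_def sm \<mu>_def)
  show M: "M > 0" using I by (simp add: M_def M_body_def sm \<mu>_def)
  define B where "B = {x \<in> space \<mu>. (body_norm K x)\<^sup>2 \<ge> 9 * M\<^sup>2}"
  have sB: "B \<in> sets \<mu>" unfolding B_def using m by measurable
  have "prob B \<le> (LINT x|\<mu>. (body_norm K x)\<^sup>2) / (9 * M\<^sup>2)"
    unfolding B_def
    by (rule integral_Markov_inequality_measure[OF int, where A = "{}"]) (use M in auto)
  also have "\<dots> = 1 / 9" using M I by (simp add: M2[symmetric])
  finally have "prob (space \<mu> - B) \<ge> 8 / 9" using sB by (simp add: prob_compl)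
  define G where "G = space \<mu> - B"
  have sG: "G \<in> sets (Sborel n)" using sB s unfolding G_def by (metis sets.compl_sets)
  have sK: "K \<in> sets (Rborel n)" by (rule symmetric_convex_bodyD(3)[OF K])
  have "{x \<in> space (Rborel n). (\<lambda>i. x i / (3 * M)) \<in> K} \<in> sets (Rborel n)"
  proof (rule sets_Collect_mem_measurable[OF _ sK])
    show "(\<lambda>x i. x i / (3 * M)) \<in> measurable (Rborel n) (Rborel n)"
      by (rule measurable_into_Rborel) (auto simp: Rn_iff)
  qed
  moreover have "C = unit_ball n \<inter> {x \<in> space (Rborel n). (\<lambda>i. x i / (3 * M)) \<in> K}"
    by (auto simp: C_def unit_ball_def)
  ultimately show sC: "C \<in> sets (Rborel n)" using sets_unit_ball by simp
  \<comment> \<open>Directions in \<open>G\<close> have norm below \<open>3 * M\<close>, hence lie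
    in \<open>3 * M\<close> times the body, and shrinking them by \<open>r \<le> 1\<close> stays
    there. This converts a bound on the sphere into one for volume in the ball.\<close>
  have "cone_n n G \<subseteq> C"
  proof
    fix x assume x: "x \<in> cone_n n G"
    define r where "r = norm_n n x"
    have r: "0 < r" "r \<le> 1" and xr: "x \<in> Rn n" and g: "(\<lambda>i. x i / r) \<in> G"
      using x by (auto simp: cone_n_def punctured_ball_def r_def)
    have "(body_norm K (\<lambda>i. x i / r))\<^sup>2 < (3 * M)\<^sup>2" using g by (simp add: G_def B_def power_mult_distrib not_le)
    then have "body_norm K (\<lambda>i. x i / r) < 3 * M" by (rule power2_less_imp_less) (use M in simp)
    then obtain t where t: "0 < t" "t < 3 * M" "(\<lambda>i. x i / r / t) \<in> K"
      using body_norm_less_iff[OF K, of "\<lambda>i. x i / r" "3 * M"] xr by (auto simp: Rn_iff)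
    have "(\<lambda>i. x i / r / (3 * M)) \<in> K" using body_divide_mono[OF K t(1) _ t(3), of "3 * M"] t by simp
    from body_shrink[OF K this, of r] r have "(\<lambda>i. x i / (3 * M)) \<in> K" by simp
    then show "x \<in> C" using xr r by (simp add: C_def unit_ball_def r_def)
  qed
  then have le: "emeasure (leb n) (cone_n n G) \<le> emeasure (leb n) C"
    using sC by (intro emeasure_mono) auto
  have fb: "emeasure (leb n) (unit_ball n) \<noteq> 0" "emeasure (leb n) (unit_ball n) \<noteq> \<infinity>"
    by (rule emeasure_unit_ball)+
  have "emeasure (leb n) C \<le> emeasure (leb n) (unit_ball n)"
    using sets_unit_ball by (intro emeasure_mono) (auto simp: C_def)
  then have fC: "emeasure (leb n) C < \<infinity>" using fb(2) by (simp add: less_top top_unique le_less_trans)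
  have fcone: "emeasure (leb n) (cone_n n G) < \<infinity>" using le fC by (rule le_less_trans)
  have vp: "measure (leb n) (unit_ball n) > 0"
    using vol_unit_ball_pos[of n] by (simp add: vol_eq_leb[OF sets_unit_ball])
  have "emeasure (leb n) (cone_n n G) = ennreal (measure (leb n) (cone_n n G))"
    by (rule emeasure_eq_ennreal_measure) (use fcone in auto)
  moreover have "emeasure (leb n) (unit_ball n) = ennreal (measure (leb n) (unit_ball n))"
    by (rule emeasure_eq_ennreal_measure) (use fb in auto)
  ultimately have "emeasure \<mu> G = ennreal (measure (leb n) (cone_n n G) / measure (leb n) (unit_ball n))"
    using emeasure_sphere_unif[OF n sG] vp by (simp add: \<mu>_def divide_ennreal)
  then have "prob G = measure (leb n) (cone_n n G) / measure (leb n) (unit_ball n)"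
    by (simp add: measure_def)
  then have "8 / 9 * measure (leb n) (unit_ball n) \<le> measure (leb n) (cone_n n G)"
    using vp \<open>prob (space \<mu> - B) \<ge> 8 / 9\<close> by (simp add: G_def[symmetric] pos_le_divide_eq)
  also have "\<dots> \<le> measure (leb n) C"
    unfolding measure_def using le fC by (intro enn2real_mono) auto
  finally show "8 / 9 * vol n (unit_ball n) \<le> vol n C"
    by (simp add: vol_eq_leb[OF sets_unit_ball] vol_eq_leb[OF sC])
qed

text \<open>The map \<open>x \<mapsto> x + M T x\<close>, where \<open>T\<close> is the positive map with \<open>T D = E \<subseteq> K\<close>, sends the
  part of the ball inside \<open>3 M K\<close> into \<open>4 M K\<close>; compare volumes.\<close>
lemma half_axes_product_bound:
  assumes K: "symmetric_convex_body n K" and n: "n \<ge> 1"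
    and Q: "orth_n n Q" and a: "\<And>i. i < n \<Longrightarrow> a i > 0" and E: "ell n Q a (\<lambda>i. 0) \<subseteq> K"
    and A: "vol n K = A ^ n * ((\<Prod>i<n. a i) * vol n (unit_ball n))" "A \<ge> 1"
  shows "M_body n K > 0" "(\<Prod>i<n. 1 + 1 / (M_body n K * a i)) \<le> (5 * A) ^ n"
proof -
  define M where "M = M_body n K"
  define C where "C = {x \<in> unit_ball n. (\<lambda>i. x i / (3 * M)) \<in> K}"
  have M: "M > 0" and sC: "C \<in> sets (Rborel n)" and vC: "8 / 9 * vol n (unit_ball n) \<le> vol n C"
    using ball_portion_in_body[OF K n] by (simp_all add: M_def C_def)
  show "M_body n K > 0" using M by (simp add: M_def)
  \<comment> \<open>The eigenvalues of \<open>x + M T x\<close> divided by \<open>4 * M\<close>, in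
    the axes of the ellipsoid.\<close>
  define b where "b i = (1 + M * a i) / (4 * M)" for i
  have b: "b i > 0" if "i < n" for i using a[OF that] M by (auto simp: b_def intro!: divide_pos_pos add_pos_pos)
  have sK: "K \<in> sets (Rborel n)" by (rule symmetric_convex_bodyD(3)[OF K])
  have z: "(\<lambda>i. 0) \<in> Rn n" by (simp add: Rn_iff)
  \<comment> \<open>The preimage of \<open>K\<close> under this map is \<open>K3\<close>. It is
    formed in three stages, rotation, scaling and rotation back, so that each volume factor is
    known.\<close>
  define K1 where "K1 = {y \<in> Rn n. mat_app n Q y \<in> K}"
  define K2 where "K2 = {y \<in> Rn n. (\<lambda>i. 0 + b i * y i) \<in> K1}"
  define K3 where "K3 = {x \<in> Rn n. mat_app n (transp Q) x \<in> K2}"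
  have s1: "K1 \<in> sets (Rborel n)"
    using sets_Collect_mem_measurable[OF measurable_mat_app sK] by (simp add: K1_def)
  have s2: "K2 \<in> sets (Rborel n)"
    using sets_Collect_mem_measurable[OF measurable_affine_Rborel[OF z] s1] by (simp add: K2_def)
  have s3: "K3 \<in> sets (Rborel n)"
    using sets_Collect_mem_measurable[OF measurable_mat_app s2] by (simp add: K3_def)
  have e31: "emeasure (leb n) K3 = emeasure (leb n) K2"
    unfolding K3_def by (rule emeasure_leb_orth[OF orthogonal_mat_transpose[OF Q] s2])
  have e1: "emeasure (leb n) K1 = emeasure (leb n) K"
    unfolding K1_def by (rule emeasure_leb_orth[OF Q sK])
  have "emeasure (leb n) K1 = (\<Prod>i<n. ennreal \<bar>b i\<bar>) * emeasure (leb n) K2"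
    unfolding K2_def by (rule emeasure_leb_affine[OF _ z s1]) (use b in force)
  also have "(\<Prod>i<n. ennreal \<bar>b i\<bar>) = ennreal (\<Prod>i<n. b i)"
    using b by (subst prod_ennreal[symmetric]) (auto simp: less_imp_le intro!: prod.cong)
  finally have e: "emeasure (leb n) K = ennreal (\<Prod>i<n. b i) * emeasure (leb n) K3" by (simp add: e1 e31)
  have pb: "(\<Prod>i<n. b i) > 0" using b by (intro prod_pos) auto
  then have vK: "vol n K = (\<Prod>i<n. b i) * vol n K3"
    using e by (simp add: vol_eq_leb[OF sK] vol_eq_leb[OF s3] measure_def enn2real_mult)
  have "C \<subseteq> K3"
  proof
    fix x assume x: "x \<in> C"
    then have xr: "x \<in> Rn n" and x1: "norm_n n x \<le> 1" and xK: "(\<lambda>i. x i / (3 * M)) \<in> K"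
      by (auto simp: C_def unit_ball_def)
    define y where "y = mat_app n (transp Q) x"
    have y: "y \<in> Rn n" "norm_n n y \<le> 1" "mat_app n Q y = x"
      using mat_app_Rn norm_n_mat_app_orth[OF orthogonal_mat_transpose[OF Q] xr] x1 mat_app_transp_cancel(2)[OF Q xr]
      by (simp_all add: y_def)
    have "mat_app n Q (\<lambda>i. a i * y i) \<in> K"
      using E y by (auto simp: ell_def unit_ball_def)
    from body_combine[OF K xK this, of "3 * M" M] M
    have "(\<lambda>i. (3 * M * (x i / (3 * M)) + M * mat_app n Q (\<lambda>i. a i * y i) i) / (3 * M + M)) \<in> K" by simp
    moreover have "mat_app n Q (\<lambda>i. b i * y i)
        = (\<lambda>i. (3 * M * (x i / (3 * M)) + M * mat_app n Q (\<lambda>i. a i * y i) i) / (3 * M + M))"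
    proof -
      have "mat_app n Q (\<lambda>i. b i * y i) = mat_app n Q (\<lambda>i. 1 / (4 * M) * (y i + M * (a i * y i)))"
        by (rule arg_cong[where f = "mat_app n Q"]) (use M in \<open>simp add: b_def fun_eq_iff field_simps\<close>)
      also have "\<dots> = (\<lambda>i. 1 / (4 * M) * (mat_app n Q y i + M * mat_app n Q (\<lambda>i. a i * y i) i))"
        unfolding mat_app_lincomb ..
      finally show ?thesis using M by (simp add: y(3) fun_eq_iff)
    qed
    ultimately have "mat_app n Q (\<lambda>i. b i * y i) \<in> K" by simp
    moreover have "(\<lambda>i. b i * y i) \<in> Rn n" using y(1) by (simp add: Rn_iff)
    ultimately have "y \<in> K2" using y(1) by (simp add: K2_def K1_def)
    then show "x \<in> K3" using xr by (simp add: K3_def y_def)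
  qed
  have w: "vol n (unit_ball n) > 0" by (rule vol_unit_ball_pos)
  have pa: "(\<Prod>i<n. a i) > 0" using a by (intro prod_pos) auto
  \<comment> \<open>If this were infinite, \<open>measure\<close> would return 0 by convention, and
    the volume of \<open>K\<close> would be 0.\<close>
  have "emeasure (leb n) K3 \<noteq> \<infinity>"
  proof
    assume "emeasure (leb n) K3 = \<infinity>"
    then have "vol n K3 = 0" by (simp add: vol_eq_leb[OF s3] measure_def)
    then have "vol n K = 0" by (simp add: vK)
    moreover have "A ^ n * ((\<Prod>i<n. a i) * vol n (unit_ball n)) > 0"
      using A(2) w pa by (intro mult_pos_pos) auto
    ultimately show False using A(1) by linarith
  qed
  then have "vol n C \<le> vol n K3"
    unfolding vol_eq_leb[OF sC] vol_eq_leb[OF s3] using \<open>C \<subseteq> K3\<close> sC s3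
    by (intro measure_mono_fmeasurable) (auto simp: fmeasurable_def less_top)
  then have "(\<Prod>i<n. b i) * (8 / 9 * vol n (unit_ball n)) \<le> A ^ n * (\<Prod>i<n. a i) * vol n (unit_ball n)"
    using vC pb A(1) vK by (smt (verit) mult.assoc mult_left_mono)
  then have 1: "(\<Prod>i<n. b i) * (8 / 9) \<le> A ^ n * (\<Prod>i<n. a i)" using w by simp
  have "(\<Prod>i<n. b i) = (\<Prod>i<n. (1 / 4) * a i * (1 + 1 / (M * a i)))"
  proof (intro prod.cong refl)
    fix i assume "i \<in> {..<n}"
    then have "a i > 0" using a by simp
    then show "b i = (1 / 4) * a i * (1 + 1 / (M * a i))" using M by (simp add: b_def field_simps)
  qed
  also have "\<dots> = (1 / 4) ^ n * (\<Prod>i<n. a i) * (\<Prod>i<n. 1 + 1 / (M * a i))"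
    unfolding prod.distrib by (simp add: power_one_over)
  finally have "(1 / 4) ^ n * (\<Prod>i<n. 1 + 1 / (M * a i)) * (8 / 9) * (\<Prod>i<n. a i) \<le> A ^ n * (\<Prod>i<n. a i)"
    using 1 by (simp add: mult_ac)
  then have "(1 / 4) ^ n * (\<Prod>i<n. 1 + 1 / (M * a i)) * (8 / 9) \<le> A ^ n" using pa by (simp only: mult_le_cancel_right_pos)
  then have "(\<Prod>i<n. 1 + 1 / (M * a i)) \<le> 9 / 8 * 4 ^ n * A ^ n"
    by (simp add: power_divide field_simps)
  \<comment> \<open>Source of the constant 5: the 4 comes from \<open>4 M K\<close>, and the factor
    \<open>9 / 8\<close> of the Markov estimate is absorbed once \<open>n \<ge> 1\<close>.\<close>
  also have "\<dots> \<le> 5 ^ n * A ^ n"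
  proof (rule mult_right_mono)
    show "9 / 8 * 4 ^ n \<le> (5::real) ^ n"
      using n
    proof (induction n rule: dec_induct)
      case (step m)
      have "9 / 8 * 4 ^ Suc m = 4 * (9 / 8 * 4 ^ m :: real)" by simp
      also have "\<dots> \<le> 5 * 5 ^ m" using step.IH by (intro mult_mono) auto
      finally show ?case by simp
    qed simp
  qed (use A(2) in simp)
  finally show "(\<Prod>i<n. 1 + 1 / (M_body n K * a i)) \<le> (5 * A) ^ n"
    by (simp add: M_def power_mult_distrib)
qed

subsection \<open>Projections onto coordinate subspaces\<close>

definition basis_mat :: "(nat \<Rightarrow> nat \<Rightarrow> real) \<Rightarrow> nat \<Rightarrow> nat \<Rightarrow> real" where
  "basis_mat e = (\<lambda>i j. e j i)"

lemma orth_n_basis_mat: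
  assumes "orthonormal_basis n e"
  shows "orth_n n (basis_mat e)"
proof (rule orthonormal_columns_imp_orth_n)
  fix j k assume "j < n" "k < n"
  then show "(\<Sum>i<n. basis_mat e i j * basis_mat e i k) = (if j = k then 1 else 0)"
    using assms by (simp add: basis_mat_def orthonormal_basis_def inner_n_def)
qed

text \<open>The columns of \<open>Q\<close> indexed by \<open>J\<close> span a subspace \<open>G\<close>; any \<open>x\<close> supported off \<open>\<tau>\<close> can be
  moved into the orthogonal complement of \<open>G\<close> by a vector \<open>y\<close> supported on \<open>\<tau>\<close>.\<close>
lemma coordinate_correction:
  assumes e: "orthonormal_basis n e" and Q: "orth_n n Q" and J: "J \<subseteq> {..<n}"
    and \<theta>: "0 < \<theta>" "\<theta> < 1" and card: "real (card J) \<le> \<theta> * n / 4"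
  obtains \<tau> where "\<tau> \<subseteq> {..<n}" "real (card \<tau>) \<le> \<theta> * n"
    "\<And>x. x \<in> Rn n \<Longrightarrow> (\<And>j. j \<in> \<tau> \<Longrightarrow> inner_n n x (e j) = 0) \<Longrightarrow>
      \<exists>y\<in>Rn n. (\<forall>j<n. j \<notin> \<tau> \<longrightarrow> inner_n n y (e j) = 0) \<and>
        (\<forall>i\<in>J. mat_app n (transp Q) (\<lambda>i. x i + y i) i = 0) \<and>
        inner_n n (\<lambda>i. x i + y i) (\<lambda>i. x i + y i) \<le> (1 + 4 / \<theta>) * inner_n n x x"
proof (cases "J = {}")
  case True
  have "\<exists>y\<in>Rn n. (\<forall>j<n. j \<notin> {} \<longrightarrow> inner_n n y (e j) = 0) \<and>
        (\<forall>i\<in>J. mat_app n (transp Q) (\<lambda>i. x i + y i) i = 0) \<and>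
        inner_n n (\<lambda>i. x i + y i) (\<lambda>i. x i + y i) \<le> (1 + 4 / \<theta>) * inner_n n x x" for x
  proof (rule bexI[of _ "\<lambda>i. 0"])
    have "1 * inner_n n x x \<le> (1 + 4 / \<theta>) * inner_n n x x"
      using \<theta> by (intro mult_right_mono) auto
    then show "(\<forall>j<n. j \<notin> {} \<longrightarrow> inner_n n (\<lambda>i. 0) (e j) = 0) \<and>
        (\<forall>i\<in>J. mat_app n (transp Q) (\<lambda>i. x i + 0) i = 0) \<and>
        inner_n n (\<lambda>i. x i + 0) (\<lambda>i. x i + 0) \<le> (1 + 4 / \<theta>) * inner_n n x x"
      using True by simp
  qed (simp add: Rn_iff)
  then show ?thesis using that[of "{}"] \<theta> by simp
next
  case ne: False
  have fJ: "finite J" using J finite_subset by blast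
  define k where "k = card J"
  have k: "k \<ge> 1" using ne fJ by (simp add: k_def Suc_le_eq card_gt_0_iff)
  \<comment> \<open>Row \<open>j\<close> holds the components along \<open>e j\<close> of the
    columns of \<open>Q\<close>. Restricting vectors of the span of the \<open>J\<close> columns to
    the coordinates \<open>\<tau>\<close> means keeping the rows in \<open>\<tau>\<close>.\<close>
  define w where "w j i = inner_n n (e j) (\<lambda>r. Q r i)" for j i
  have W: "orth_n n (\<lambda>i j. \<Sum>r<n. Q r i * basis_mat e r j)"
    by (rule orthogonal_mat_mult[OF _ orthogonal_mat_transpose[OF Q] orth_n_basis_mat[OF e]]) simp
  have wW: "w j i = (\<Sum>r<n. Q r i * basis_mat e r j)" for j i
    by (simp add: w_def inner_n_def basis_mat_def mult.commute)
  have frame: "(\<Sum>j<n. w j a * w j b) = (if a = b then 1 else 0)" if "a \<in> J" "b \<in> J" for a b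
  proof -
    have "a \<in> {..<n}" "b \<in> {..<n}" using that J by auto
    from orthogonal_matD(1)[OF W this] show ?thesis by (simp add: wW)
  qed
  define m where "m = nat \<lfloor>\<theta> * n\<rfloor>"
  have \<theta>n: "\<theta> * n \<ge> 4 * k" using card by (simp add: k_def)
  then have "real m = of_int \<lfloor>\<theta> * n\<rfloor>" using \<theta> by (simp add: m_def)
  then have m: "real m \<le> \<theta> * n" "\<theta> * n < real m + 1" by linarith+
  have "\<theta> * real n \<le> 1 * real n" using \<theta> by (intro mult_right_mono) auto
  then have mn: "m \<le> n" using m by linarith
  have m2: "2 * card J \<le> m" using m \<theta>n k by (simp add: k_def)
  obtain \<tau> P \<mu> where \<tau>: "\<tau> \<subseteq> {..<n}" "card \<tau> = m" and P: "orthogonal_mat J P"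
    and fd: "frame_diag J \<tau> (\<lambda>i a. \<Sum>b\<in>J. P a b * w i b) \<mu>"
    and \<mu>: "\<And>a. a \<in> J \<Longrightarrow> \<mu> a > (real m - 2 * card J + 1) / (2 * (real n - 2 * card J + 1))"
    using coordinate_subset_selection[OF fJ ne frame m2 mn] by blast
  have f\<tau>: "finite \<tau>" using \<tau>(1) finite_subset by blast
  have \<mu>4: "\<mu> a > \<theta> / 4" if "a \<in> J" for a
  proof -
    have n2: "real n - 2 * k + 1 > 0" using mn m2 by (simp add: k_def)
    \<comment> \<open>From \<open>\<theta> * n < m + 1\<close> and
      \<open>4 * k \<le> \<theta> * n\<close> one gets
      \<open>\<theta> * n \<le> 2 * (m - 2 * k + 1)\<close>. This is why the number of short axes is
      kept below \<open>\<theta> * n / 4\<close>.\<close>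
    have "\<theta> / 4 \<le> (real m - 2 * k + 1) / (2 * (real n - 2 * k + 1))"
    proof -
      have "\<theta> * (real n - 2 * k + 1) \<le> \<theta> * n" using \<theta> k by (intro mult_left_mono) auto
      also have "\<dots> \<le> 2 * (real m - 2 * k + 1)"
      proof -
        have "t \<le> 2 * (a - 2 * b + 1)" if "t < a + 1" "4 * b \<le> t" for a b t :: real
          using that by argo
        from this[OF m(2), of k] \<theta>n show ?thesis by simp
      qed
      finally have le: "\<theta> * (real n - 2 * k + 1) \<le> 2 * (real m - 2 * k + 1)" .
      have "\<theta> / 4 \<le> Y / (2 * X)" if "\<theta> * X \<le> 2 * Y" "X > 0" for X Y :: real
        using that by (simp add: pos_le_divide_eq)
      from this[OF le n2] show ?thesis .
    qed
    then show ?thesis using \<mu>[OF that, folded k_def] by (rule le_less_trans)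
  qed
  have eR: "e j \<in> Rn n" and ee: "\<And>i. i < n \<Longrightarrow> inner_n n (e j) (e i) = (if j = i then 1 else 0)" if "j < n" for j
    using e that by (auto simp: orthonormal_basis_def)
  have "\<exists>y\<in>Rn n. (\<forall>j<n. j \<notin> \<tau> \<longrightarrow> inner_n n y (e j) = 0) \<and>
        (\<forall>i\<in>J. mat_app n (transp Q) (\<lambda>i. x i + y i) i = 0) \<and>
        inner_n n (\<lambda>i. x i + y i) (\<lambda>i. x i + y i) \<le> (1 + 4 / \<theta>) * inner_n n x x"
    if x: "x \<in> Rn n" and x0: "\<And>j. j \<in> \<tau> \<Longrightarrow> inner_n n x (e j) = 0" for x
  proof -
    \<comment> \<open>\<open>y\<close> is the least norm vector on \<open>\<tau>\<close> that
      cancels the components of \<open>x\<close> along the \<open>J\<close> columns. In the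
      eigenbasis the normal equations are diagonal, so their solution is
      \<open>- \<beta> a / \<mu> a\<close>, and the squared norm of \<open>y\<close> is the sum of
      \<open>(\<beta> a)\<^sup>2 / \<mu> a\<close>.\<close>
    define z where "z j a = (\<Sum>b\<in>J. P a b * w j b)" for j a
    define \<beta> where "\<beta> a = (\<Sum>b\<in>J. P a b * mat_app n (transp Q) x b)" for a
    define c where "c a = - \<beta> a / \<mu> a" for a
    define s where "s j = (\<Sum>a\<in>J. c a * z j a)" for j
    define y where "y = (\<lambda>i. \<Sum>j\<in>\<tau>. s j * e j i)"
    have zz: "(\<Sum>j\<in>\<tau>. z j a * z j b) = (if a = b then \<mu> a else 0)" if "a \<in> J" "b \<in> J" for a b
      using frame_diagD[OF fd that] by (simp add: z_def)
    have sz: "(\<Sum>j\<in>\<tau>. s j * z j a) = - \<beta> a" if a: "a \<in> J" for a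
    proof -
      have "(\<Sum>j\<in>\<tau>. s j * z j a) = (\<Sum>b\<in>J. \<Sum>j\<in>\<tau>. c b * (z j b * z j a))"
        unfolding s_def sum_distrib_right by (subst sum.swap) (simp add: mult.assoc)
      also have "\<dots> = (\<Sum>b\<in>J. if b = a then c a * \<mu> a else 0)"
        using a by (intro sum.cong refl) (simp add: sum_distrib_left[symmetric] zz)
      also have "\<dots> = - \<beta> a" using a fJ \<mu>4[OF a] \<theta> by (simp add: c_def)
      finally show ?thesis .
    qed
    have yR: "y \<in> Rn n" using eR \<tau>(1) by (auto simp: y_def Rn_iff intro!: sum.neutral)
    have ye: "inner_n n y (e i) = (if i \<in> \<tau> then s i else 0)" if i: "i < n" for i
    proof -
      have "inner_n n y (e i) = (\<Sum>j\<in>\<tau>. s j * (if j = i then 1 else 0))"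
        unfolding y_def inner_n_sum using \<tau>(1) ee i by (intro sum.cong refl) auto
      then show ?thesis using f\<tau> by (simp add: indicator_mult_simps)
    qed
    have Qy: "mat_app n (transp Q) y b = (\<Sum>j\<in>\<tau>. s j * w j b)" if "b \<in> J" for b
    proof -
      have "mat_app n (transp Q) y b = inner_n n y (\<lambda>r. Q r b)"
        using that J by (auto simp: mat_app_def inner_n_def mult.commute)
      then show ?thesis by (simp add: y_def inner_n_sum w_def)
    qed
    have zero: "mat_app n (transp Q) (\<lambda>i. x i + y i) i = 0" if i: "i \<in> J" for i
    proof -
      define u where "u b = mat_app n (transp Q) (\<lambda>i. x i + y i) b" for b
      have "(\<Sum>b\<in>J. P a b * u b) = 0" if a: "a \<in> J" for a
      proof -
        have "(\<Sum>b\<in>J. P a b * u b) = \<beta> a + (\<Sum>b\<in>J. P a b * (\<Sum>j\<in>\<tau>. s j * w j b))"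
          by (simp add: u_def mat_app_lincomb distrib_left sum.distrib \<beta>_def Qy)
        also have "(\<Sum>b\<in>J. P a b * (\<Sum>j\<in>\<tau>. s j * w j b)) = (\<Sum>j\<in>\<tau>. s j * z j a)"
          unfolding z_def sum_distrib_left by (subst sum.swap) (simp add: mult.left_commute)
        finally show ?thesis using sz[OF a] by simp
      qed
      then have "(\<Sum>a\<in>J. (\<Sum>b\<in>J. P a b * u b) * P a i) = 0" by simp
      then show ?thesis using orthogonal_mat_expansion[OF fJ P i, of u] by (simp add: u_def)
    qed
    have xy: "inner_n n x y = 0" unfolding y_def inner_n_sum using x0 by simp
    have "inner_n n y y = (\<Sum>j\<in>\<tau>. s j * inner_n n y (e j))"
      by (subst (2) y_def) (rule inner_n_sum(2))
    also have "\<dots> = (\<Sum>j\<in>\<tau>. s j * s j)"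
      using \<tau>(1) ye by (intro sum.cong refl) auto
    also have "\<dots> = (\<Sum>j\<in>\<tau>. \<Sum>a\<in>J. c a * (s j * z j a))"
      by (intro sum.cong refl) (subst (2) s_def, simp add: sum_distrib_left mult.left_commute)
    also have "\<dots> = (\<Sum>a\<in>J. c a * (\<Sum>j\<in>\<tau>. s j * z j a))"
      unfolding sum_distrib_left by (rule sum.swap)
    also have "\<dots> = (\<Sum>a\<in>J. (\<beta> a)\<^sup>2 / \<mu> a)"
      by (intro sum.cong refl) (simp add: sz c_def power2_eq_square)
    also have "\<dots> \<le> (\<Sum>a\<in>J. (4 / \<theta>) * (\<beta> a)\<^sup>2)"
    proof (rule sum_mono)
      fix a assume a: "a \<in> J"
      have "(\<beta> a)\<^sup>2 / \<mu> a \<le> (\<beta> a)\<^sup>2 / (\<theta> / 4)"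
        using \<mu>4[OF a] \<theta> by (intro divide_left_mono mult_pos_pos) auto
      then show "(\<beta> a)\<^sup>2 / \<mu> a \<le> (4 / \<theta>) * (\<beta> a)\<^sup>2" by (simp add: mult.commute)
    qed
    also have "\<dots> = (4 / \<theta>) * (\<Sum>b\<in>J. (mat_app n (transp Q) x b)\<^sup>2)"
      unfolding sum_distrib_left[symmetric] \<beta>_def orthogonal_mat_parseval[OF fJ P] ..
    also have "\<dots> \<le> (4 / \<theta>) * (\<Sum>b<n. (mat_app n (transp Q) x b)\<^sup>2)"
      using J \<theta> by (intro mult_left_mono sum_mono2) auto
    also have "(\<Sum>b<n. (mat_app n (transp Q) x b)\<^sup>2) = inner_n n x x"
      using norm_n_mat_app_orth[OF orthogonal_mat_transpose[OF Q] x]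
      by (simp add: norm_n_sq_sum[symmetric] norm_n_sq[symmetric])
    finally have yy: "inner_n n y y \<le> (4 / \<theta>) * inner_n n x x" .
    have "inner_n n (\<lambda>i. x i + y i) (\<lambda>i. x i + y i) = inner_n n x x + inner_n n y y"
      by (simp add: inner_n_add xy inner_n_commute[of n y x])
    also have "\<dots> \<le> (1 + 4 / \<theta>) * inner_n n x x" using yy by (simp add: algebra_simps)
    finally show ?thesis using yR ye zero by (intro bexI[of _ y]) auto
  qed
  then show ?thesis using that[of \<tau>] \<tau> m(1) by simp
qed

section \<open>Assembly: identifying the projection, counting short axes, fixing the
  constants\<close>

lemma orth_proj_eqI:
  assumes "y \<in> coord_subspace n e \<sigma>" "\<And>z. z \<in> coord_subspace n e \<sigma> \<Longrightarrow> inner_n n (\<lambda>i. x i - y i) z = 0"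
  shows "orth_proj n (coord_subspace n e \<sigma>) x = y"
  unfolding orth_proj_def
proof (rule the_equality)
  show "y \<in> coord_subspace n e \<sigma> \<and> (\<forall>z\<in>coord_subspace n e \<sigma>. inner_n n (\<lambda>i. x i - y i) z = 0)"
    using assms by blast
  fix y' assume y': "y' \<in> coord_subspace n e \<sigma> \<and> (\<forall>z\<in>coord_subspace n e \<sigma>. inner_n n (\<lambda>i. x i - y' i) z = 0)"
  define d where "d = (\<lambda>i. y' i - y i)"
  have d: "d \<in> coord_subspace n e \<sigma>"
    using assms(1) y' by (auto simp: coord_subspace_def d_def Rn_iff inner_n_add)
  have "inner_n n (\<lambda>i. x i - y i) d = 0" "inner_n n (\<lambda>i. x i - y' i) d = 0" using assms(2) y' d by auto
  then have "inner_n n y' d - inner_n n y d = 0" by (simp add: inner_n_add)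
  then have "inner_n n d d = 0" by (subst (1) d_def) (simp add: inner_n_add)
  moreover have "d \<in> Rn n" using d by (simp add: coord_subspace_def)
  ultimately have "d = (\<lambda>i. 0)" using norm_n_eq_0_iff[of d n] by (simp add: norm_n_def)
  then show "y' = y" by (simp add: d_def fun_eq_iff)
qed

text \<open>Every short axis contributes a factor of at least \<open>B powr (4 / \<theta>)\<close>
  to the product and every other axis a factor of at least 1. Comparing exponents of
  \<open>B\<close> bounds their number.\<close>

lemma few_short_half_axes:
  fixes a :: "nat \<Rightarrow> real"
  assumes a: "\<And>i. i < n \<Longrightarrow> a i > 0" and M: "M > 0" and B: "B > 1" and \<theta>: "0 < \<theta>"
    and bound: "(\<Prod>i<n. 1 + 1 / (M * a i)) \<le> B ^ n"
  shows "real (card {i. i < n \<and> a i < 1 / (B powr (4 / \<theta>) * M)}) \<le> \<theta> * n / 4"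
proof -
  define J where "J = {i. i < n \<and> a i < 1 / (B powr (4 / \<theta>) * M)}"
  have J: "J \<subseteq> {..<n}" by (auto simp: J_def)
  have pos: "1 / (M * a i) > 0" if "i < n" for i using M a[OF that] by simp
  have L: "B powr (4 / \<theta>) > 0" using B by simp
  have "B powr (4 / \<theta> * card J) = (B powr (4 / \<theta>)) powr (card J)" by (simp add: powr_powr)
  also have "\<dots> = (\<Prod>i\<in>J. B powr (4 / \<theta>))" using L by (simp add: powr_realpow)
  also have "\<dots> \<le> (\<Prod>i\<in>J. 1 + 1 / (M * a i))"
  proof (rule prod_mono)
    fix i assume "i \<in> J"
    then have i: "i < n" "a i < 1 / (B powr (4 / \<theta>) * M)" by (auto simp: J_def)
    have "B powr (4 / \<theta>) * (M * a i) < 1"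
      using i(2) L M by (simp add: pos_less_divide_eq mult_ac)
    then have "B powr (4 / \<theta>) \<le> 1 / (M * a i)" using M a[OF i(1)] by (simp add: pos_le_divide_eq)
    then show "0 \<le> B powr (4 / \<theta>) \<and> B powr (4 / \<theta>) \<le> 1 + 1 / (M * a i)" by simp
  qed
  also have "\<dots> \<le> (\<Prod>i<n. 1 + 1 / (M * a i))"
    using J pos by (intro prod_mono2) (auto simp: less_imp_le intro: add_nonneg_nonneg)
  also have "\<dots> \<le> B powr n" using bound B by (simp add: powr_realpow)
  finally have "4 / \<theta> * card J \<le> n" using B by simp
  then show ?thesis using \<theta> by (simp add: J_def field_simps)
qed

text \<open>The exponents differ by at least \<open>2 * L\<close> with
  \<open>L = ln (2 / \<theta>)\<close>, and the base exceeds e, so the quotient is at most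
  \<open>exp (- 2 * L) = \<theta>\<^sup>2 / 4\<close>. Its square outweighs
  \<open>1 + 4 / \<theta>\<close>.\<close>

lemma radius_bound:
  fixes A \<theta> :: real
  assumes A: "A \<ge> 1" and \<theta>: "0 < \<theta>" "\<theta> < 1"
  shows "(((5 * A) powr (4 / \<theta>)) / ((5 * A) powr (8 * ln (2 / \<theta>) / \<theta>)))\<^sup>2 * (1 + 4 / \<theta>) \<le> 1"
proof -
  define L where "L = ln (2 / \<theta>)"
  have "ln 2 \<le> L" unfolding L_def using \<theta> by (subst ln_le_cancel_iff) (auto simp: field_simps)
  then have L: "L \<ge> 2 / 3" using ln2_ge_two_thirds by linarith
  have "2 * L * \<theta> \<le> 2 * L * 1" using \<theta> L by (intro mult_left_mono) auto
  then have "2 * L \<le> 2 * L / \<theta>" using \<theta> by (simp add: pos_le_divide_eq)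
  \<comment> \<open>This amounts to \<open>6 * L \<ge> 4\<close>, exactly the bound
    \<open>L \<ge> 2 / 3\<close> obtained from \<open>ln 2\<close>; the constant 8 leaves just this
    much room.\<close>
  also have "\<dots> \<le> (8 * L - 4) / \<theta>" using \<theta> L by (intro divide_right_mono) auto
  finally have ex: "2 * L \<le> 8 * L / \<theta> - 4 / \<theta>" by (simp add: diff_divide_distrib)
  have "exp (2 * L) = (2 / \<theta>) * (2 / \<theta>)"
    using \<theta> by (simp add: L_def exp_double power2_eq_square)
  also have "\<dots> = 4 / \<theta>\<^sup>2" by (simp add: power2_eq_square)
  finally have e: "exp (2 * L) = 4 / \<theta>\<^sup>2" .
  have "exp (2 * L) = exp 1 powr (2 * L)" by (simp add: powr_def)
  also have "\<dots> \<le> (5 * A) powr (2 * L)" using exp_le A L by (intro powr_mono2) auto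
  also have "\<dots> \<le> (5 * A) powr (8 * L / \<theta> - 4 / \<theta>)" using ex A by (intro powr_mono) auto
  finally have g: "4 / \<theta>\<^sup>2 \<le> (5 * A) powr (8 * L / \<theta> - 4 / \<theta>)" by (simp add: e)
  define R where "R = (5 * A) powr (4 / \<theta>) / (5 * A) powr (8 * L / \<theta>)"
  have "R = 1 / (5 * A) powr (8 * L / \<theta> - 4 / \<theta>)"
    using A by (simp add: R_def powr_diff)
  also have "\<dots> \<le> 1 / (4 / \<theta>\<^sup>2)" using g \<theta> by (intro divide_left_mono mult_pos_pos) auto
  finally have "R \<le> \<theta>\<^sup>2 / 4" by simp
  moreover have "R \<ge> 0" by (simp add: R_def)
  ultimately have "R\<^sup>2 \<le> (\<theta>\<^sup>2 / 4)\<^sup>2" by (intro power_mono)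
  then have "R\<^sup>2 * (1 + 4 / \<theta>) \<le> (\<theta>\<^sup>2 / 4)\<^sup>2 * (1 + 4 / \<theta>)" using \<theta> by (intro mult_right_mono) auto
  also have "\<dots> = (\<theta> ^ 4 + 4 * \<theta> ^ 3) / 16" using \<theta> by (simp add: field_simps power2_eq_square power4_eq_xxxx power3_eq_cube)
  also have "\<dots> \<le> 1" using power_le_one[of \<theta> 4] power_le_one[of \<theta> 3] \<theta> by simp
  finally show ?thesis by (simp add: R_def L_def)
qed

lemma projection_contains_ball:
  assumes n: "n \<ge> 1" and K: "symmetric_convex_body n K" and e: "orthonormal_basis n e"
    and \<theta>: "0 < \<theta>" "\<theta> < 1"
  shows "\<exists>\<sigma>. \<sigma> \<subseteq> {..<n} \<and> real (card \<sigma>) \<ge> (1 - \<theta>) * real n \<and>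
          (\<lambda>x i. 1 / ((5 * vr n K) powr (8 * ln (2 / \<theta>) / \<theta>) * M_body n K) * x i)
              ` (unit_ball n \<inter> coord_subspace n e \<sigma>)
            \<subseteq> orth_proj n (coord_subspace n e \<sigma>) ` K"
proof -
  define A M where "A = vr n K" and "M = M_body n K"
  obtain Q a where Q: "orth_n n Q" and a: "\<And>i. i < n \<Longrightarrow> a i > 0" and E: "ell n Q a (\<lambda>i. 0) \<subseteq> K"
    and vA: "vol n K = A ^ n * ((\<Prod>i<n. a i) * vol n (unit_ball n))" "A \<ge> 1"
    unfolding A_def using centered_ellipsoid_vr[OF K n] by metis
  have M: "M > 0" and bound: "(\<Prod>i<n. 1 + 1 / (M * a i)) \<le> (5 * A) ^ n"
    using half_axes_product_bound[OF K n Q a E vA] by (simp_all add: M_def)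
  define L where "L = (5 * A) powr (4 / \<theta>)"
  have L: "L > 0" using vA(2) by (simp add: L_def)
  define J where "J = {i. i < n \<and> a i < 1 / (L * M)}"
  have cJ: "real (card J) \<le> \<theta> * n / 4"
    unfolding J_def L_def using few_short_half_axes[OF a M _ \<theta>(1) bound] vA(2) by simp
  have J: "J \<subseteq> {..<n}" by (auto simp: J_def)
  obtain \<tau> where \<tau>: "\<tau> \<subseteq> {..<n}" "real (card \<tau>) \<le> \<theta> * n"
    and corr: "\<And>x. x \<in> Rn n \<Longrightarrow> (\<And>j. j \<in> \<tau> \<Longrightarrow> inner_n n x (e j) = 0) \<Longrightarrow>
      \<exists>y\<in>Rn n. (\<forall>j<n. j \<notin> \<tau> \<longrightarrow> inner_n n y (e j) = 0) \<and>
        (\<forall>i\<in>J. mat_app n (transp Q) (\<lambda>i. x i + y i) i = 0) \<and>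
        inner_n n (\<lambda>i. x i + y i) (\<lambda>i. x i + y i) \<le> (1 + 4 / \<theta>) * inner_n n x x"
    using coordinate_correction[OF e Q J \<theta> cJ] by blast
  define \<sigma> where "\<sigma> = {..<n} - \<tau>"
  define R where "R = 1 / ((5 * A) powr (8 * ln (2 / \<theta>) / \<theta>) * M)"
  have Rpos: "R > 0" using M vA(2) by (simp add: R_def)
  have RL: "(R * (L * M))\<^sup>2 * (1 + 4 / \<theta>) \<le> 1"
    using radius_bound[OF vA(2) \<theta>] M by (simp add: R_def L_def)
  have "card \<sigma> = n - card \<tau>" using \<tau>(1) finite_subset[OF \<tau>(1)] by (simp add: \<sigma>_def card_Diff_subset)
  moreover have "card \<tau> \<le> n" using card_mono[OF _ \<tau>(1)] by simp
  ultimately have "real (card \<sigma>) = real n - real (card \<tau>)" by simp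
  then have c\<sigma>: "real (card \<sigma>) \<ge> (1 - \<theta>) * real n" using \<tau>(2) by (simp add: algebra_simps)
  have "(\<lambda>i. R * u i) \<in> orth_proj n (coord_subspace n e \<sigma>) ` K"
    if u: "u \<in> unit_ball n" "u \<in> coord_subspace n e \<sigma>" for u
  proof -
    have uR: "u \<in> Rn n" using u by (simp add: unit_ball_def)
    have u0: "inner_n n u (e j) = 0" if "j \<in> \<tau>" for j
      using u(2) that \<tau>(1) by (auto simp: coord_subspace_def \<sigma>_def)
    obtain y where y: "y \<in> Rn n" "\<And>j. j < n \<Longrightarrow> j \<notin> \<tau> \<Longrightarrow> inner_n n y (e j) = 0"
      "\<And>i. i \<in> J \<Longrightarrow> mat_app n (transp Q) (\<lambda>i. u i + y i) i = 0"
      "inner_n n (\<lambda>i. u i + y i) (\<lambda>i. u i + y i) \<le> (1 + 4 / \<theta>) * inner_n n u u"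
      using corr[OF uR u0] by blast
    define h where "h = (\<lambda>i. u i + y i)"
    define x where "x = (\<lambda>i. R * h i)"
    have hR: "h \<in> Rn n" using uR y(1) by (simp add: h_def Rn_iff)
    have xR: "x \<in> Rn n" using hR by (simp add: x_def Rn_iff)
    have uu: "inner_n n u u \<le> 1" using u(1) norm_n_le_iff[of 1 n u] by (simp add: unit_ball_def)
    have hh: "inner_n n h h \<le> 1 + 4 / \<theta>"
    proof -
      have "(1 + 4 / \<theta>) * inner_n n u u \<le> (1 + 4 / \<theta>) * 1"
        using uu \<theta> by (intro mult_left_mono) auto
      then show ?thesis using y(4) by (simp add: h_def)
    qed
    \<comment> \<open>The coordinates of \<open>x\<close> in the axes, each divided by its
      half-axis; \<open>x\<close> lies in the ellipsoid when \<open>d\<close> is in the unit ball.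
      On \<open>J\<close> they vanish by the correction, elsewhere \<open>1 / a i\<close> is at most
      \<open>L * M\<close>. The form \<open>- 0 + x i\<close> matches \<open>ell_eq\<close> for the
      centre 0.\<close>
    define d where "d = (\<lambda>i. mat_app n (transp Q) (\<lambda>i. - (0::real) + x i) i / a i)"
    have mx: "mat_app n (transp Q) x = (\<lambda>i. R * mat_app n (transp Q) h i)"
      unfolding x_def by (rule mat_app_lincomb(2))
    have "(norm_n n d)\<^sup>2 \<le> (\<Sum>i<n. ((R * (L * M)) * mat_app n (transp Q) h i)\<^sup>2)"
      unfolding norm_n_sq_sum
    proof (rule sum_mono)
      fix i assume "i \<in> {..<n}"
      then have i: "i < n" by simp
      have di: "d i = R * mat_app n (transp Q) h i / a i" by (simp add: d_def mx)
      show "(d i)\<^sup>2 \<le> ((R * (L * M)) * mat_app n (transp Q) h i)\<^sup>2"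
      proof (cases "i \<in> J")
        case True
        then show ?thesis using y(3) by (simp add: di h_def)
      next
        case False
        then have "1 / (L * M) \<le> a i" using i by (simp add: J_def)
        then have "1 / a i \<le> L * M" using L M a[OF i] by (simp add: field_simps)
        then have "\<bar>R * mat_app n (transp Q) h i\<bar> * (1 / a i) \<le> \<bar>R * mat_app n (transp Q) h i\<bar> * (L * M)"
          by (intro mult_left_mono) auto
        then have "\<bar>d i\<bar> \<le> \<bar>(R * (L * M)) * mat_app n (transp Q) h i\<bar>"
          using a[OF i] L M by (simp add: di abs_mult mult_ac)
        then show ?thesis by (simp add: abs_le_square_iff)
      qed
    qed
    also have "\<dots> = (R * (L * M))\<^sup>2 * (\<Sum>i<n. (mat_app n (transp Q) h i)\<^sup>2)"
      by (simp add: power_mult_distrib sum_distrib_left)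
    also have "(\<Sum>i<n. (mat_app n (transp Q) h i)\<^sup>2) = inner_n n h h"
      using norm_n_mat_app_orth[OF orthogonal_mat_transpose[OF Q] hR]
      by (simp add: norm_n_sq_sum[symmetric] norm_n_sq[symmetric])
    also have "(R * (L * M))\<^sup>2 * inner_n n h h \<le> (R * (L * M))\<^sup>2 * (1 + 4 / \<theta>)"
      using hh by (intro mult_left_mono) auto
    also have "\<dots> \<le> 1\<^sup>2" using RL by simp
    finally have "norm_n n d \<le> 1" by (rule power2_le_imp_le) simp
    moreover have "d \<in> Rn n" using mat_app_Rn by (auto simp: d_def Rn_iff)
    ultimately have "d \<in> unit_ball n" by (simp add: unit_ball_def)
    moreover have "(\<lambda>i. 0) \<in> Rn n" by (simp add: Rn_iff)
    ultimately have "x \<in> ell n Q a (\<lambda>i. 0)"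
      using ell_eq[of n Q a "\<lambda>i. 0", OF Q a] xR by (simp add: d_def)
    then have xK: "x \<in> K" using E by blast
    \<comment> \<open>\<open>y\<close> is supported on \<open>\<tau>\<close>, hence orthogonal to
      the coordinate subspace, so projecting \<open>R * (u + y)\<close> leaves
      \<open>R * u\<close>.\<close>
    have "orth_proj n (coord_subspace n e \<sigma>) x = (\<lambda>i. R * u i)"
    proof (rule orth_proj_eqI)
      show "(\<lambda>i. R * u i) \<in> coord_subspace n e \<sigma>"
        using u(2) by (auto simp: coord_subspace_def Rn_iff inner_n_add)
      fix z assume z: "z \<in> coord_subspace n e \<sigma>"
      then have "z \<in> Rn n" by (simp add: coord_subspace_def)
      then obtain c where c: "z = (\<lambda>i. \<Sum>j<n. c j * e j i)" using e unfolding orthonormal_basis_def by blast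
      have "c j * inner_n n y (e j) = 0" if j: "j < n" for j
      proof (cases "j \<in> \<tau>")
        case True
        then have "inner_n n z (e j) = 0" using z j by (simp add: coord_subspace_def \<sigma>_def)
        moreover have "inner_n n z (e j) = (\<Sum>k<n. c k * (if k = j then 1 else 0))"
          unfolding c inner_n_sum using e j by (intro sum.cong refl) (auto simp: orthonormal_basis_def)
        then have "inner_n n z (e j) = c j" using j by (simp add: indicator_mult_simps)
        ultimately show ?thesis by simp
      next
        case False
        then show ?thesis using y(2)[OF j] by simp
      qed
      then have "inner_n n y z = 0" unfolding c inner_n_sum by (intro sum.neutral) auto
      moreover have "(\<lambda>i. x i - R * u i) = (\<lambda>i. R * y i)"
        by (simp add: x_def h_def algebra_simps)
      ultimately show "inner_n n (\<lambda>i. x i - R * u i) z = 0" by (simp add: inner_n_add)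
    qed
    then show ?thesis using xK by (metis imageI)
  qed
  then have "(\<lambda>x i. R * x i) ` (unit_ball n \<inter> coord_subspace n e \<sigma>) \<subseteq> orth_proj n (coord_subspace n e \<sigma>) ` K"
    by blast
  then show ?thesis using c\<sigma> unfolding R_def A_def M_def by (intro exI[of _ \<sigma>]) (auto simp: \<sigma>_def)
qed

theorem theoremD:
  shows "\<exists>c\<^sub>2 c\<^sub>3 :: real. c\<^sub>2 > 0 \<and> c\<^sub>3 > 0 \<and>
    (\<forall>(n::nat) K e (\<theta>::real).
       n \<ge> 1 \<longrightarrow> symmetric_convex_body n K \<longrightarrow> orthonormal_basis n e \<longrightarrow> 0 < \<theta> \<longrightarrow> \<theta> < 1 \<longrightarrow>
       (\<exists>\<sigma>. \<sigma> \<subseteq> {..<n} \<and> real (card \<sigma>) \<ge> (1 - \<theta>) * real n \<and>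
          (\<lambda>x i. 1 / ((c\<^sub>2 * vr n K) powr (c\<^sub>3 * ln (2 / \<theta>) / \<theta>) * M_body n K) * x i)
              ` (unit_ball n \<inter> coord_subspace n e \<sigma>)
            \<subseteq> orth_proj n (coord_subspace n e \<sigma>) ` K))"
proof (rule exI[of _ "5::real"], rule exI[of _ "8::real"], intro conjI allI impI)
  fix n K e \<theta>
  assume "n \<ge> 1" "symmetric_convex_body n K" "orthonormal_basis n e" "0 < \<theta>" "\<theta> < (1::real)"
  then show "\<exists>\<sigma>. \<sigma> \<subseteq> {..<n} \<and> real (card \<sigma>) \<ge> (1 - \<theta>) * real n \<and>
          (\<lambda>x i. 1 / ((5 * vr n K) powr (8 * ln (2 / \<theta>) / \<theta>) * M_body n K) * x i)
              ` (unit_ball n \<inter> coord_subspace n e \<sigma>)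
            \<subseteq> orth_proj n (coord_subspace n e \<sigma>) ` K"
    by (rule projection_contains_ball)
qed simp_all

end
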